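(* Let $1\le p<\infty$ and let $f\in L^p(\mathbb{R})$. Let $\psi\in L^1(\mathbb{R})$ be such that $\int_{-\infty}^\infty\psi(t)\,dt=1$, $\hat\psi$ is absolutely continuous, $\int_{-\infty}^\infty|s|^{1/p}|\hat\psi(s)|\,ds<\infty$ and $\int_{-\infty}^\infty|s|^{1/p}|\hat\psi\,'(s)|\,ds<\infty$. For each $a>0$ define $\psi_a(x)=\psi(x/a)/a$ and $K_a(s)=\widehat{\psi_a}(s)$. Let $e_x(s)=e^{ixs}$ and $$I_a[f](x)=\frac1{2\pi}\int_{-\infty}^\infty e_xK_a\hat f,\qquad x\in\mathbb{R}.$$ Then $\lim_{a\to0^+}\|f-I_a[f]\|_p=0$.
   Context: $L^p(\mathbb{R})$ consists of complex-valued functions. For $\psi\in L^1(\mathbb{R})$, $\hat\psi(s)=\int_{-\infty}^\infty e^{-ist}\psi(t)\,dt$. For $f\in L^p(\mathbb{R})$, $1\le p<\infty$, let $\Psi_f(s)=\int_{-\infty}^\infty\left(\frac{1-e^{-ist}}{it}\right)f(t)\,dt$ (kernel equal to $s$ at $t=0$), a continuous function which is $O(|s|^{1/p})$. The Fourier transform of $f$ is the distributional derivative $\hat f=\Psi_f'$. For a complex-valued function $g$ of bounded variation on $\mathbb{R}$ with $g(x)=o(|x|^{-1/p})$ as $|x|\to\infty$ (if $p=1$, $g(x)=O(|x|^{-1})$ suffices), the integral (no variable or measure displayed) is defined by $$\int_{-\infty}^\infty g\hat f=\int_{-\infty}^\infty\hat f g:=-\int_{-\infty}^\infty\Psi_f(s)\,dg(s).$$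 Here this is applied with $g=e_xK_a$, which is absolutely continuous, so $dg(s)=g'(s)\,ds$. Absolutely continuous means absolutely continuous on each compact interval. *)

theory Defs
  imports "HOL-Analysis.Analysis"
begin

(* Complex-valued functions on the real line, as representatives: functions equal almost
   everywhere are not identified. *)
definition Lp_space :: "real \<Rightarrow> (real \<Rightarrow> complex) set" where
  "Lp_space p = {f. f \<in> borel_measurable lebesgue \<and>
                    integrable lebesgue (\<lambda>x. norm (f x) powr p)}"

(* Meaningful only on Lp_space p: the Bochner integral of a non-integrable function is 0. *)
definition Lp_norm :: "real \<Rightarrow> (real \<Rightarrow> complex) \<Rightarrow> real" where
  "Lp_norm p f = (LINT x|lebesgue. norm (f x) powr p) powr (1 / p)"

definition fourier_L1 :: "(real \<Rightarrow> complex) \<Rightarrow> real \<Rightarrow> complex" where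
  "fourier_L1 \<psi> s = (LINT t|lebesgue. exp (- (\<i> * of_real (s * t))) * \<psi> t)"

definition Psi_kernel :: "real \<Rightarrow> real \<Rightarrow> complex" where
  "Psi_kernel s t = (if t = 0 then of_real s
                     else (1 - exp (- (\<i> * of_real (s * t)))) / (\<i> * of_real t))"

definition Psi :: "(real \<Rightarrow> complex) \<Rightarrow> real \<Rightarrow> complex" where
  "Psi f s = (LINT t|lebesgue. Psi_kernel s t * f t)"

definition abs_continuous_on_interval :: "real \<Rightarrow> real \<Rightarrow> (real \<Rightarrow> complex) \<Rightarrow> bool" where
  "abs_continuous_on_interval a b g \<longleftrightarrow>
     (\<forall>\<epsilon>>0. \<exists>\<delta>>0. \<forall>D :: (real \<times> real) set.
        finite D \<and> (\<forall>(u, v)\<in>D. a \<le> u \<and> u \<le> v \<and> v \<le> b) \<and>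
        disjoint_family_on (\<lambda>(u, v). {u<..<v}) D \<and>
        (\<Sum>(u, v)\<in>D. v - u) < \<delta>
        \<longrightarrow> (\<Sum>(u, v)\<in>D. norm (g v - g u)) < \<epsilon>)"

definition abs_continuous :: "(real \<Rightarrow> complex) \<Rightarrow> bool" where
  "abs_continuous g \<longleftrightarrow> (\<forall>a b. a \<le> b \<longrightarrow> abs_continuous_on_interval a b g)"

(* The pairing of g with the Fourier transform of f, i.e. minus the Stieltjes integral of Psi f
   against dg, for absolutely continuous g, where dg(s) = g'(s) ds.  The derivative of such a g
   exists almost everywhere; the arbitrary values that vector_derivative takes on the
   exceptional null set do not affect the integral. *)
definition fourier_pairing :: "(real \<Rightarrow> complex) \<Rightarrow> (real \<Rightarrow> complex) \<Rightarrow> complex" where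
  "fourier_pairing g f = - (LINT s|lebesgue. Psi f s * vector_derivative g (at s))"

definition dilate :: "(real \<Rightarrow> complex) \<Rightarrow> real \<Rightarrow> real \<Rightarrow> complex" where
  "dilate \<psi> a x = \<psi> (x / a) / of_real a"

definition summability_kernel :: "(real \<Rightarrow> complex) \<Rightarrow> real \<Rightarrow> real \<Rightarrow> complex" where
  "summability_kernel \<psi> a = fourier_L1 (dilate \<psi> a)"

definition char_fun :: "real \<Rightarrow> real \<Rightarrow> complex" where
  "char_fun x s = exp (\<i> * of_real (x * s))"

definition summability_mean ::
    "(real \<Rightarrow> complex) \<Rightarrow> real \<Rightarrow> (real \<Rightarrow> complex) \<Rightarrow> real \<Rightarrow> complex" where
  "summability_mean \<psi> a f x =
     1 / (2 * of_real pi) * fourier_pairing (\<lambda>s. char_fun x s * summability_kernel \<psi> a s) f"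

end

theory Submission
  imports Defs "HOL-Probability.Characteristic_Functions"
begin

text \<open>Writing \<open>k s t\<close> for the kernel of \<open>\<Psi>\<^bsub>f\<^esub>\<close>, Fubini's theorem and integration by parts in \<open>s\<close>
  (where \<open>\<partial>k/\<partial>s = e\<^bsup>-ist\<^esup>\<close>) turn the pairing of \<open>g\<close> with the Fourier transform of \<open>f\<close> into
  the integral of \<open>f\<close> times the classical Fourier transform of \<open>g\<close>; the bound \<open>\<integral> \<bar>k s t\<bar> * \<bar>f t\<bar> dt = O(\<bar>s\<bar>\<^bsup>1/p\<^esup>)\<close> makes this legitimate. For
  \<open>g = e\<^bsub>x\<^esub> K\<^bsub>a\<^esub>\<close> Fourier inversion identifies \<open>I\<^bsub>a\<^esub>[f]\<close> with the convolution \<open>f * \<psi>\<^bsub>a\<^esub>\<close>, and the claim is that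
  \<open>\<psi>\<^bsub>a\<^esub>\<close> is an approximate identity in \<open>L\<^bsup>p\<^esup>\<close>. Integration by parts needs Lebesgue's theorem that an absolutely continuous
  function is differentiable almost everywhere and is the integral of its derivative; this follows from
  the Vitali covering theorem and a gauge argument.\<close>

section \<open>Absolutely continuous functions\<close>

text \<open>Each weight condition on the transform \<open>K\<close> of \<psi> has its place. The one
  on its derivative matches the growth of the kernel integral and gives absolute convergence for
  Fubini. The one on \<open>K\<close> itself does double duty: differentiating
  \<open>e_x K_a\<close> produces a term with \<open>x * K\<close>, and since \<open>K\<close> is
  bounded near 0 the condition makes \<open>K\<close> integrable, as inversion requires. Boundary
  terms in the integration by parts cannot be handled by pointwise decay, because \<open>g\<close>
  is only known to be integrable; they vanish because their limit exists and they are dominated by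
  an integrable function. Inversion recovers \<psi> only almost everywhere. The convolution is
  therefore formed with the inverse transform of \<open>K\<close>, which is defined at every point,
  so that the formula for the means holds at every \<open>x\<close>. The theorem on approximate
  identities is used twice: with a Gaussian kernel and exponent 1 to prove inversion, then with the
  inverse transform of \<open>K\<close> and exponent \<open>p\<close> for the result.\<close>

lemma division_interval_real:
  fixes D :: "real set set"
  assumes "D division_of S" "k \<in> D"
  obtains u v where "k = {u..v}" "u \<le> v" "Inf k = u" "Sup k = v" "measure lebesgue k = v - u"
proof -
  obtain u v where uv: "k = cbox u v" and ne: "k \<noteq> {}"
    using division_ofD[OF assms(1)] assms(2) by metis
  then have "u \<le> v" by auto
  then show thesis using that[of u v] uv by auto
qed

text \<open>Vitali coverings and tagged divisions both deliver divisions, so the modulus of absolute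
  continuity is recast for them: the smallness condition becomes one on the measure of the divided
  set.\<close>

lemma abs_continuous_division:
  assumes F: "abs_continuous_on_interval a b F" and "\<epsilon> > 0"
  obtains \<delta> where "\<delta> > 0"
    "\<And>D S. \<lbrakk>D division_of S; S \<subseteq> {a..b}; measure lebesgue S < \<delta>\<rbrakk>
       \<Longrightarrow> (\<Sum>k\<in>D. norm (F (Sup k) - F (Inf k))) < \<epsilon>"
proof -
  obtain \<delta> where "\<delta> > 0" and \<delta>0: "\<forall>D. finite D \<and> (\<forall>(u, v)\<in>D. a \<le> u \<and> u \<le> v \<and> v \<le> b) \<and>
        disjoint_family_on (\<lambda>(u, v). {u<..<v}) D \<and> (\<Sum>(u, v)\<in>D. v - u) < \<delta>
        \<longrightarrow> (\<Sum>(u, v)\<in>D. norm (F v - F u)) < \<epsilon>"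
    using F[unfolded abs_continuous_on_interval_def, rule_format, OF \<open>\<epsilon> > 0\<close>] by (elim exE conjE)
  note \<delta> = \<delta>0[rule_format, OF conjI, OF _ conjI, OF _ _ conjI]
  show ?thesis
  proof (rule that[OF \<open>\<delta> > 0\<close>])
    fix D S assume D: "D division_of S" and S: "S \<subseteq> {a..b}" and m: "measure lebesgue S < \<delta>"
    \<comment> \<open>Absolute continuity speaks of a set of endpoint pairs. Passing from intervals
      to pairs is injective, so no term of the sum is lost; degenerate intervals are harmless
      because their open interiors are empty.\<close>
    define h where "h = (\<lambda>k::real set. (Inf k, Sup k))"
    have inj: "inj_on h D"
    proof (rule inj_onI)
      fix k l assume "k \<in> D" "l \<in> D" and h: "h k = h l"
      from division_interval_real[OF D \<open>k \<in> D\<close>] obtain u v where "k = {u..v}" "Inf k = u" "Sup k = v" by metis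
      moreover from division_interval_real[OF D \<open>l \<in> D\<close>] obtain u' v' where "l = {u'..v'}" "Inf l = u'" "Sup l = v'" by metis
      ultimately show "k = l" using h unfolding h_def by simp
    qed
    have sub: "k \<subseteq> {a..b}" if "k \<in> D" for k using division_ofD(2)[OF D that] S by auto
    have "(\<Sum>(u, v)\<in>h ` D. norm (F v - F u)) < \<epsilon>"
    proof (rule \<delta>)
      show "finite (h ` D)" using D by auto
      show "\<forall>(u, v)\<in>h ` D. a \<le> u \<and> u \<le> v \<and> v \<le> b"
      proof clarify
        fix k u v assume k: "k \<in> D" and "(u, v) = h k"
        then have uv: "u = Inf k" "v = Sup k" by (auto simp: h_def)
        obtain u' v' where "k = {u'..v'}" "u' \<le> v'" "Inf k = u'" "Sup k = v'"
          using division_interval_real[OF D k] by metis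
        then show "a \<le> u \<and> u \<le> v \<and> v \<le> b"
          using sub[OF k] uv by (simp add: atLeastatMost_subset_iff)
      qed
      show "disjoint_family_on (\<lambda>(u, v). {u<..<v}) (h ` D)"
        unfolding disjoint_family_on_def
      proof (intro ballI impI)
        fix p q assume "p \<in> h ` D" "q \<in> h ` D" and ne: "p \<noteq> q"
        then obtain k l where k: "k \<in> D" "p = h k" and l: "l \<in> D" "q = h l" by auto
        with ne have "k \<noteq> l" by auto
        then have "interior k \<inter> interior l = {}" using division_ofD(5)[OF D] k l by auto
        moreover have int: "interior m = {Inf m<..<Sup m}" if "m \<in> D" for m
        proof -
          from division_interval_real[OF D \<open>m \<in> D\<close>] obtain u v where "m = {u..v}" "Inf m = u" "Sup m = v"
            by metis
          then show ?thesis using interior_atLeastAtMost_real by simp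
        qed
        ultimately show "(case p of (u, v) \<Rightarrow> {u<..<v}) \<inter> (case q of (u, v) \<Rightarrow> {u<..<v}) = {}"
          using k l int[OF k(1)] int[OF l(1)] by (simp add: h_def)
      qed
      have "(\<Sum>(u, v)\<in>h ` D. v - u) = (\<Sum>k\<in>D. measure lebesgue k)"
        by (subst sum.reindex[OF inj])
           (auto simp: h_def intro!: sum.cong elim!: division_interval_real[OF D])
      then show "(\<Sum>(u, v)\<in>h ` D. v - u) < \<delta>"
        using content_division[OF D] m by simp
    qed
    then show "(\<Sum>k\<in>D. norm (F (Sup k) - F (Inf k))) < \<epsilon>"
      by (subst (asm) sum.reindex[OF inj]) (simp add: h_def)
  qed
qed

lemma sum_division_additive:
  fixes F :: "real \<Rightarrow> 'a::real_normed_vector"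
  assumes D: "D division_of {a..b}" and "a \<le> b"
  shows "(\<Sum>k\<in>D. F (Sup k) - F (Inf k)) = F b - F a"
proof -
  let ?p = "(\<lambda>k. (Inf k, k)) ` D"
  have "?p tagged_division_of {a..b}"
  proof (rule tagged_division_ofI)
    show "finite ?p" using D by auto
  next
    fix x k assume "(x, k) \<in> ?p"
    then have k: "k \<in> D" "x = Inf k" by auto
    show "x \<in> k" using division_interval_real[OF D k(1)] k(2) by (metis atLeastAtMost_iff order_refl)
    show "k \<subseteq> {a..b}" using division_ofD(2)[OF D k(1)] .
    show "\<exists>u v. k = cbox u v" using division_ofD(4)[OF D k(1)] .
  next
    fix x1 k1 x2 k2 assume "(x1, k1) \<in> ?p" "(x2, k2) \<in> ?p" "(x1, k1) \<noteq> (x2, k2)"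
    then show "interior k1 \<inter> interior k2 = {}" using division_ofD(5)[OF D] by auto
  next
    show "\<Union> {k. \<exists>x. (x, k) \<in> ?p} = {a..b}" using division_ofD(6)[OF D] by (simp add: image_iff)
  qed
  from additive_tagged_division_1[OF \<open>a \<le> b\<close> this, of F]
  have "(\<Sum>(x, k)\<in>?p. F (Sup k) - F (Inf k)) = F b - F a" .
  then show ?thesis
    by (subst (asm) sum.reindex) (auto simp: inj_on_def)
qed

section \<open>Differentiability almost everywhere by Vitali coverings\<close>

lemma vitali_finite_division:
  fixes E U :: "real set"
  assumes E: "E \<in> lmeasurable" and U: "open U" "E \<subseteq> U" and "\<epsilon> > 0"
    and P: "\<And>x d. \<lbrakk>x \<in> E; d > 0\<rbrakk> \<Longrightarrow> \<exists>y z. y < x \<and> x < z \<and> z - y < d \<and> P y z"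
  obtains D where "D division_of \<Union>D" "\<Union>D \<subseteq> U" "measure lebesgue (E - \<Union>D) < \<epsilon>"
    "\<And>k. k \<in> D \<Longrightarrow> Inf k < Sup k \<and> P (Inf k) (Sup k)"
proof -
  let ?K = "{(y, z). y < z \<and> {y..z} \<subseteq> U \<and> P y z}"
  \<comment> \<open>Intervals are written as closed balls, which is the form of the covering
    theorem. The point to be covered need only lie in the ball, so intervals straddling it
    asymmetrically are admissible.\<close>
  let ?c = "\<lambda>(y, z). (y + z) / 2 :: real" and ?r = "\<lambda>(y, z). (z - y) / 2 :: real"
  have cb: "cball (?c i) (?r i) = {fst i..snd i}" for i
    by (cases i) (auto simp: cball_eq_atLeastAtMost field_simps)
  obtain C where C: "countable C" "C \<subseteq> ?K"
     and pw: "pairwise (\<lambda>i j. disjnt (cball (?c i) (?r i)) (cball (?c j) (?r j))) C"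
     and neg: "negligible (E - (\<Union>i\<in>C. cball (?c i) (?r i)))"
  proof (rule Vitali_covering_theorem_cballs[of ?K ?r E ?c])
    show "0 < ?r i" if "i \<in> ?K" for i using that by auto
    fix x d :: real assume x: "x \<in> E" "0 < d"
    then obtain e where e: "e > 0" "ball x e \<subseteq> U" using U openE by blast
    obtain y z where yz: "y < x" "x < z" "z - y < min d e" "P y z" using P[OF x(1), of "min d e"] x e by auto
    then have "{y..z} \<subseteq> ball x e" by (auto simp: dist_real_def)
    with yz e show "\<exists>i. i \<in> ?K \<and> x \<in> cball (?c i) (?r i) \<and> ?r i < d"
      by (intro exI[of _ "(y, z)"]) (auto simp: cb[of "(y,z)", simplified])
  qed
  have pw': "{fst i..snd i} \<inter> {fst j..snd j} = {}" if "i \<in> C" "j \<in> C" "i \<noteq> j" for i j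
    using pairwiseD[OF pw that] by (simp only: cb disjnt_def)
  have neg': "negligible (E - (\<Union>i\<in>C. {fst i..snd i}))" using neg by (simp only: cb)
  \<comment> \<open>The dummy pair \<open>(1, 0)\<close> stands for the empty interval
    \<open>{1..0}\<close>: it makes the enumerated set nonempty even if \<open>C\<close> is empty,
    and covers nothing.\<close>
  define I where "I = from_nat_into (insert (1, 0) C)"
  have ran: "range I = insert (1,0) C"
    unfolding I_def using C(1) by (intro range_from_nat_into) auto
  define W where "W n = E - (\<Union>i\<le>n. {fst (I i)..snd (I i)})" for n
  \<comment> \<open>The countable family leaves a null set; continuity of measure from above turns
    this into a small remainder after finitely many intervals.\<close>
  have "(\<lambda>n. measure lebesgue (W n)) \<longlonglongrightarrow> measure lebesgue (\<Inter>n. W n)"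
  proof (rule Lim_measure_decseq)
    have "E \<in> sets lebesgue" using E by auto
    then show "range W \<subseteq> sets lebesgue" by (auto simp: W_def)
    show "decseq W" unfolding decseq_def W_def by fastforce
    fix n
    have "W n \<in> lmeasurable" unfolding W_def using E by (intro fmeasurable.Diff) (auto intro!: fmeasurable.finite_UN)
    then show "emeasure lebesgue (W n) \<noteq> \<infinity>" by (metis fmeasurableD2 infinity_ennreal_def)
  qed
  moreover have "(\<Inter>n. W n) = E - (\<Union>i\<in>C. {fst i..snd i})"
  proof -
    have "(\<Inter>n. W n) = E - (\<Union>i\<in>range I. {fst i..snd i})" unfolding W_def by fastforce
    also have "\<dots> = E - (\<Union>i\<in>C. {fst i..snd i})" unfolding ran by auto
    finally show ?thesis .
  qed
  ultimately have "(\<lambda>n. measure lebesgue (W n)) \<longlonglongrightarrow> 0"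
    using negligible_imp_measure0[OF neg'] by simp
  from order_tendstoD(2)[OF this \<open>\<epsilon> > 0\<close>] obtain n where n: "measure lebesgue (W n) < \<epsilon>"
    by (auto simp: eventually_sequentially)
  define D where "D = (\<lambda>i. {fst i..snd i}) ` (I ` {..n} - {(1,0)})"
  have IC: "I ` {..n} - {(1,0)} \<subseteq> C" using ran by auto
  have UD: "\<Union>D = (\<Union>i\<le>n. {fst (I i)..snd (I i)})"
    unfolding D_def by fastforce
  show thesis
  proof (rule that[of D])
    show "D division_of \<Union>D"
    proof (rule division_ofI)
      show "finite D" by (auto simp: D_def)
      fix k assume "k \<in> D"
      then obtain i where i: "i \<in> C" "k = {fst i..snd i}" using IC by (auto simp: D_def)
      then show "k \<subseteq> \<Union>D" "k \<noteq> {}" "\<exists>a b. k = cbox a b" using \<open>k \<in> D\<close> C(2) by auto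
      fix l assume "l \<in> D" "k \<noteq> l"
      then obtain j where j: "j \<in> C" "l = {fst j..snd j}" using IC by (auto simp: D_def)
      have "k \<inter> l = {}" using pw'[OF i(1) j(1)] i j \<open>k \<noteq> l\<close> by auto
      then show "interior k \<inter> interior l = {}" using interior_subset by blast
    qed simp
    show "\<Union>D \<subseteq> U" using IC C(2) by (fastforce simp: D_def)
    show "measure lebesgue (E - \<Union>D) < \<epsilon>" using n unfolding W_def UD .
    fix k assume "k \<in> D"
    then obtain i where i: "i \<in> C" "k = {fst i..snd i}" using IC by (auto simp: D_def)
    then show "Inf k < Sup k \<and> P (Inf k) (Sup k)" using C(2) by auto
  qed
qed

text \<open>Points straddled by arbitrarily short intervals of slope above \<open>v\<close>.
  Intervals around the point, rather than difference quotients at it, fit Vitali's theorem and make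
  the set Borel. \<open>steep (\<lambda>x. - F x) (- u)\<close> is the mirror notion: arbitrarily
  short straddling intervals of slope below \<open>u\<close>.\<close>

definition steep :: "(real \<Rightarrow> real) \<Rightarrow> real \<Rightarrow> real set" where
  "steep F v = {x. \<forall>d>0. \<exists>y z. y < x \<and> x < z \<and> z - y < d \<and> v * (z - y) < F z - F y}"

text \<open>The set is a countable intersection of open sets: being straddled by one steep interval
  of length below \<open>1 / Suc n\<close> is an open condition.\<close>

lemma borel_steep: "steep F v \<in> sets borel"
proof -
  define W where "W n = \<Union>{{y<..<z} | y z. z - y < 1 / real (Suc n) \<and> v * (z - y) < F z - F y}" for n
  have "open (W n)" for n unfolding W_def by (intro open_Union) auto
  then have "(\<Inter>n. W n) \<in> sets borel" by (intro sets.countable_INT) auto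
  moreover have "steep F v = (\<Inter>n. W n)"
  proof (intro equalityI subsetI)
    fix x assume x: "x \<in> steep F v"
    have "x \<in> W n" for n
    proof -
      have "0 < 1 / real (Suc n)" by simp
      then obtain y z where "y < x" "x < z" "z - y < 1 / real (Suc n)" "v * (z - y) < F z - F y"
        using x unfolding steep_def by blast
      then show ?thesis unfolding W_def by (intro UnionI[of "{y<..<z}"]) auto
    qed
    then show "x \<in> (\<Inter>n. W n)" by blast
  next
    fix x assume x: "x \<in> (\<Inter>n. W n)"
    show "x \<in> steep F v" unfolding steep_def
    proof (intro CollectI allI impI)
      fix d :: real assume "d > 0"
      then obtain n where "1 / real (Suc n) < d" using nat_approx_posE by metis
      moreover have "x \<in> W n" using x by auto
      ultimately show "\<exists>y z. y < x \<and> x < z \<and> z - y < d \<and> v * (z - y) < F z - F y"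
        unfolding W_def by (smt (verit) Union_iff greaterThanLessThan_iff mem_Collect_eq)
    qed
  qed
  ultimately show ?thesis by simp
qed

lemma lmeasurable_borel_Int_interval: "A \<in> sets borel \<Longrightarrow> {a<..<b::real} \<inter> A \<in> lmeasurable"
  by (rule bounded_set_imp_lmeasurable) (use bounded_subset[OF bounded_box[of a b]] in auto)

lemma Union_interior_subset: "\<Union>(interior ` D) \<subseteq> \<Union>D"
  by (auto dest: subsetD[OF interior_subset])

text \<open>Extend \<open>D1\<close> by intervals \<open>A\<close> to a division of
  \<open>{a..b}\<close>, then extend \<open>D2 \<union> A\<close> to another; \<open>R\<close>
  consists of the intervals added last. Both full sums telescope to \<open>G b - G a\<close>, and
  the contribution of \<open>A\<close> cancels. One \<open>R\<close> serves every \<open>G\<close>: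
  the identity yields lengths, \<open>F\<close> yields increments.\<close>

lemma nested_division_remainder:
  fixes D1 D2 :: "real set set"
  assumes "a \<le> b" and D1: "D1 division_of \<Union>D1" "\<Union>D1 \<subseteq> {a..b}"
    and D2: "D2 division_of \<Union>D2" "\<Union>D2 \<subseteq> \<Union>(interior ` D1)" "\<And>k. k \<in> D2 \<Longrightarrow> Inf k < Sup k"
  obtains R where "R division_of \<Union>R" "\<Union>R \<subseteq> {a..b}"
    "\<And>G :: real \<Rightarrow> real. (\<Sum>k\<in>D1. G (Sup k) - G (Inf k)) =
        (\<Sum>k\<in>D2. G (Sup k) - G (Inf k)) + (\<Sum>k\<in>R. G (Sup k) - G (Inf k))"
proof -
  obtain q1 where q1: "D1 \<subseteq> q1" "q1 division_of {a..b}"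
    using partial_division_extend_interval[OF D1(1), of a b] D1(2) by auto
  define A where "A = q1 - D1"
  have dis: "interior k \<inter> interior l = {}" if "k \<in> D2" "l \<in> A" for k l
  proof -
    have "interior j \<inter> interior l = {}" if "j \<in> D1" for j
      using division_ofD(5)[OF q1(2), of j l] that \<open>l \<in> A\<close> q1(1) unfolding A_def by auto
    moreover have "interior k \<subseteq> \<Union>(interior ` D1)" using D2(2) that(1) interior_subset[of k] by auto
    ultimately show ?thesis by fast
  qed
  have DA: "D2 \<union> A division_of \<Union>(D2 \<union> A)"
  proof (rule division_ofI)
    show "finite (D2 \<union> A)" using D2(1) q1(2) by (auto simp: A_def)
    fix k assume k: "k \<in> D2 \<union> A"
    then show "k \<subseteq> \<Union>(D2 \<union> A)" by auto
    show "k \<noteq> {}" "\<exists>a b. k = cbox a b"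
      using k division_ofD(3,4)[OF D2(1)] division_ofD(3,4)[OF q1(2)] by (auto simp: A_def)
    fix l assume l: "l \<in> D2 \<union> A" and "k \<noteq> l"
    consider "k \<in> D2" "l \<in> D2" | "k \<in> D2" "l \<in> A" | "k \<in> A" "l \<in> D2" | "k \<in> q1" "l \<in> q1"
      using k l by (auto simp: A_def)
    then show "interior k \<inter> interior l = {}"
    proof cases
      case 1 then show ?thesis using division_ofD(5)[OF D2(1)] \<open>k \<noteq> l\<close> by auto
    next
      case 2 then show ?thesis by (rule dis)
    next
      case 3 then show ?thesis using dis by (metis inf_commute)
    next
      case 4 then show ?thesis using division_ofD(5)[OF q1(2)] \<open>k \<noteq> l\<close> by auto
    qed
  qed simp
  have "\<Union>(D2 \<union> A) \<subseteq> {a..b}"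
  proof -
    have "\<Union>D2 \<subseteq> \<Union>D1" using D2(2) Union_interior_subset[of D1] by (rule order_trans)
    moreover have "\<Union>A \<subseteq> {a..b}" using division_ofD(6)[OF q1(2)] unfolding A_def by auto
    ultimately show ?thesis using D1(2) by auto
  qed
  then obtain q2 where q2: "D2 \<union> A \<subseteq> q2" "q2 division_of {a..b}"
    using partial_division_extend_interval[OF DA, of a b] by auto
  define R where "R = q2 - (D2 \<union> A)"
  \<comment> \<open>A degenerate interval could belong to both families and then be counted only
    once in the union; nondegeneracy of \<open>D2\<close> excludes this.\<close>
  have disj: "D2 \<inter> A = {}"
  proof (rule ccontr)
    assume "D2 \<inter> A \<noteq> {}"
    then obtain k where k: "k \<in> D2" "k \<in> A" by auto
    then have "interior k = {}" using dis by blast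
    moreover from division_interval_real[OF D2(1) k(1)] obtain u v
      where "k = {u..v}" "Inf k = u" "Sup k = v" by metis
    ultimately show False using D2(3)[OF k(1)] by simp
  qed
  show thesis
  proof (rule that[of R])
    show "R division_of \<Union>R"
      using division_of_subset[OF division_of_union_self[OF q2(2)], of R] unfolding R_def by blast
    show "\<Union>R \<subseteq> {a..b}" using division_ofD(6)[OF q2(2)] unfolding R_def by auto
    fix G :: "real \<Rightarrow> real"
    let ?s = "\<lambda>D. \<Sum>k\<in>D. G (Sup k) - G (Inf k)"
    have fin: "finite D1" "finite A" "finite D2" "finite R"
      using D1(1) D2(1) q1(2) q2(2) by (auto simp: A_def R_def)
    have "?s D1 + ?s A = ?s q1"
      using fin q1(1) by (subst sum.union_disjoint[symmetric]) (auto simp: A_def intro!: sum.cong)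
    moreover have "?s D2 + ?s A + ?s R = ?s q2"
    proof -
      have "?s D2 + ?s A = ?s (D2 \<union> A)" using fin disj by (subst sum.union_disjoint) auto
      moreover have "?s (D2 \<union> A) + ?s R = ?s q2"
        using fin q2(1) by (subst sum.union_disjoint[symmetric]) (auto simp: R_def intro!: sum.cong)
      ultimately show ?thesis by simp
    qed
    ultimately show "?s D1 = ?s D2 + ?s R"
      using sum_division_additive[OF q1(2) \<open>a \<le> b\<close>, of G] sum_division_additive[OF q2(2) \<open>a \<le> b\<close>, of G]
      by simp
  qed
qed

lemma measure_Union_division:
  fixes D :: "real set set"
  assumes "D division_of \<Union>D"
  shows "measure lebesgue (\<Union>D) = (\<Sum>k\<in>D. Sup k - Inf k)"
  using content_division[OF assms] division_interval_real[OF assms]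
  by (metis (mono_tags, lifting) sum.cong)

lemma negligible_Union_division_diff_interior:
  fixes D :: "real set set"
  assumes "D division_of \<Union>D"
  shows "negligible (\<Union>D - \<Union>(interior ` D))"
proof (rule negligible_subset)
  show "negligible (\<Union>k\<in>D. {Inf k, Sup k})" using assms by (intro negligible_Union) auto
  show "\<Union>D - \<Union>(interior ` D) \<subseteq> (\<Union>k\<in>D. {Inf k, Sup k})"
  proof
    fix x assume "x \<in> \<Union>D - \<Union>(interior ` D)"
    then obtain k where k: "k \<in> D" "x \<in> k" "x \<notin> interior k" by auto
    from division_interval_real[OF assms k(1)] obtain u v
      where "k = {u..v}" "Inf k = u" "Sup k = v" by metis
    with k show "x \<in> (\<Union>k\<in>D. {Inf k, Sup k})" by fastforce
  qed
qed

text \<open>No monotonicity is needed here: the intervals of slope below \<open>u\<close> and the intervals of slope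
  above \<open>v\<close> nested in them differ by a set of small measure, on which absolute continuity makes the
  increment of \<open>F\<close> small.\<close>

lemma negligible_steep_gap:
  fixes F :: "real \<Rightarrow> real"
  assumes F: "abs_continuous_on_interval a b (\<lambda>x. of_real (F x))" and "a < b" and "u < v"
  shows "negligible ({a<..<b} \<inter> (steep F v \<inter> steep (\<lambda>x. - F x) (- u)))"
proof -
  define E where "E = {a<..<b} \<inter> (steep F v \<inter> steep (\<lambda>x. - F x) (- u))"
  have E: "E \<in> lmeasurable" unfolding E_def
    by (intro lmeasurable_borel_Int_interval sets.Int borel_steep)
  define m where "m = measure lebesgue E"
  have "m \<ge> 0" by (simp add: m_def)
  \<comment> \<open>The constant collects the errors of replacing the total lengths
    \<open>d1\<close> and \<open>d2\<close> by \<open>m\<close>, at most \<open>2 * e\<close> each,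
    and the increment \<open>e\<close> over the remainder.\<close>
  have est: "(v - u) * m \<le> (2 * \<bar>u\<bar> + 2 * \<bar>v\<bar> + 1) * e" if "e > 0" for e
  proof -
    obtain \<delta> where "\<delta> > 0" and \<delta>: "\<And>D S. \<lbrakk>D division_of S; S \<subseteq> {a..b}; measure lebesgue S < \<delta>\<rbrakk>
       \<Longrightarrow> (\<Sum>k\<in>D. norm (complex_of_real (F (Sup k)) - of_real (F (Inf k)))) < e"
      using abs_continuous_division[OF F \<open>e > 0\<close>] by metis
    \<comment> \<open>The remainder has length \<open>d1 - d2\<close>, which is below
      \<open>(m + \<eta>) - (m - 2 * \<eta>) = 3 * \<eta>\<close>; the factor 3 brings this under
      \<delta>.\<close>
    define \<eta> where "\<eta> = min (\<delta> / 3) e"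
    have \<eta>: "\<eta> > 0" "\<eta> \<le> e" "3 * \<eta> \<le> \<delta>" using \<open>\<delta> > 0\<close> \<open>e > 0\<close> by (auto simp: \<eta>_def)
    obtain T where T: "open T" "E \<subseteq> T" "T - E \<in> lmeasurable" "emeasure lebesgue (T - E) < ennreal \<eta>"
      using sets_lebesgue_outer_open[of E \<eta>] E \<eta> by (auto simp: fmeasurable_def)
    define U where "U = T \<inter> {a<..<b}"
    have U: "open U" "E \<subseteq> U" "U \<subseteq> {a..b}" using T by (auto simp: U_def E_def)
    have Um: "U \<in> lmeasurable" using lmeasurable_borel_Int_interval[of T a b] T(1) by (auto simp: U_def Int_commute)
    have mU: "measure lebesgue U < m + \<eta>"
    proof -
      have "measure lebesgue (T - E) < \<eta>"
        using T(3,4) \<eta>(1) by (simp add: emeasure_eq_measure2 ennreal_less_iff)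
      moreover have "measure lebesgue U \<le> measure lebesgue (E \<union> (T - E))"
        using T(3) E by (intro measure_mono_fmeasurable fmeasurable.Un fmeasurableD[OF Um]) (auto simp: U_def)
      moreover have "measure lebesgue (E \<union> (T - E)) \<le> m + measure lebesgue (T - E)"
        unfolding m_def using T(3) E by (intro measure_Un_le fmeasurableD)
      ultimately show ?thesis by linarith
    qed
    obtain D1 where D1: "D1 division_of \<Union>D1" "\<Union>D1 \<subseteq> U" "measure lebesgue (E - \<Union>D1) < \<eta>"
      "\<And>k. k \<in> D1 \<Longrightarrow> Inf k < Sup k \<and> F (Sup k) - F (Inf k) < u * (Sup k - Inf k)"
    proof (rule vitali_finite_division[OF E U(1,2) \<eta>(1), of "\<lambda>y z. F z - F y < u * (z - y)"])
      fix x d :: real assume x: "x \<in> E" "d > 0"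
      then have "x \<in> steep (\<lambda>x. - F x) (- u)" by (simp add: E_def)
      then obtain y z where "y < x" "x < z" "z - y < d" "- u * (z - y) < - F z - - F y"
        using x unfolding steep_def by blast
      then show "\<exists>y z. y < x \<and> x < z \<and> z - y < d \<and> F z - F y < u * (z - y)"
        by (intro exI[of _ y] exI[of _ z]) auto
    qed auto
    \<comment> \<open>The second covering needs an open set inside the first one. Passing to
      interiors drops only finitely many endpoints and so costs no measure.\<close>
    define O1 where "O1 = \<Union>(interior ` D1)"
    have "open O1" by (auto simp: O1_def)
    have O1: "O1 \<subseteq> \<Union>D1" unfolding O1_def by (rule Union_interior_subset)
    have D1m: "\<Union>D1 \<in> lmeasurable" using D1(1) by (metis lmeasurable_division)
    have O1m: "O1 \<in> lmeasurable"
      using O1 \<open>open O1\<close> D1m by (intro lmeasurable_open bounded_subset[OF _ O1]) (auto intro: elementary_bounded[OF D1(1)])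
    have mE1: "measure lebesgue (E - O1) < \<eta>"
    proof -
      have "measure lebesgue (E - O1) = measure lebesgue (E - \<Union>D1)"
      proof (rule measure_negligible_symdiff)
        show "E - \<Union>D1 \<in> lmeasurable" using E D1m by auto
        show "negligible ((E - \<Union>D1 - (E - O1)) \<union> (E - O1 - (E - \<Union>D1)))"
          by (rule negligible_subset[OF negligible_Union_division_diff_interior[OF D1(1)]])
             (use O1 in \<open>auto simp: O1_def\<close>)
      qed
      then show ?thesis using D1(3) by simp
    qed
    have E1: "E \<inter> O1 \<in> lmeasurable" using E O1m by auto
    obtain D2 where D2: "D2 division_of \<Union>D2" "\<Union>D2 \<subseteq> O1" "measure lebesgue (E \<inter> O1 - \<Union>D2) < \<eta>"
      "\<And>k. k \<in> D2 \<Longrightarrow> Inf k < Sup k \<and> v * (Sup k - Inf k) < F (Sup k) - F (Inf k)"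
    proof (rule vitali_finite_division[OF E1 \<open>open O1\<close> _ \<eta>(1), of "\<lambda>y z. v * (z - y) < F z - F y"])
      fix x d :: real assume x: "x \<in> E \<inter> O1" "d > 0"
      then have "x \<in> steep F v" by (simp add: E_def)
      then show "\<exists>y z. y < x \<and> x < z \<and> z - y < d \<and> v * (z - y) < F z - F y"
        using x unfolding steep_def by blast
    qed auto
    have D2m: "\<Union>D2 \<in> lmeasurable" using D2(1) by (metis lmeasurable_division)
    obtain R where R: "R division_of \<Union>R" "\<Union>R \<subseteq> {a..b}" and RG:
      "\<And>G :: real \<Rightarrow> real. (\<Sum>k\<in>D1. G (Sup k) - G (Inf k)) =
        (\<Sum>k\<in>D2. G (Sup k) - G (Inf k)) + (\<Sum>k\<in>R. G (Sup k) - G (Inf k))"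
    proof (rule nested_division_remainder[of a b D1 D2])
      show "\<Union>D1 \<subseteq> {a..b}" using D1(2) U(3) by (rule order_trans)
      show "\<Union>D2 \<subseteq> \<Union>(interior ` D1)" using D2(2) by (simp only: O1_def)
      show "Inf k < Sup k" if "k \<in> D2" for k using D2(4) that by blast
    qed (use \<open>a < b\<close> D1(1) D2(1) in auto)
    define d1 d2 r where "d1 = measure lebesgue (\<Union>D1)" and "d2 = measure lebesgue (\<Union>D2)"
      and "r = measure lebesgue (\<Union>R)"
    have dr: "d1 = d2 + r"
      using RG[of "\<lambda>x. x"] unfolding d1_def d2_def r_def
      by (simp add: measure_Union_division D1(1) D2(1) R(1))
    have up: "d1 < m + \<eta>"
      using mU measure_mono_fmeasurable[OF D1(2) _ Um] D1m unfolding d1_def by (auto simp: fmeasurableD)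
    have lo: "m < d2 + 2 * \<eta>"
    proof -
      have "m \<le> measure lebesgue (\<Union>D2 \<union> ((E - O1) \<union> (E \<inter> O1 - \<Union>D2)))"
        unfolding m_def using E O1m D2m by (intro measure_mono_fmeasurable) (auto simp: fmeasurableD)
      also have "\<dots> \<le> d2 + measure lebesgue ((E - O1) \<union> (E \<inter> O1 - \<Union>D2))"
        unfolding d2_def using E O1m D2m by (intro measure_Un_le) (auto simp: fmeasurableD)
      also have "measure lebesgue ((E - O1) \<union> (E \<inter> O1 - \<Union>D2)) \<le> measure lebesgue (E - O1) + measure lebesgue (E \<inter> O1 - \<Union>D2)"
        using E O1m D2m by (intro measure_Un_le) (auto simp: fmeasurableD)
      finally show ?thesis using mE1 D2(3) by linarith
    qed
    have r: "0 \<le> r" "r < \<delta>" using dr up lo \<eta> by (auto simp: r_def)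
    have s1: "(\<Sum>k\<in>D1. F (Sup k) - F (Inf k)) \<le> u * d1"
      unfolding d1_def measure_Union_division[OF D1(1)] sum_distrib_left
      by (intro sum_mono) (use D1(4) in \<open>auto intro: less_imp_le\<close>)
    have s2: "v * d2 \<le> (\<Sum>k\<in>D2. F (Sup k) - F (Inf k))"
      unfolding d2_def measure_Union_division[OF D2(1)] sum_distrib_left
      by (intro sum_mono) (use D2(4) in \<open>auto intro: less_imp_le\<close>)
    have s3: "\<bar>\<Sum>k\<in>R. F (Sup k) - F (Inf k)\<bar> < e"
    proof -
      have "\<bar>\<Sum>k\<in>R. F (Sup k) - F (Inf k)\<bar> \<le> (\<Sum>k\<in>R. \<bar>F (Sup k) - F (Inf k)\<bar>)" by (rule sum_abs)
      also have "\<dots> = (\<Sum>k\<in>R. norm (complex_of_real (F (Sup k)) - of_real (F (Inf k))))"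
        by (simp add: of_real_diff[symmetric] del: of_real_diff)
      also have "\<dots> < e" using \<delta>[OF R] r by (simp add: r_def)
      finally show ?thesis .
    qed
    \<comment> \<open>The increments over \<open>D2\<close> exceed slope \<open>v\<close>, those
      over \<open>D1\<close> stay below slope \<open>u\<close>, and the two sums differ by the
      increments over \<open>R\<close>.\<close>
    have "v * d2 \<le> u * d1 + e" using RG[of F] s1 s2 s3 by linarith
    moreover have "\<bar>d2 - m\<bar> \<le> 2 * e" "\<bar>d1 - m\<bar> \<le> 2 * e" using dr up lo r \<eta> by auto
    then have "\<bar>v * (d2 - m)\<bar> \<le> \<bar>v\<bar> * (2 * e)" "\<bar>u * (d1 - m)\<bar> \<le> \<bar>u\<bar> * (2 * e)"
      unfolding abs_mult by (auto intro: mult_left_mono)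
    ultimately show ?thesis by (simp add: algebra_simps)
  qed
  have "(v - u) * m \<le> 0"
  proof (rule field_le_epsilon)
    fix e :: real assume "e > 0"
    then show "(v - u) * m \<le> 0 + e"
      using est[of "e / (2 * \<bar>u\<bar> + 2 * \<bar>v\<bar> + 1)"] by (simp add: divide_simps split: if_splits)
  qed
  then have "m = 0" using \<open>u < v\<close> \<open>m \<ge> 0\<close> by (simp add: mult_le_0_iff)
  then show ?thesis using E unfolding E_def m_def by (simp add: negligible_iff_measure)
qed

text \<open>A Chebyshev argument: disjoint intervals of slope above \<open>n\<close> covering all
  but \<open>1 / n\<close> of the set have total increment at least \<open>n * m - 1\<close>, which
  the hypothesis keeps below 1. Hence \<open>m\<close> is at most \<open>2 / n\<close> for every
  positive \<open>n\<close>.\<close>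

lemma negligible_steep_infinite_local:
  fixes F :: "real \<Rightarrow> real"
  assumes D: "\<And>D. D division_of \<Union>D \<Longrightarrow> \<Union>D \<subseteq> {c<..<d} \<Longrightarrow> (\<Sum>k\<in>D. F (Sup k) - F (Inf k)) \<le> 1"
  shows "negligible ({c<..<d} \<inter> (\<Inter>n. steep F (real n)))"
proof -
  define E where "E = {c<..<d} \<inter> (\<Inter>n. steep F (real n))"
  have E: "E \<in> lmeasurable" unfolding E_def
    by (intro lmeasurable_borel_Int_interval sets.countable_INT) (auto simp: borel_steep)
  define m where "m = measure lebesgue E"
  have est: "real n * (m - 1 / real n) \<le> 1" if "n > 0" for n
  proof -
    obtain D1 where D1: "D1 division_of \<Union>D1" "\<Union>D1 \<subseteq> {c<..<d}" "measure lebesgue (E - \<Union>D1) < 1 / real n"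
      "\<And>k. k \<in> D1 \<Longrightarrow> Inf k < Sup k \<and> real n * (Sup k - Inf k) < F (Sup k) - F (Inf k)"
    proof (rule vitali_finite_division[OF E open_greaterThanLessThan, of c d "1 / real n" "\<lambda>y z. real n * (z - y) < F z - F y"])
      fix x d :: real assume x: "x \<in> E" "d > 0"
      then have "x \<in> steep F (real n)" by (auto simp: E_def)
      then show "\<exists>y z. y < x \<and> x < z \<and> z - y < d \<and> real n * (z - y) < F z - F y"
        using x unfolding steep_def by blast
    qed (use \<open>n > 0\<close> in \<open>auto simp: E_def\<close>)
    have D1m: "\<Union>D1 \<in> lmeasurable" using D1(1) by (metis lmeasurable_division)
    have "m \<le> measure lebesgue (\<Union>D1 \<union> (E - \<Union>D1))"
      unfolding m_def using E D1m by (intro measure_mono_fmeasurable) (auto simp: fmeasurableD)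
    also have "\<dots> \<le> measure lebesgue (\<Union>D1) + measure lebesgue (E - \<Union>D1)"
      using E D1m by (intro measure_Un_le) (auto simp: fmeasurableD)
    finally have "m - 1 / real n \<le> measure lebesgue (\<Union>D1)" using D1(3) by linarith
    then have "real n * (m - 1 / real n) \<le> real n * measure lebesgue (\<Union>D1)" by (intro mult_left_mono) auto
    also have "\<dots> \<le> (\<Sum>k\<in>D1. F (Sup k) - F (Inf k))"
      unfolding measure_Union_division[OF D1(1)] sum_distrib_left
      by (intro sum_mono) (use D1(4) in \<open>auto intro: less_imp_le\<close>)
    also have "\<dots> \<le> 1" using D[OF D1(1,2)] .
    finally show ?thesis .
  qed
  have "m \<le> 0"
  proof (rule ccontr)
    assume "\<not> m \<le> 0"
    then obtain n where n: "2 < real n * m" using ex_less_of_nat_mult[of m 2] by auto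
    then have "n > 0" by (cases n) auto
    then show False using est[OF \<open>n > 0\<close>] n by (simp add: algebra_simps)
  qed
  then have "m = 0" using measure_nonneg[of lebesgue E] by (simp add: m_def)
  then show ?thesis using E unfolding E_def m_def by (simp add: negligible_iff_measure)
qed

lemma negligible_steep_infinite:
  fixes F :: "real \<Rightarrow> real"
  assumes F: "abs_continuous_on_interval a b (\<lambda>x. of_real (F x))"
  shows "negligible ({a<..<b} \<inter> (\<Inter>n. steep F (real n)))"
proof -
  obtain \<delta> where "\<delta> > 0" and \<delta>: "\<And>D S. \<lbrakk>D division_of S; S \<subseteq> {a..b}; measure lebesgue S < \<delta>\<rbrakk>
     \<Longrightarrow> (\<Sum>k\<in>D. norm (complex_of_real (F (Sup k)) - of_real (F (Inf k)))) < 1"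
    using abs_continuous_division[OF F zero_less_one] by metis
  \<comment> \<open>Windows of length at most \<open>2 * \<delta> / 3\<close> lie below the
    threshold \<delta> belonging to the bound 1, and those centred at rationals are countably many
    and cover the interval.\<close>
  let ?J = "\<lambda>q. {max a (q - \<delta> / 3)<..<min b (q + \<delta> / 3)}"
  have "negligible (?J q \<inter> (\<Inter>n. steep F (real n)))" for q
  proof (rule negligible_steep_infinite_local)
    fix D assume D: "D division_of \<Union>D" "\<Union>D \<subseteq> ?J q"
    have "measure lebesgue (\<Union>D) \<le> measure lebesgue {q - \<delta> / 3<..<q + \<delta> / 3}"
      using D lmeasurable_division[OF D(1)] by (intro measure_mono_fmeasurable) (auto simp: fmeasurableD)
    then have m: "measure lebesgue (\<Union>D) < \<delta>" using \<open>\<delta> > 0\<close> by simp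
    have "(\<Sum>k\<in>D. F (Sup k) - F (Inf k)) \<le> (\<Sum>k\<in>D. norm (complex_of_real (F (Sup k)) - of_real (F (Inf k))))"
      by (intro sum_mono) (simp add: of_real_diff[symmetric] del: of_real_diff)
    also have "\<dots> < 1" using D m by (intro \<delta>) auto
    finally show "(\<Sum>k\<in>D. F (Sup k) - F (Inf k)) \<le> 1" by simp
  qed
  then have "negligible (\<Union>q\<in>\<rat>. ?J q \<inter> (\<Inter>n. steep F (real n)))"
    by (intro negligible_countable_Union) (auto intro: countable_rat)
  moreover have "{a<..<b} \<inter> (\<Inter>n. steep F (real n)) \<subseteq> (\<Union>q\<in>\<rat>. ?J q \<inter> (\<Inter>n. steep F (real n)))"
  proof
    fix x assume x: "x \<in> {a<..<b} \<inter> (\<Inter>n. steep F (real n))"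
    obtain q where "q \<in> \<rat>" "x - \<delta> / 3 < q" "q < x + \<delta> / 3"
      using Rats_dense_in_real[of "x - \<delta> / 3" "x + \<delta> / 3"] \<open>\<delta> > 0\<close> by auto
    with x show "x \<in> (\<Union>q\<in>\<rat>. ?J q \<inter> (\<Inter>n. steep F (real n)))" by (auto intro!: bexI[of _ q])
  qed
  ultimately show ?thesis by (rule negligible_subset)
qed

text \<open>The derivative is the supremum of the \<open>v\<close> for which \<open>x\<close> is
  steep. The bounds \<open>n\<close> and \<open>m\<close> make it finite, and the gap condition
  prevents the lower straddled slopes from staying below it. Continuity at \<open>x\<close> then
  passes from straddling intervals to intervals with endpoint \<open>x\<close>.\<close>

lemma differentiable_if_not_steep:
  fixes F :: "real \<Rightarrow> real"
  assumes cont: "isCont F x"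
    and gap: "\<And>u v. \<lbrakk>u \<in> \<rat>; v \<in> \<rat>; u < v; x \<in> steep F v\<rbrakk> \<Longrightarrow> x \<notin> steep (\<lambda>x. - F x) (- u)"
    and up: "x \<notin> steep F (real n)" and lo: "x \<notin> steep (\<lambda>x. - F x) (real m)"
  shows "F differentiable (at x)"
proof -
  have upD: "\<exists>d>0. \<forall>y z. y < x \<and> x < z \<and> z - y < d \<longrightarrow> F z - F y \<le> v * (z - y)" if "x \<notin> steep F v" for v
    using that unfolding steep_def mem_Collect_eq by (meson not_less)
  have loD: "\<exists>d>0. \<forall>y z. y < x \<and> x < z \<and> z - y < d \<longrightarrow> u * (z - y) \<le> F z - F y"
    if "x \<notin> steep (\<lambda>x. - F x) (- u)" for u
  proof -
    have eq: "(u * (z - y) \<le> F z - F y) \<longleftrightarrow> \<not> (- u * (z - y) < - F z - - F y)" for y z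
      by auto
    show ?thesis using that unfolding steep_def mem_Collect_eq eq by meson
  qed
  have mono: "x \<in> steep F v'" if "x \<in> steep F v" "v' \<le> v" for v v'
  proof -
    have "\<exists>y z. y < x \<and> x < z \<and> z - y < d \<and> v' * (z - y) < F z - F y" if "d > 0" for d
    proof -
      obtain y z where yz: "y < x" "x < z" "z - y < d" "v * (z - y) < F z - F y"
        using \<open>x \<in> steep F v\<close> \<open>d > 0\<close> unfolding steep_def by auto
      moreover have "v' * (z - y) \<le> v * (z - y)" using \<open>v' \<le> v\<close> yz by (intro mult_right_mono) auto
      then have "v' * (z - y) < F z - F y" using yz(4) by (rule le_less_trans)
      ultimately show ?thesis by blast
    qed
    then show ?thesis by (auto simp: steep_def)
  qed
  define S where "S = {v. x \<in> steep F v}"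
  have bdd: "bdd_above S"
  proof (rule bdd_aboveI)
    fix v assume "v \<in> S"
    then show "v \<le> real n" using up mono[of v "real n"] unfolding S_def by (cases "v \<le> real n") auto
  qed
  have ne: "S \<noteq> {}"
  proof -
    obtain d where d: "d > 0" "\<And>y z. y < x \<and> x < z \<and> z - y < d \<Longrightarrow> - real m * (z - y) \<le> F z - F y"
      using loD[of "- real m"] lo by auto
    have "x \<in> steep F (- real m - 1)" unfolding steep_def
    proof (intro CollectI allI impI)
      fix e :: real assume "e > 0"
      define h where "h = min d e / 4"
      have h: "h > 0" "2 * h < d" "2 * h < e" using d \<open>e > 0\<close> by (auto simp: h_def)
      have "- real m * (x + h - (x - h)) \<le> F (x + h) - F (x - h)" using d(2)[of "x - h" "x + h"] h by simp
      then show "\<exists>y z. y < x \<and> x < z \<and> z - y < e \<and> (- real m - 1) * (z - y) < F z - F y"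
        using h by (intro exI[of _ "x - h"] exI[of _ "x + h"]) (auto simp: algebra_simps)
    qed
    then show ?thesis by (auto simp: S_def)
  qed
  define A where "A = Sup S"
  have straddle: "\<exists>d>0. \<forall>y z. y < x \<and> x < z \<and> z - y < d \<longrightarrow> \<bar>F z - F y - A * (z - y)\<bar> \<le> e * (z - y)"
    if "e > 0" for e
  proof -
    have "A + e \<notin> S" using cSup_upper[OF _ bdd, of "A + e"] \<open>e > 0\<close> by (auto simp: A_def)
    then obtain d1 where d1: "d1 > 0" "\<And>y z. y < x \<and> x < z \<and> z - y < d1 \<Longrightarrow> F z - F y \<le> (A + e) * (z - y)"
      using upD[of "A + e"] by (auto simp: S_def)
    \<comment> \<open>Two rationals are inserted below the supremum: \<open>v\<close> is still
      exceeded by straddling slopes, so the gap condition for \<open>u\<close> and \<open>v\<close>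
      bounds all short slopes below by \<open>u\<close>, which is within \<open>e\<close> of the
      supremum.\<close>
    obtain u where u: "u \<in> \<rat>" "A - e < u" "u < A" using Rats_dense_in_real[of "A - e" A] \<open>e > 0\<close> by auto
    obtain v where v: "v \<in> \<rat>" "u < v" "v < A" using Rats_dense_in_real[of u A] u by auto
    obtain s where "s \<in> S" "v < s" using less_cSupE[OF _ ne, of v] v unfolding A_def by auto
    then have "x \<in> steep F v" using mono[of s v] by (auto simp: S_def)
    then have "x \<notin> steep (\<lambda>x. - F x) (- u)" using gap u v by auto
    then obtain d2 where d2: "d2 > 0" "\<And>y z. y < x \<and> x < z \<and> z - y < d2 \<Longrightarrow> u * (z - y) \<le> F z - F y"
      using loD[of u] by auto
    show ?thesis
    proof (intro exI[of _ "min d1 d2"] conjI allI impI)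
      fix y z assume yz: "y < x \<and> x < z \<and> z - y < min d1 d2"
      have "(A - e) * (z - y) \<le> u * (z - y)" using yz u by (intro mult_right_mono) auto
      moreover have "u * (z - y) \<le> F z - F y" using d2(2)[of y z] yz by auto
      ultimately have "(A - e) * (z - y) \<le> F z - F y" by (rule order_trans)
      moreover have "F z - F y \<le> (A + e) * (z - y)" using d1(2)[of y z] yz by auto
      ultimately show "\<bar>F z - F y - A * (z - y)\<bar> \<le> e * (z - y)" by (auto simp: algebra_simps)
    qed (use d1 d2 in auto)
  qed
  have lim: "(F \<longlongrightarrow> F x) (at_left x)" "(F \<longlongrightarrow> F x) (at_right x)"
    using cont by (auto simp: isCont_def filterlim_at_split)
  have "(F has_derivative (\<lambda>h. A * h)) (at x)"
    unfolding has_derivative_at_alt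
  proof (intro conjI allI impI)
    show "bounded_linear (\<lambda>h. A * h)" by (rule bounded_linear_mult_right)
    fix e :: real assume "e > 0"
    from straddle[OF this] obtain d where "d > 0" and
      d: "\<forall>y z. y < x \<and> x < z \<and> z - y < d \<longrightarrow> \<bar>F z - F y - A * (z - y)\<bar> \<le> e * (z - y)"
      by (elim exE conjE)
    \<comment> \<open>Fix \<open>z\<close> and let the left endpoint tend to \<open>x\<close>; the
      non-strict inequality survives the limit.\<close>
    have right: "\<bar>F z - F x - A * (z - x)\<bar> \<le> e * (z - x)" if z: "x < z" "z < x + d" for z
    proof (rule tendsto_le)
      show "((\<lambda>y. \<bar>F z - F y - A * (z - y)\<bar>) \<longlongrightarrow> \<bar>F z - F x - A * (z - x)\<bar>) (at_left x)"
        by (intro tendsto_intros lim)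
      show "((\<lambda>y. e * (z - y)) \<longlongrightarrow> e * (z - x)) (at_left x)" by (intro tendsto_intros)
      have "\<forall>\<^sub>F y in at_left x. y \<in> {z - d<..<x}" using z by (intro eventually_at_leftI) auto
      then show "\<forall>\<^sub>F y in at_left x. \<bar>F z - F y - A * (z - y)\<bar> \<le> e * (z - y)"
        by eventually_elim (use d z in auto)
    qed simp
    have left: "\<bar>F x - F y - A * (x - y)\<bar> \<le> e * (x - y)" if y: "y < x" "x - d < y" for y
    proof (rule tendsto_le)
      show "((\<lambda>z. \<bar>F z - F y - A * (z - y)\<bar>) \<longlongrightarrow> \<bar>F x - F y - A * (x - y)\<bar>) (at_right x)"
        by (intro tendsto_intros lim)
      show "((\<lambda>z. e * (z - y)) \<longlongrightarrow> e * (x - y)) (at_right x)" by (intro tendsto_intros)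
      have "\<forall>\<^sub>F z in at_right x. z \<in> {x<..<y + d}" using y by (intro eventually_at_rightI) auto
      then show "\<forall>\<^sub>F z in at_right x. \<bar>F z - F y - A * (z - y)\<bar> \<le> e * (z - y)"
        by eventually_elim (use d y in auto)
    qed simp
    show "\<exists>d>0. \<forall>y. norm (y - x) < d \<longrightarrow> norm (F y - F x - A * (y - x)) \<le> e * norm (y - x)"
    proof (intro exI[of _ d] conjI allI impI)
      fix y assume y: "norm (y - x) < d"
      consider "y = x" | "y < x" | "x < y" by linarith
      then show "norm (F y - F x - A * (y - x)) \<le> e * norm (y - x)"
      proof cases
        case 2
        then have "\<bar>F x - F y - A * (x - y)\<bar> \<le> e * (x - y)" using left[of y] y by auto
        moreover have "F y - F x - A * (y - x) = - (F x - F y - A * (x - y))" by (simp add: algebra_simps)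
        ultimately show ?thesis using 2 by (simp only: real_norm_def abs_minus_cancel) simp
      next
        case 3
        then show ?thesis using right[of y] y by auto
      qed auto
    qed (use \<open>d > 0\<close> in auto)
  qed
  then show ?thesis by (auto simp: differentiable_def)
qed

lemma abs_continuous_on_interval_isCont:
  assumes F: "abs_continuous_on_interval a b F" and x: "a < x" "x < b"
  shows "isCont F x"
  unfolding isCont_def LIM_eq
proof (intro allI impI)
  fix e :: real assume "e > 0"
  then obtain \<delta> where "\<delta> > 0" and \<delta>: "\<forall>D. finite D \<and> (\<forall>(u, v)\<in>D. a \<le> u \<and> u \<le> v \<and> v \<le> b) \<and>
        disjoint_family_on (\<lambda>(u, v). {u<..<v}) D \<and> (\<Sum>(u, v)\<in>D. v - u) < \<delta>
        \<longrightarrow> (\<Sum>(u, v)\<in>D. norm (F v - F u)) < e"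
    using F[unfolded abs_continuous_on_interval_def, rule_format, OF \<open>e > 0\<close>] by (elim exE conjE)
  define s where "s = min \<delta> (min (x - a) (b - x))"
  have s: "s > 0" using \<open>\<delta> > 0\<close> x by (auto simp: s_def)
  show "\<exists>s>0. \<forall>y. y \<noteq> x \<and> norm (y - x) < s \<longrightarrow> norm (F y - F x) < e"
  proof (intro exI[of _ s] conjI allI impI s)
    fix y assume y: "y \<noteq> x \<and> norm (y - x) < s"
    have "(\<Sum>(u, v)\<in>{(min x y, max x y)}. norm (F v - F u)) < e"
      using y by (intro \<delta>[rule_format]) (auto simp: s_def disjoint_family_on_def)
    then show "norm (F y - F x) < e" 
      by (cases "x < y") (auto simp: norm_minus_commute max_def min_def split: if_splits)
  qed
qed

lemma abs_continuous_real_differentiable: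
  fixes F :: "real \<Rightarrow> real"
  assumes F: "abs_continuous_on_interval a b (\<lambda>x. of_real (F x))" and "a < b"
  obtains N where "negligible N" "\<And>x. \<lbrakk>a < x; x < b; x \<notin> N\<rbrakk> \<Longrightarrow> F differentiable (at x)"
proof -
  have F': "abs_continuous_on_interval a b (\<lambda>x. of_real (- F x))"
    using F unfolding abs_continuous_on_interval_def by (simp add: norm_minus_commute)
  define G where "G = (\<lambda>(u, v). {a<..<b} \<inter> (steep F v \<inter> steep (\<lambda>x. - F x) (- u)))"
  \<comment> \<open>Restricting the slopes to rational pairs keeps the union countable. The other
    two sets collect the points of infinite upward or downward slope.\<close>
  define N where "N = \<Union>(G ` {(u, v) \<in> \<rat> \<times> \<rat>. u < v})
    \<union> ({a<..<b} \<inter> (\<Inter>n. steep F (real n))) \<union> ({a<..<b} \<inter> (\<Inter>n. steep (\<lambda>x. - F x) (real n)))"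
  show thesis
  proof (rule that[of N])
    show "negligible N" unfolding N_def
    proof (intro negligible_Un negligible_countable_Union negligible_steep_infinite F F' countable_image)
      show "countable {(u, v) \<in> \<rat> \<times> \<rat>. u < (v::real)}"
        by (rule countable_subset[of _ "\<rat> \<times> \<rat>"]) (auto intro: countable_rat)
      show "negligible A" if "A \<in> G ` {(u, v) \<in> \<rat> \<times> \<rat>. u < v}" for A
        using that by (auto simp: G_def intro: negligible_steep_gap[OF F \<open>a < b\<close>])
    qed
    fix x assume x: "a < x" "x < b" "x \<notin> N"
    have "isCont (\<lambda>x. Re (complex_of_real (F x))) x"
      by (intro continuous_Re abs_continuous_on_interval_isCont[OF F x(1,2)])
    then have "isCont F x" by simp
    moreover have "\<exists>n. x \<notin> steep F (real n)" "\<exists>m. x \<notin> steep (\<lambda>x. - F x) (real m)"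
      using x unfolding N_def by auto
    moreover have "x \<notin> steep (\<lambda>x. - F x) (- u)" if "u \<in> \<rat>" "v \<in> \<rat>" "u < v" "x \<in> steep F v" for u v
    proof
      assume "x \<in> steep (\<lambda>x. - F x) (- u)"
      then have "x \<in> G (u, v)" using x that by (simp add: G_def)
      then have "x \<in> N" using that unfolding N_def
        by (intro UnI1 UnionI[of "G (u, v)"] imageI) simp_all
      then show False using x by simp
    qed
    ultimately show "F differentiable (at x)"
      using differentiable_if_not_steep[of x F] by blast
  qed
qed

section \<open>Products, dilations and complex-valued functions\<close>

lemma abs_continuous_on_interval_dominated:
  assumes F: "abs_continuous_on_interval a b F"
    and G: "\<And>u v. \<lbrakk>a \<le> u; u \<le> v; v \<le> b\<rbrakk> \<Longrightarrow> norm (G v - G u) \<le> C * norm (F v - F u) + L * (v - u)"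
    and "C > 0" "L > 0"
  shows "abs_continuous_on_interval a b G"
  unfolding abs_continuous_on_interval_def
proof (intro allI impI)
  fix e :: real assume "e > 0"
  then have "e / (2 * C) > 0" using \<open>C > 0\<close> by simp
  from F[unfolded abs_continuous_on_interval_def, rule_format, OF this] obtain \<delta> where "\<delta> > 0" and
    \<delta>: "\<forall>D. finite D \<and> (\<forall>(u, v)\<in>D. a \<le> u \<and> u \<le> v \<and> v \<le> b) \<and>
        disjoint_family_on (\<lambda>(u, v). {u<..<v}) D \<and> (\<Sum>(u, v)\<in>D. v - u) < \<delta>
        \<longrightarrow> (\<Sum>(u, v)\<in>D. norm (F v - F u)) < e / (2 * C)"
    by (elim exE conjE)
  show "\<exists>\<delta>>0. \<forall>D. finite D \<and> (\<forall>(u, v)\<in>D. a \<le> u \<and> u \<le> v \<and> v \<le> b) \<and>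
        disjoint_family_on (\<lambda>(u, v). {u<..<v}) D \<and> (\<Sum>(u, v)\<in>D. v - u) < \<delta>
        \<longrightarrow> (\<Sum>(u, v)\<in>D. norm (G v - G u)) < e"
  proof (intro exI[of _ "min \<delta> (e / (2 * L))"] conjI allI impI)
    show "0 < min \<delta> (e / (2 * L))" using \<open>\<delta> > 0\<close> \<open>e > 0\<close> \<open>L > 0\<close> by simp
    fix D :: "(real \<times> real) set"
    assume D: "finite D \<and> (\<forall>(u, v)\<in>D. a \<le> u \<and> u \<le> v \<and> v \<le> b) \<and>
        disjoint_family_on (\<lambda>(u, v). {u<..<v}) D \<and> (\<Sum>(u, v)\<in>D. v - u) < min \<delta> (e / (2 * L))"
    then have 1: "(\<Sum>(u, v)\<in>D. norm (F v - F u)) < e / (2 * C)" using \<delta> by simp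
    have "(\<Sum>(u, v)\<in>D. norm (G v - G u)) \<le> (\<Sum>(u, v)\<in>D. C * norm (F v - F u) + L * (v - u))"
      using D G by (intro sum_mono) auto
    also have "\<dots> = C * (\<Sum>(u, v)\<in>D. norm (F v - F u)) + L * (\<Sum>(u, v)\<in>D. v - u)"
      by (simp add: sum.distrib sum_distrib_left case_prod_unfold)
    also have "\<dots> < C * (e / (2 * C)) + L * (e / (2 * L))"
      using 1 D \<open>C > 0\<close> \<open>L > 0\<close> by (intro add_strict_mono mult_strict_left_mono) auto
    also have "\<dots> = e" using \<open>C > 0\<close> \<open>L > 0\<close> by simp
    finally show "(\<Sum>(u, v)\<in>D. norm (G v - G u)) < e" .
  qed
qed

lemma abs_continuous_isCont:
  assumes "abs_continuous F"
  shows "isCont F x"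
  using assms abs_continuous_on_interval_isCont[of "x - 1" "x + 1" F x]
  by (simp add: abs_continuous_def)

lemma abs_continuous_mult_Lipschitz:
  assumes F: "abs_continuous F"
    and m: "\<And>a b. \<exists>L. \<forall>u\<in>{a..b}. \<forall>v\<in>{a..b}. norm (m v - m u) \<le> L * \<bar>v - u\<bar>"
  shows "abs_continuous (\<lambda>x. m x * F x)"
  unfolding abs_continuous_def
proof (intro allI impI)
  fix a b :: real assume "a \<le> b"
  have "compact (F ` {a..b})"
    using abs_continuous_isCont[OF F] by (intro compact_continuous_image continuous_at_imp_continuous_on) auto
  then obtain B where B: "B > 0" "\<And>x. x \<in> {a..b} \<Longrightarrow> norm (F x) \<le> B"
    using compact_imp_bounded bounded_pos by (metis imageI)
  obtain L0 where L0: "\<And>u v. u \<in> {a..b} \<Longrightarrow> v \<in> {a..b} \<Longrightarrow> norm (m v - m u) \<le> L0 * \<bar>v - u\<bar>"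
    using m[of a b] by metis
  \<comment> \<open>The given Lipschitz constant may be zero or negative, while the domination
    criterion asks for positive constants; the summand 1 in \<open>M\<close> below serves the same
    purpose.\<close>
  define L where "L = max 1 L0"
  have L: "L > 0" by (simp add: L_def)
  have mL: "norm (m v - m u) \<le> L * \<bar>v - u\<bar>" if "u \<in> {a..b}" "v \<in> {a..b}" for u v
  proof -
    have "L0 * \<bar>v - u\<bar> \<le> L * \<bar>v - u\<bar>" by (intro mult_right_mono) (auto simp: L_def)
    with L0[OF that] show ?thesis by linarith
  qed
  define M where "M = norm (m a) + L * (b - a) + 1"
  have M: "norm (m v) \<le> M" if "v \<in> {a..b}" for v
  proof -
    have "norm (m v) \<le> norm (m a) + norm (m v - m a)" by (metis norm_triangle_sub)
    also have "norm (m v - m a) \<le> L * \<bar>v - a\<bar>" using that by (intro mL) auto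
    also have "\<dots> \<le> L * (b - a)" using L that by (intro mult_left_mono) auto
    finally show ?thesis by (simp add: M_def)
  qed
  have "M > 0" using L \<open>a \<le> b\<close> by (auto simp: M_def intro!: add_nonneg_pos mult_nonneg_nonneg)
  show "abs_continuous_on_interval a b (\<lambda>x. m x * F x)"
  proof (rule abs_continuous_on_interval_dominated)
    show "abs_continuous_on_interval a b F" using F \<open>a \<le> b\<close> by (simp add: abs_continuous_def)
    show "M > 0" by fact
    show "L * B > 0" using L B by simp
    fix u v assume uv: "a \<le> u" "u \<le> v" "v \<le> b"
    have "m v * F v - m u * F u = m v * (F v - F u) + (m v - m u) * F u" by (simp add: algebra_simps)
    then have "norm (m v * F v - m u * F u) \<le> norm (m v) * norm (F v - F u) + norm (m v - m u) * norm (F u)"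
      by (metis norm_mult norm_triangle_ineq)
    also have "\<dots> \<le> M * norm (F v - F u) + (L * \<bar>v - u\<bar>) * B"
      using uv L by (intro add_mono mult_mono M mL B mult_nonneg_nonneg less_imp_le[OF \<open>M > 0\<close>]) auto
    finally show "norm (m v * F v - m u * F u) \<le> M * norm (F v - F u) + L * B * (v - u)"
      using uv by (simp add: algebra_simps)
  qed
qed

lemma abs_continuous_scale:
  assumes F: "abs_continuous F" and "c > 0"
  shows "abs_continuous (\<lambda>x. F (c * x))"
  unfolding abs_continuous_def abs_continuous_on_interval_def
proof (intro allI impI)
  fix a b e :: real assume "a \<le> b" "e > 0"
  then have "abs_continuous_on_interval (c * a) (c * b) F"
    using F \<open>c > 0\<close> by (simp add: abs_continuous_def)
  from this[unfolded abs_continuous_on_interval_def, rule_format, OF \<open>e > 0\<close>] obtain \<delta> where "\<delta> > 0" and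
    \<delta>: "\<forall>D. finite D \<and> (\<forall>(u, v)\<in>D. c * a \<le> u \<and> u \<le> v \<and> v \<le> c * b) \<and>
        disjoint_family_on (\<lambda>(u, v). {u<..<v}) D \<and> (\<Sum>(u, v)\<in>D. v - u) < \<delta>
        \<longrightarrow> (\<Sum>(u, v)\<in>D. norm (F v - F u)) < e"
    by (elim exE conjE)
  show "\<exists>\<delta>>0. \<forall>D. finite D \<and> (\<forall>(u, v)\<in>D. a \<le> u \<and> u \<le> v \<and> v \<le> b) \<and>
        disjoint_family_on (\<lambda>(u, v). {u<..<v}) D \<and> (\<Sum>(u, v)\<in>D. v - u) < \<delta>
        \<longrightarrow> (\<Sum>(u, v)\<in>D. norm (F (c * v) - F (c * u))) < e"
  proof (intro exI[of _ "\<delta> / c"] conjI allI impI)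
    show "\<delta> / c > 0" using \<open>\<delta> > 0\<close> \<open>c > 0\<close> by simp
    fix D :: "(real \<times> real) set"
    assume D: "finite D \<and> (\<forall>(u, v)\<in>D. a \<le> u \<and> u \<le> v \<and> v \<le> b) \<and>
        disjoint_family_on (\<lambda>(u, v). {u<..<v}) D \<and> (\<Sum>(u, v)\<in>D. v - u) < \<delta> / c"
    let ?h = "\<lambda>(u, v). (c * u, c * v)"
    have inj: "inj_on ?h D" using \<open>c > 0\<close> by (auto simp: inj_on_def)
    have "(\<Sum>(u, v)\<in>?h ` D. norm (F v - F u)) < e"
    proof (intro \<delta>[rule_format] conjI)
      show "finite (?h ` D)" using D by auto
      show "\<forall>(u, v)\<in>?h ` D. c * a \<le> u \<and> u \<le> v \<and> v \<le> c * b" using D \<open>c > 0\<close> by auto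
      show "disjoint_family_on (\<lambda>(u, v). {u<..<v}) (?h ` D)"
        unfolding disjoint_family_on_def
      proof (intro ballI impI)
        fix p q assume "p \<in> ?h ` D" "q \<in> ?h ` D" "p \<noteq> q"
        then obtain u v u' v' where uv: "(u, v) \<in> D" "(u', v') \<in> D" "(u, v) \<noteq> (u', v')"
          "p = (c * u, c * v)" "q = (c * u', c * v')" by auto
        then have "{u<..<v} \<inter> {u'<..<v'} = {}" using D unfolding disjoint_family_on_def by fastforce
        moreover have "x / c \<in> {u<..<v}" if "x \<in> {c * u<..<c * v}" for x u v
          using that \<open>c > 0\<close> by (simp add: field_simps)
        ultimately show "(case p of (u, v) \<Rightarrow> {u<..<v}) \<inter> (case q of (u, v) \<Rightarrow> {u<..<v}) = {}"
          unfolding uv prod.case by blast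
      qed
      have "(\<Sum>(u, v)\<in>?h ` D. v - u) = c * (\<Sum>(u, v)\<in>D. v - u)"
        by (subst sum.reindex[OF inj]) (simp add: case_prod_unfold sum_distrib_left right_diff_distrib)
      then show "(\<Sum>(u, v)\<in>?h ` D. v - u) < \<delta>" using D \<open>c > 0\<close> by (simp add: field_simps)
    qed
    then show "(\<Sum>(u, v)\<in>D. norm (F (c * v) - F (c * u))) < e"
      by (subst (asm) sum.reindex[OF inj]) (simp add: case_prod_unfold)
  qed
qed

lemma abs_continuous_differentiable:
  assumes F: "abs_continuous F"
  obtains N where "negligible N" "\<And>x. x \<notin> N \<Longrightarrow> (F has_vector_derivative vector_derivative F (at x)) (at x)"
proof -
  have F': "abs_continuous_on_interval (- real n) (real n) F" for n
    using F by (simp add: abs_continuous_def)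
  have Re: "abs_continuous_on_interval (- real n) (real n) (\<lambda>x. of_real (Re (F x)))" for n
    by (rule abs_continuous_on_interval_dominated[OF F', of n _ 1 1])
       (auto simp: of_real_diff[symmetric] minus_complex.simps[symmetric] simp del: of_real_diff minus_complex.simps
          intro!: add_increasing2 abs_Re_le_cmod)
  have Im: "abs_continuous_on_interval (- real n) (real n) (\<lambda>x. of_real (Im (F x)))" for n
    by (rule abs_continuous_on_interval_dominated[OF F', of n _ 1 1])
       (auto simp: of_real_diff[symmetric] minus_complex.simps[symmetric] simp del: of_real_diff minus_complex.simps
          intro!: add_increasing2 abs_Im_le_cmod)
  have "\<exists>N. negligible N \<and> (\<forall>x. - real (Suc n) < x \<and> x < real (Suc n) \<and> x \<notin> N \<longrightarrow> (\<lambda>x. Re (F x)) differentiable (at x))" for n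
    using abs_continuous_real_differentiable[OF Re[of "Suc n"]] by (metis less_minus_iff minus_zero of_nat_0_less_iff order_less_trans zero_less_Suc neg_less_0_iff_less)
  then obtain N1 where N1: "\<And>n. negligible (N1 n)" "\<And>n x. - real (Suc n) < x \<Longrightarrow> x < real (Suc n) \<Longrightarrow> x \<notin> N1 n \<Longrightarrow> (\<lambda>x. Re (F x)) differentiable (at x)"
    by metis
  have "\<exists>N. negligible N \<and> (\<forall>x. - real (Suc n) < x \<and> x < real (Suc n) \<and> x \<notin> N \<longrightarrow> (\<lambda>x. Im (F x)) differentiable (at x))" for n
    using abs_continuous_real_differentiable[OF Im[of "Suc n"]] by (metis less_minus_iff minus_zero of_nat_0_less_iff order_less_trans zero_less_Suc neg_less_0_iff_less)
  then obtain N2 where N2: "\<And>n. negligible (N2 n)" "\<And>n x. - real (Suc n) < x \<Longrightarrow> x < real (Suc n) \<Longrightarrow> x \<notin> N2 n \<Longrightarrow> (\<lambda>x. Im (F x)) differentiable (at x)"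
    by metis
  show thesis
  proof (rule that[of "(\<Union>n. N1 n \<union> N2 n)"])
    show "negligible (\<Union>n. N1 n \<union> N2 n)" using N1(1) N2(1) by (intro negligible_countable_Union) auto
    fix x assume x: "x \<notin> (\<Union>n. N1 n \<union> N2 n)"
    obtain n where "\<bar>x\<bar> < real n" using reals_Archimedean2 by blast
    then have n: "- real (Suc n) < x" "x < real (Suc n)" by auto
    obtain u v where u: "((\<lambda>x. Re (F x)) has_real_derivative u) (at x)"
      and v: "((\<lambda>x. Im (F x)) has_real_derivative v) (at x)"
      using N1(2)[OF n] N2(2)[OF n] x by (auto simp: real_differentiable_def)
    have "((\<lambda>x. of_real (Re (F x)) + \<i> * of_real (Im (F x))) has_vector_derivative (of_real u + \<i> * of_real v)) (at x)"
      using u v by (intro has_vector_derivative_add has_vector_derivative_mult_right has_vector_derivative_of_real)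
         (auto simp: has_real_derivative_iff_has_vector_derivative)
    then have "(F has_vector_derivative (of_real u + \<i> * of_real v)) (at x)"
      by (simp add: complex_eq[symmetric])
    then show "(F has_vector_derivative vector_derivative F (at x)) (at x)"
      using vector_derivative_at by metis
  qed
qed

text \<open>The gauge is chosen in two ways. At a tag outside \<open>N\<close> differentiability
  makes the increment of \<open>F\<close> close to the linear term. At a tag in \<open>N\<close> the
  interval is kept inside an open set of small measure containing \<open>N\<close>, and there
  absolute continuity makes the sum of increments small. The gauge integral delivers integrability
  of \<open>f\<close> along with its value.\<close>

lemma abs_continuous_FTC:
  fixes F f :: "real \<Rightarrow> complex"
  assumes F: "abs_continuous_on_interval a b F" and "a \<le> b" and N: "negligible N"
    and f: "\<And>x. \<lbrakk>a \<le> x; x \<le> b; x \<notin> N\<rbrakk> \<Longrightarrow> (F has_vector_derivative f x) (at x)"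
  shows "(f has_integral (F b - F a)) {a..b}"
proof (cases "a = b")
  case True
  then show ?thesis by auto
next
  case False
  then have "a < b" using \<open>a \<le> b\<close> by simp
  define f0 where "f0 x = (if x \<in> N then 0 else f x)" for x
  have "(f0 has_integral (F b - F a)) {a..b}"
    unfolding has_integral_factor_content_real
  proof (intro allI impI)
    fix e :: real assume "e > 0"
    \<comment> \<open>Half of the permitted error \<open>e * (b - a)\<close> for each kind of
      tag.\<close>
    define e2 where "e2 = e * (b - a) / 2"
    have "e2 > 0" using \<open>e > 0\<close> \<open>a < b\<close> by (simp add: e2_def)
    obtain \<delta> where "\<delta> > 0" and \<delta>: "\<And>D S. \<lbrakk>D division_of S; S \<subseteq> {a..b}; measure lebesgue S < \<delta>\<rbrakk>
       \<Longrightarrow> (\<Sum>k\<in>D. norm (F (Sup k) - F (Inf k))) < e2"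
      using abs_continuous_division[OF F \<open>e2 > 0\<close>] by metis
    have Nl: "N \<in> sets lebesgue" using N by (auto simp: negligible_iff_null_sets)
    obtain T where T: "open T" "N \<subseteq> T" "T - N \<in> lmeasurable" "emeasure lebesgue (T - N) < ennreal \<delta>"
      using sets_lebesgue_outer_open[OF Nl \<open>\<delta> > 0\<close>] by metis
    have Nm: "N \<in> lmeasurable" "measure lebesgue N = 0"
      using N by (auto simp: negligible_iff_measure)
    have TN: "T = N \<union> (T - N)" using T by auto
    have Tm: "T \<in> lmeasurable" using Nm T(3) by (subst TN) (rule fmeasurable.Un)
    have "measure lebesgue (T - N) < \<delta>"
      using T(3,4) \<open>\<delta> > 0\<close> by (simp add: emeasure_eq_measure2 ennreal_less_iff)
    then have mT: "measure lebesgue T < \<delta>"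
      using measure_Un_le[of N lebesgue "T - N"] Nm T(3) TN by (auto simp: fmeasurableD)
    have "\<exists>r>0. (x \<in> N \<longrightarrow> ball x r \<subseteq> T) \<and>
        (x \<in> {a..b} - N \<longrightarrow> (\<forall>u v. u \<le> x \<and> x \<le> v \<and> x - u < r \<and> v - x < r \<longrightarrow>
            norm ((v - u) *\<^sub>R f x - (F v - F u)) \<le> e / 2 * (v - u)))" for x
    proof (cases "x \<in> N")
      case True
      then show ?thesis using T openE[of T x] by blast
    next
      case False
      show ?thesis
      proof (cases "x \<in> {a..b}")
        case True
        then have "(F has_vector_derivative f x) (at x)" using f False by auto
        then obtain r where r: "r > 0" "\<And>y. norm (y - x) < r \<Longrightarrow> norm (F y - F x - (y - x) *\<^sub>R f x) \<le> e / 2 * norm (y - x)"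
          unfolding has_vector_derivative_def has_derivative_at_alt using \<open>e > 0\<close> by (meson half_gt_zero)
        have "norm ((v - u) *\<^sub>R f x - (F v - F u)) \<le> e / 2 * (v - u)"
          if "u \<le> x" "x \<le> v" "x - u < r" "v - x < r" for u v
        proof -
          have "(v - u) *\<^sub>R f x - (F v - F u) = (F u - F x - (u - x) *\<^sub>R f x) - (F v - F x - (v - x) *\<^sub>R f x)"
            by (simp add: algebra_simps)
          then have "norm ((v - u) *\<^sub>R f x - (F v - F u))
              \<le> norm (F u - F x - (u - x) *\<^sub>R f x) + norm (F v - F x - (v - x) *\<^sub>R f x)"
            by (metis norm_triangle_ineq4)
          also have "\<dots> \<le> e / 2 * norm (u - x) + e / 2 * norm (v - x)"
            using that by (intro add_mono r(2)) auto
          also have "\<dots> = e / 2 * (v - u)" using that by (simp add: field_simps)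
          finally show ?thesis .
        qed
        with r(1) False show ?thesis by blast
      next
        case False
        then show ?thesis using \<open>x \<notin> N\<close> by (intro exI[of _ 1]) auto
      qed
    qed
    then obtain r where r: "\<And>x. r x > 0" "\<And>x. x \<in> N \<Longrightarrow> ball x (r x) \<subseteq> T"
      "\<And>x u v. \<lbrakk>x \<in> {a..b} - N; u \<le> x; x \<le> v; x - u < r x; v - x < r x\<rbrakk>
         \<Longrightarrow> norm ((v - u) *\<^sub>R f x - (F v - F u)) \<le> e / 2 * (v - u)"
      by metis
    show "\<exists>d. gauge d \<and> (\<forall>p. p tagged_division_of {a..b} \<and> d fine p \<longrightarrow>
       norm ((\<Sum>(x, k)\<in>p. measure lborel k *\<^sub>R f0 x) - (F b - F a)) \<le> e * measure lborel {a..b})"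
    proof (intro exI[of _ "\<lambda>x. ball x (r x)"] conjI allI impI)
      show "gauge (\<lambda>x. ball x (r x))" using r(1) by (auto simp: gauge_def)
      fix p assume p: "p tagged_division_of {a..b} \<and> (\<lambda>x. ball x (r x)) fine p"
      then have pd: "p tagged_division_of {a..b}" and fine: "\<And>x k. (x, k) \<in> p \<Longrightarrow> k \<subseteq> ball x (r x)"
        by (auto simp: fine_def)
      have "finite p" using pd by auto
      let ?\<Delta> = "\<lambda>k. F (Sup k) - F (Inf k)"
      define p1 where "p1 = {(x, k) \<in> p. x \<in> N}"
      have p1p: "p1 \<subseteq> p" by (auto simp: p1_def)
      have intv: "\<exists>u v. k = {u..v} \<and> u \<le> x \<and> x \<le> v \<and> x - u < r x \<and> v - x < r x \<and> x \<in> {a..b}" if xk: "(x, k) \<in> p" for x k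
      proof -
        obtain u v where k: "k = cbox u v" using tagged_division_ofD(4)[OF pd xk] by auto
        have "x \<in> k" "k \<subseteq> {a..b}" using tagged_division_ofD(2,3)[OF pd xk] by auto
        then have uv: "u \<in> k" "v \<in> k" "u \<le> x" "x \<le> v" "x \<in> {a..b}" using k by auto
        then have "u \<in> ball x (r x)" "v \<in> ball x (r x)" using fine[OF xk] by auto
        then have "x - u < r x" "v - x < r x" by (auto simp: dist_real_def)
        with uv k show ?thesis by (intro exI[of _ u] exI[of _ v]) auto
      qed
      have pp: "p1 tagged_partial_division_of {a..b}"
        using tagged_partial_division_subset[OF _ p1p] pd by (auto simp: tagged_division_of_def)
      \<comment> \<open>Rewriting a sum over tagged intervals as a sum over intervals requires the
        summand to vanish on degenerate ones. For the empty interval \<open>Inf\<close> and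
        \<open>Sup\<close> carry no information, so the value 0 is imposed.\<close>
      define d where "d k = (if k = {} then 0 else norm (?\<Delta> k))" for k
      have d: "norm (?\<Delta> k) = d k" if "(x, k) \<in> p1" for x k
        using tagged_partial_division_ofD(2)[OF pp that] by (auto simp: d_def)
      have "(\<Sum>(x, k)\<in>p1. norm (?\<Delta> k)) = (\<Sum>(x, k)\<in>p1. d k)"
        by (intro sum.cong) (auto simp: d)
      also have "\<dots> = (\<Sum>k\<in>snd ` p1. d k)"
      proof (rule sum.over_tagged_division_lemma[OF tagged_partial_division_of_Union_self[OF pp]])
        fix u v :: real assume "box u v = {}"
        then consider "cbox u v = {}" | "u = v" by (auto simp: box_real)
        then show "d (cbox u v) = 0" by cases (auto simp: d_def)
      qed
      also have "\<dots> = (\<Sum>k\<in>snd ` p1. norm (?\<Delta> k))"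
        by (intro sum.cong) (auto simp: d)
      also have "\<dots> < e2"
      proof (rule \<delta>[OF partial_division_of_tagged_division[OF pp]])
        show "\<Union>(snd ` p1) \<subseteq> {a..b}" using tagged_partial_division_ofD(3)[OF pp] by fastforce
        have "\<Union>(snd ` p1) \<subseteq> T" using fine r(2) p1p unfolding p1_def by fastforce
        then have "measure lebesgue (\<Union>(snd ` p1)) \<le> measure lebesgue T"
          using Tm lmeasurable_division[OF partial_division_of_tagged_division[OF pp]]
          by (intro measure_mono_fmeasurable) (auto simp: fmeasurableD)
        then show "measure lebesgue (\<Union>(snd ` p1)) < \<delta>" using mT by linarith
      qed
      finally have s1: "(\<Sum>(x, k)\<in>p1. norm (measure lborel k *\<^sub>R f0 x - ?\<Delta> k)) \<le> e2"
        by (subst sum.cong[of p1 p1 _ "\<lambda>(x, k). norm (?\<Delta> k)"]) (auto simp: p1_def f0_def norm_minus_commute)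
      have "(\<Sum>(x, k)\<in>p - p1. norm (measure lborel k *\<^sub>R f0 x - ?\<Delta> k)) \<le> (\<Sum>(x, k)\<in>p - p1. e / 2 * measure lborel k)"
      proof (intro sum_mono, clarify)
        fix x k assume xk: "(x, k) \<in> p" "(x, k) \<notin> p1"
        then have "x \<notin> N" by (auto simp: p1_def)
        obtain u v where uv: "k = {u..v}" "u \<le> x" "x \<le> v" "x - u < r x" "v - x < r x" "x \<in> {a..b}"
          using intv[OF xk(1)] by metis
        then show "norm (measure lborel k *\<^sub>R f0 x - ?\<Delta> k) \<le> e / 2 * measure lborel k"
          using r(3)[of x u v] \<open>x \<notin> N\<close> by (simp add: f0_def)
      qed
      also have "\<dots> \<le> (\<Sum>(x, k)\<in>p. e / 2 * measure lborel k)"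
        using \<open>finite p\<close> \<open>e > 0\<close> by (intro sum_mono2) auto
      also have "\<dots> = e2"
        using additive_content_tagged_division[of p a b] pd \<open>a \<le> b\<close>
        by (simp add: e2_def sum_distrib_left[symmetric] case_prod_unfold sum_divide_distrib[symmetric])
      finally have s2: "(\<Sum>(x, k)\<in>p - p1. norm (measure lborel k *\<^sub>R f0 x - ?\<Delta> k)) \<le> e2" .
      have "(\<Sum>(x, k)\<in>p. measure lborel k *\<^sub>R f0 x) - (F b - F a) = (\<Sum>(x, k)\<in>p. measure lborel k *\<^sub>R f0 x - ?\<Delta> k)"
        using additive_tagged_division_1[OF \<open>a \<le> b\<close> pd, of F] by (simp add: case_prod_unfold sum_subtractf)
      then have "norm ((\<Sum>(x, k)\<in>p. measure lborel k *\<^sub>R f0 x) - (F b - F a)) \<le> (\<Sum>(x, k)\<in>p. norm (measure lborel k *\<^sub>R f0 x - ?\<Delta> k))"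
        using norm_sum[of "\<lambda>(x, k). measure lborel k *\<^sub>R f0 x - ?\<Delta> k" p] by (simp add: case_prod_unfold)
      also have "\<dots> = (\<Sum>(x, k)\<in>p - p1. norm (measure lborel k *\<^sub>R f0 x - ?\<Delta> k)) + (\<Sum>(x, k)\<in>p1. norm (measure lborel k *\<^sub>R f0 x - ?\<Delta> k))"
        by (rule sum.subset_diff[OF p1p \<open>finite p\<close>])
      also have "\<dots> \<le> e2 + e2" using s1 s2 by linarith
      also have "\<dots> = e * measure lborel {a..b}" using \<open>a \<le> b\<close> by (simp add: e2_def)
      finally show "norm ((\<Sum>(x, k)\<in>p. measure lborel k *\<^sub>R f0 x) - (F b - F a)) \<le> e * measure lborel {a..b}" .
    qed
  qed
  then show ?thesis
    using has_integral_spike[OF N, of "{a..b}" f f0] by (auto simp: f0_def)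
qed

section \<open>Approximate identities\<close>

lemma powr_add_le:
  fixes a b p :: real
  assumes "0 \<le> a" "0 \<le> b" "0 \<le> p"
  shows "(a + b) powr p \<le> 2 powr p * (a powr p + b powr p)"
proof -
  have "(a + b) powr p \<le> (2 * max a b) powr p" using assms by (intro powr_mono2) auto
  also have "\<dots> = 2 powr p * (max a b) powr p" using assms by (simp add: powr_mult)
  also have "\<dots> \<le> 2 powr p * (a powr p + b powr p)" by (intro mult_left_mono) (auto simp: max_def)
  finally show ?thesis .
qed

text \<open>This crude inequality takes the place of Minkowski's: only convergence to 0 is at stake,
  so the factor \<open>2 powr p\<close> is harmless and \<open>p\<close>-th powers can be integrated
  directly.\<close>

lemma norm_diff_powr_le:
  fixes x y :: "'a::real_normed_vector"
  assumes "0 \<le> p"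
  shows "norm (x - y) powr p \<le> 2 powr p * (norm x powr p + norm y powr p)"
proof -
  have "norm (x - y) powr p \<le> (norm x + norm y) powr p"
    using assms by (intro powr_mono2 norm_triangle_ineq4) auto
  also have "\<dots> \<le> 2 powr p * (norm x powr p + norm y powr p)"
    using assms by (intro powr_add_le) auto
  finally show ?thesis .
qed

lemma integrable_lborel_translate:
  fixes f :: "real \<Rightarrow> 'a::{banach, second_countable_topology}"
  shows "integrable lborel f \<Longrightarrow> integrable lborel (\<lambda>x. f (x - h))"
  using lborel_integrable_real_affine[of f 1 "- h"] by (simp add: add.commute)

lemma integral_lborel_translate:
  fixes f :: "real \<Rightarrow> 'a::{banach, second_countable_topology}"
  shows "(LINT x|lborel. f (x - h)) = (LINT x|lborel. f x)"
  using lborel_integral_real_affine[of 1 f "- h"] by (simp add: add.commute)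

text \<open>The \<open>p\<close>-th power of the L^p distance between \<open>f\<close> and its
  translate. Leaving out the root keeps it an integral, to which Fubini applies.\<close>

definition Lp_modulus :: "real \<Rightarrow> (real \<Rightarrow> complex) \<Rightarrow> real \<Rightarrow> real" where
  "Lp_modulus p f h = (LINT x|lborel. norm (f (x - h) - f x) powr p)"

lemma
  fixes f :: "real \<Rightarrow> complex"
  assumes p: "0 \<le> p" and f[measurable]: "f \<in> borel_measurable borel"
    and int: "integrable lborel (\<lambda>x. norm (f x) powr p)"
  shows integrable_translate_diff: "integrable lborel (\<lambda>x. norm (f (x - h) - f x) powr p)"
    and Lp_modulus_le: "Lp_modulus p f h \<le> 2 powr p * (2 * (LINT x|lborel. norm (f x) powr p))"
proof -
  have i: "integrable lborel (\<lambda>x. 2 powr p * (norm (f (x - h)) powr p + norm (f x) powr p))"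
    using integrable_lborel_translate[OF int, of h] int by auto
  show 1: "integrable lborel (\<lambda>x. norm (f (x - h) - f x) powr p)"
    by (rule Bochner_Integration.integrable_bound[OF i]) (auto intro!: AE_I2 norm_diff_powr_le p)
  have "Lp_modulus p f h \<le> (LINT x|lborel. 2 powr p * (norm (f (x - h)) powr p + norm (f x) powr p))"
    unfolding Lp_modulus_def by (intro integral_mono 1 i norm_diff_powr_le p)
  also have "\<dots> = 2 powr p * (2 * (LINT x|lborel. norm (f x) powr p))"
    using integral_lborel_translate[of "\<lambda>x. norm (f x) powr p" h] integrable_lborel_translate[OF int, of h] int by simp
  finally show "Lp_modulus p f h \<le> 2 powr p * (2 * (LINT x|lborel. norm (f x) powr p))" .
qed

lemma Lp_modulus_nonneg: "0 \<le> Lp_modulus p f h"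
  unfolding Lp_modulus_def by (intro integral_nonneg_AE) auto

lemma Lp_modulus_add_le:
  fixes f g :: "real \<Rightarrow> complex"
  assumes p: "0 \<le> p" and [measurable]: "f \<in> borel_measurable borel" "g \<in> borel_measurable borel"
    and int: "integrable lborel (\<lambda>x. norm (f x) powr p)" "integrable lborel (\<lambda>x. norm (g x) powr p)"
  shows "Lp_modulus p (\<lambda>x. f x + g x) h \<le> 2 powr p * (Lp_modulus p f h + Lp_modulus p g h)"
proof -
  note i = integrable_translate_diff[OF p _ int(1)] integrable_translate_diff[OF p _ int(2)]
  have le: "norm (f (x - h) + g (x - h) - (f x + g x)) powr p
      \<le> 2 powr p * (norm (f (x - h) - f x) powr p + norm (g (x - h) - g x) powr p)" for x
    using norm_diff_powr_le[OF p, of "f (x - h) - f x" "- (g (x - h) - g x)"]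
    by (simp add: algebra_simps norm_minus_commute)
  have "Lp_modulus p (\<lambda>x. f x + g x) h \<le>
      (LINT x|lborel. 2 powr p * (norm (f (x - h) - f x) powr p + norm (g (x - h) - g x) powr p))"
    unfolding Lp_modulus_def
    by (rule integral_mono'[OF _ le]) (use i in auto)
  also have "\<dots> = 2 powr p * (Lp_modulus p f h + Lp_modulus p g h)"
    using i by (simp add: Lp_modulus_def)
  finally show ?thesis .
qed

text \<open>The density step. The modulus of \<open>f - s i\<close> is bounded uniformly in
  \<open>h\<close> by a multiple of its \<open>p\<close>-th power integral, which tends to 0 by
  dominated convergence; first \<open>i\<close> is fixed, then \<open>h\<close> is sent to 0. The
  domination by \<open>2 * norm (f x)\<close> is the form supplied by induction over integrable
  functions.\<close>

lemma Lp_modulus_tendsto_limit: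
  fixes f :: "real \<Rightarrow> complex"
  assumes p: "0 < p" and f[measurable]: "f \<in> borel_measurable borel"
    and int: "integrable lborel (\<lambda>x. norm (f x) powr p)"
    and s[measurable]: "\<And>i. s i \<in> borel_measurable borel"
    and s0: "\<And>i. (Lp_modulus p (s i) \<longlongrightarrow> 0) (at 0)"
    and lim: "\<And>x. (\<lambda>i. s i x) \<longlonglongrightarrow> f x"
    and bd: "\<And>i x. norm (s i x) \<le> 2 * norm (f x)"
  shows "(Lp_modulus p f \<longlongrightarrow> 0) (at 0)"
proof (rule tendstoI)
  fix e :: real assume "e > 0"
  have bp: "norm (s i x) powr p \<le> 2 powr p * norm (f x) powr p" for i x
    using powr_mono2[of p "norm (s i x)" "2 * norm (f x)"] bd[of i x] p by (simp add: powr_mult)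
  have si: "integrable lborel (\<lambda>x. norm (s i x) powr p)" for i
    by (rule Bochner_Integration.integrable_bound[of _ "\<lambda>x. 2 powr p * norm (f x) powr p"])
       (use int bp in auto)
  have bd2: "norm (f x - s i x) powr p \<le> 2 powr p * (norm (f x) powr p + 2 powr p * norm (f x) powr p)" for i x
    by (rule order_trans[OF norm_diff_powr_le]) (use p bp[of i x] in \<open>auto intro!: mult_left_mono\<close>)
  have di: "integrable lborel (\<lambda>x. norm (f x - s i x) powr p)" for i
    by (rule Bochner_Integration.integrable_bound[of _ "\<lambda>x. 2 powr p * (norm (f x) powr p + 2 powr p * norm (f x) powr p)"])
       (use int bd2 in auto)
  have "(\<lambda>i. LINT x|lborel. norm (f x - s i x) powr p) \<longlonglongrightarrow> (LINT x::real|lborel. 0)"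
  proof (rule integral_dominated_convergence[where w = "\<lambda>x. 2 powr p * (norm (f x) powr p + 2 powr p * norm (f x) powr p)"])
    show "AE x in lborel. (\<lambda>i. norm (f x - s i x) powr p) \<longlonglongrightarrow> 0"
    proof (rule AE_I2)
      fix x
      have "(\<lambda>i. norm (f x - s i x)) \<longlonglongrightarrow> 0"
        using tendsto_norm[OF tendsto_diff[OF tendsto_const lim[of x]], of "f x"] by simp
      then have "(\<lambda>i. norm (f x - s i x) powr p) \<longlonglongrightarrow> 0 powr p"
        by (intro tendsto_powr') (use p in auto)
      then show "(\<lambda>i. norm (f x - s i x) powr p) \<longlonglongrightarrow> 0" by simp
    qed
  qed (use int bd2 in auto)
  then have "(\<lambda>i. 2 powr p * (2 powr p * (2 * (LINT x|lborel. norm (f x - s i x) powr p)))) \<longlonglongrightarrow> 2 powr p * (2 powr p * (2 * 0))"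
    by (intro tendsto_intros) simp
  from order_tendstoD(2)[OF this, of "e / 2"] \<open>e > 0\<close> obtain i where
    i: "2 powr p * (2 powr p * (2 * (LINT x|lborel. norm (f x - s i x) powr p))) < e / 2"
    by (auto simp: eventually_sequentially)
  have "((\<lambda>h. 2 powr p * Lp_modulus p (s i) h) \<longlongrightarrow> 2 powr p * 0) (at 0)"
    by (intro tendsto_intros s0)
  from order_tendstoD(2)[OF this, of "e / 2"] \<open>e > 0\<close>
  have "\<forall>\<^sub>F h in at 0. 2 powr p * Lp_modulus p (s i) h < e / 2" by simp
  then show "\<forall>\<^sub>F h in at 0. dist (Lp_modulus p f h) 0 < e"
  proof eventually_elim
    case (elim h)
    have "Lp_modulus p f h = Lp_modulus p (\<lambda>x. s i x + (f x - s i x)) h" by simp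
    also have "\<dots> \<le> 2 powr p * (Lp_modulus p (s i) h + Lp_modulus p (\<lambda>x. f x - s i x) h)"
      using p si di by (intro Lp_modulus_add_le) auto
    also have "Lp_modulus p (\<lambda>x. f x - s i x) h \<le> 2 powr p * (2 * (LINT x|lborel. norm (f x - s i x) powr p))"
      using p di by (intro Lp_modulus_le) auto
    finally have "Lp_modulus p f h \<le> 2 powr p * Lp_modulus p (s i) h
        + 2 powr p * (2 powr p * (2 * (LINT x|lborel. norm (f x - s i x) powr p)))"
      by (simp add: distrib_left)
    then show ?case using elim i Lp_modulus_nonneg[of p f h] by (simp add: dist_real_def)
  qed
qed

text \<open>Regularity squeezes \<open>A\<close> between a compact \<open>K\<close> and an open
  \<open>U\<close>. A shift shorter than a positive lower bound for the distance from
  \<open>K\<close> to the complement of \<open>U\<close> changes membership in \<open>A\<close> only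
  where \<open>x\<close> or \<open>x - h\<close> lies in \<open>U - K\<close>, a set of small
  measure.\<close>

lemma L1_modulus_indicator_bounded:
  fixes c :: complex
  assumes A: "A \<in> sets borel" "bounded A"
  shows "(Lp_modulus 1 (\<lambda>x. indicator A x *\<^sub>R c) \<longlongrightarrow> 0) (at 0)"
proof (rule tendstoI)
  fix e :: real assume "e > 0"
  \<comment> \<open>\<open>U - K\<close> has measure at most \<open>2 * e'\<close> and is counted
    twice, giving \<open>norm c * (4 * e')\<close>. The summand 1 allows \<open>c = 0\<close> and
    makes the final inequality strict.\<close>
  define e' where "e' = e / (2 * (norm c + 1)) / 2"
  have "e' > 0" using \<open>e > 0\<close> by (simp add: e'_def add_nonneg_pos)
  have Al: "A \<in> sets lebesgue" using A(1) by auto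
  obtain U where U: "open U" "A \<subseteq> U" "U - A \<in> lmeasurable" "emeasure lebesgue (U - A) < ennreal e'"
    using sets_lebesgue_outer_open[OF Al \<open>e' > 0\<close>] by metis
  obtain K where K: "closed K" "K \<subseteq> A" "A - K \<in> lmeasurable" "emeasure lebesgue (A - K) < ennreal e'"
    using sets_lebesgue_inner_closed[OF Al \<open>e' > 0\<close>] by metis
  have "compact K" using K(1,2) A(2) by (meson bounded_subset compact_eq_bounded_closed)
  then obtain d where d: "d > 0" "\<And>x y. x \<in> K \<Longrightarrow> y \<in> - U \<Longrightarrow> d \<le> dist x y"
    using separate_compact_closed[of K "- U"] U K by (metis Compl_disjoint closed_Compl disjoint_iff subsetD ComplD)
  define B where "B = U - K"
  have [measurable]: "B \<in> sets borel" using U(1) K(1) by (simp add: B_def)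
  have Beq: "B = (U - A) \<union> (A - K)" using U K by (auto simp: B_def)
  then have "B \<in> lmeasurable" using U(3) K(3) by auto
  have mB: "measure lebesgue B \<le> 2 * e'"
  proof -
    have "measure lebesgue (U - A) < e'" "measure lebesgue (A - K) < e'"
      using U(3,4) K(3,4) \<open>e' > 0\<close> by (simp_all add: emeasure_eq_measure2 ennreal_less_iff)
    moreover have "measure lebesgue B \<le> measure lebesgue (U - A) + measure lebesgue (A - K)"
      using Beq U(3) K(3) by (simp add: measure_Un_le fmeasurableD)
    ultimately show ?thesis by linarith
  qed
  have iB: "integrable lborel (\<lambda>x. indicator B x :: real)"
    using \<open>B \<in> lmeasurable\<close> \<open>B \<in> sets borel\<close> by (simp add: integrable_indicator_iff fmeasurable_def)
  have LB: "(LINT x|lborel. indicator B x :: real) = measure lebesgue B" by simp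
  have "\<forall>\<^sub>F h in at (0::real). \<bar>h\<bar> < d" using d(1) by (auto simp: eventually_at dist_real_def)
  then show "\<forall>\<^sub>F h in at 0. dist (Lp_modulus 1 (\<lambda>x. indicator A x *\<^sub>R c) h) 0 < e"
  proof eventually_elim
    case (elim h)
    have KU: "x + t \<in> U" if "x \<in> K" "\<bar>t\<bar> < d" for x t
      using d(2)[OF that(1), of "x + t"] that(2) by (force simp: dist_real_def)
    have le: "norm (indicator A (x - h) *\<^sub>R c - indicator A x *\<^sub>R c) powr 1
        \<le> norm c * (indicator B (x - h) + indicator B x)" for x
    proof (cases "x - h \<in> A \<longleftrightarrow> x \<in> A")
      case True
      then show ?thesis by (auto simp: indicator_def)
    next
      case False
      then have "x - h \<in> B \<or> x \<in> B"
        using KU[of "x - h" h] KU[of x "- h"] elim U(2) K(2) unfolding B_def by auto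
      then have "norm c * 1 \<le> norm c * (indicator B (x - h) + indicator B x)"
        by (intro mult_left_mono) (auto simp: indicator_def)
      moreover have "norm (indicator A (x - h) *\<^sub>R c - indicator A x *\<^sub>R c) = norm c"
        using False by (auto simp: indicator_def)
      ultimately show ?thesis by simp
    qed
    have "Lp_modulus 1 (\<lambda>x. indicator A x *\<^sub>R c) h \<le> (LINT x|lborel. norm c * (indicator B (x - h) + indicator B x))"
      unfolding Lp_modulus_def
      by (rule integral_mono'[OF _ le]) (use iB integrable_lborel_translate[OF iB, of h] in auto)
    also have "\<dots> = norm c * (2 * measure lebesgue B)"
      using integral_lborel_translate[of "\<lambda>x. indicator B x :: real" h] iB integrable_lborel_translate[OF iB, of h] LB
      by simp
    also have "\<dots> \<le> norm c * (4 * e')" using mB by (intro mult_left_mono) auto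
    also have "\<dots> = e * (norm c / (norm c + 1))"
    proof -
      have "norm c + 1 \<noteq> 0" by (smt (verit) norm_ge_zero)
      then show ?thesis unfolding e'_def by (simp add: divide_simps)
    qed
    also have "\<dots> < e * 1" using \<open>e > 0\<close>
      by (intro mult_strict_left_mono) (auto simp: add_nonneg_pos divide_less_eq)
    finally show ?case using Lp_modulus_nonneg by (simp add: dist_real_def)
  qed
qed

lemma L1_modulus_tendsto:
  fixes f :: "real \<Rightarrow> complex"
  assumes "integrable lborel f"
  shows "(Lp_modulus 1 f \<longlongrightarrow> 0) (at 0)"
  using assms
proof (induction rule: integrable_induct)
  case (base A c)
  have [measurable]: "A \<in> sets borel" using base by simp
  have [simp]: "A \<inter> {- real i..real i} \<in> sets borel" for i by simp
  show ?case
  \<comment> \<open>A set of finite measure may be unbounded, whereas the squeezing argument rests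
    on compactness; hence the cut to \<open>{- real i..real i}\<close>.\<close>
  proof (rule Lp_modulus_tendsto_limit[where s = "\<lambda>i x. indicator (A \<inter> {- real i..real i}) x *\<^sub>R c"])
    show "integrable lborel (\<lambda>x. norm (indicator A x *\<^sub>R c) powr 1)"
      using base by (simp add: integrable_indicator_iff)
    show "(Lp_modulus 1 (\<lambda>x. indicator (A \<inter> {- real i..real i}) x *\<^sub>R c) \<longlongrightarrow> 0) (at 0)" for i
      by (rule L1_modulus_indicator_bounded) (auto intro: bounded_subset[of "{- real i..real i}"])
    show "(\<lambda>i. indicator (A \<inter> {- real i..real i}) x *\<^sub>R c) \<longlonglongrightarrow> indicator A x *\<^sub>R c" for x
    proof (rule tendsto_eventually)
      obtain n where "\<bar>x\<bar> < real n" using reals_Archimedean2 by blast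
      then show "\<forall>\<^sub>F i in sequentially. indicator (A \<inter> {- real i..real i}) x *\<^sub>R c = indicator A x *\<^sub>R c"
        by (intro eventually_sequentiallyI[of n]) (auto simp: indicator_def)
    qed
  qed (auto simp: indicator_def)
next
  case (add f g)
  have "((\<lambda>h. 2 powr 1 * (Lp_modulus 1 f h + Lp_modulus 1 g h)) \<longlongrightarrow> 2 powr 1 * (0 + 0)) (at 0)"
    by (intro tendsto_intros add.IH)
  then have lim: "((\<lambda>h. 2 powr 1 * (Lp_modulus 1 f h + Lp_modulus 1 g h)) \<longlongrightarrow> 0) (at 0)" by simp
  show ?case
  proof (rule real_tendsto_sandwich[OF _ _ tendsto_const lim]; intro always_eventually allI)
    show "0 \<le> Lp_modulus 1 (\<lambda>x. f x + g x) h" for h by (rule Lp_modulus_nonneg)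
    show "Lp_modulus 1 (\<lambda>x. f x + g x) h \<le> 2 powr 1 * (Lp_modulus 1 f h + Lp_modulus 1 g h)" for h
      using add.hyps by (intro Lp_modulus_add_le) (auto dest: borel_measurable_integrable)
  qed
next
  case (lim f s)
  show ?case
    by (rule Lp_modulus_tendsto_limit[where s = s])
       (use lim in \<open>auto dest: borel_measurable_integrable\<close>)
qed

text \<open>Truncation in both value and argument yields a bounded integrable \<open>g\<close> whose
  translation differences are at most \<open>2 * i\<close>. Their \<open>p\<close>-th power is then
  at most \<open>(2 * i) powr (p - 1)\<close> times the difference itself, which reduces the claim
  to exponent 1.\<close>

lemma Lp_modulus_tendsto:
  fixes f :: "real \<Rightarrow> complex"
  assumes p: "1 \<le> p" and f[measurable]: "f \<in> borel_measurable borel"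
    and int: "integrable lborel (\<lambda>x. norm (f x) powr p)"
  shows "(Lp_modulus p f \<longlongrightarrow> 0) (at 0)"
proof (rule Lp_modulus_tendsto_limit[where s = "\<lambda>i x. if norm (f x) \<le> real i \<and> \<bar>x\<bar> \<le> real i then f x else 0"])
  show "0 < p" using p by simp
  fix i :: nat
  define g where "g = (\<lambda>x. if norm (f x) \<le> real i \<and> \<bar>x\<bar> \<le> real i then f x else 0)"
  have [measurable]: "g \<in> borel_measurable borel" unfolding g_def by measurable
  have gb: "norm (g x) \<le> real i" for x by (auto simp: g_def)
  have gi: "integrable lborel g"
  proof (rule Bochner_Integration.integrable_bound[of _ "\<lambda>x. real i * indicator {- real i..real i} x"])
    show "AE x in lborel. norm (g x) \<le> norm (real i * indicator {- real i..real i} x)"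
      by (intro AE_I2) (auto simp: g_def indicator_def)
  qed auto
  have le: "norm (g (x - h) - g x) powr p \<le> (2 * real i) powr (p - 1) * norm (g (x - h) - g x) powr 1" for x h
  proof -
    have "norm (g (x - h) - g x) \<le> 2 * real i"
      using norm_triangle_ineq4[of "g (x - h)" "g x"] gb[of "x - h"] gb[of x] by linarith
    then have "norm (g (x - h) - g x) powr (p - 1) \<le> (2 * real i) powr (p - 1)" using p by (intro powr_mono2) auto
    then have "norm (g (x - h) - g x) powr (p - 1) * norm (g (x - h) - g x) powr 1
        \<le> (2 * real i) powr (p - 1) * norm (g (x - h) - g x) powr 1" by (intro mult_right_mono) auto
    moreover have "norm (g (x - h) - g x) powr p = norm (g (x - h) - g x) powr (p - 1) * norm (g (x - h) - g x) powr 1"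
      using powr_add[of "norm (g (x - h) - g x)" "p - 1" 1] by (simp only: diff_add_cancel)
    ultimately show ?thesis by (simp only:)
  qed
  have "((\<lambda>h. (2 * real i) powr (p - 1) * Lp_modulus 1 g h) \<longlongrightarrow> (2 * real i) powr (p - 1) * 0) (at 0)"
    by (intro tendsto_intros L1_modulus_tendsto gi)
  then have lim: "((\<lambda>h. (2 * real i) powr (p - 1) * Lp_modulus 1 g h) \<longlongrightarrow> 0) (at 0)" by simp
  have "(Lp_modulus p g \<longlongrightarrow> 0) (at 0)"
  proof (rule real_tendsto_sandwich[OF _ _ tendsto_const lim]; intro always_eventually allI)
    show "0 \<le> Lp_modulus p g h" for h by (rule Lp_modulus_nonneg)
    show "Lp_modulus p g h \<le> (2 * real i) powr (p - 1) * Lp_modulus 1 g h" for h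
    proof -
      have "Lp_modulus p g h \<le> (LINT x|lborel. (2 * real i) powr (p - 1) * norm (g (x - h) - g x) powr 1)"
        unfolding Lp_modulus_def
        by (rule integral_mono'[OF _ le])
           (use integrable_translate_diff[of 1 g h] gi in auto)
      then show ?thesis by (simp add: Lp_modulus_def)
    qed
  qed
  then show "(Lp_modulus p (\<lambda>x. if norm (f x) \<le> real i \<and> \<bar>x\<bar> \<le> real i then f x else 0) \<longlongrightarrow> 0) (at 0)"
    by (simp add: g_def)
next
  fix x
  obtain n1 n2 where "\<bar>x\<bar> < real n1" "norm (f x) < real n2" using reals_Archimedean2 by metis
  then show "(\<lambda>i. if norm (f x) \<le> real i \<and> \<bar>x\<bar> \<le> real i then f x else 0) \<longlonglongrightarrow> f x"
    by (intro tendsto_eventually eventually_sequentiallyI[of "max n1 n2"]) auto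
qed (use int in auto)

section \<open>Jensen's inequality and convolution with dilated kernels\<close>

lemma powr_ge_tangent:
  fixes t m p :: real
  assumes "1 \<le> p" "0 \<le> t" "0 < m"
  shows "m powr p + p * m powr (p - 1) * (t - m) \<le> t powr p"
\<comment> \<open>The convexity argument lives on the open half-line; at 0 the claim reduces to
  \<open>m powr p * (1 - p) \<le> 0\<close>.\<close>
proof (cases "t = 0")
  case True
  have "m powr (p - 1) * m = m powr p" using assms by (simp add: powr_mult_base mult.commute)
  moreover have "m powr p * (1 - p) \<le> 0" using assms by (simp add: mult_nonneg_nonpos)
  ultimately show ?thesis using True by (simp add: algebra_simps)
next
  case False
  have "t powr p - m powr p \<ge> p * m powr (p - 1) * (t - m)"
  proof (rule convex_on_imp_above_tangent[of "{0<..}"])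
    show "convex_on {0<..} (\<lambda>x. x powr p)" using assms by (intro powr_convex)
    show "((\<lambda>x. x powr p) has_real_derivative p * m powr (p - 1)) (at m within {0<..})"
      using assms by (auto intro!: derivative_eq_intros)
  qed (use assms False in \<open>auto simp: interior_open\<close>)
  then show ?thesis by simp
qed

text \<open>Integrate the tangent inequality at the weighted mean \<open>m = G / W\<close>. The
  weight is not normalised, which accounts for the power \<open>p - 1\<close> of its mass. Combined
  with Fubini, this replaces Minkowski's integral inequality.\<close>

lemma Jensen_powr_weighted:
  fixes g w :: "'a \<Rightarrow> real"
  assumes "1 \<le> p" and g: "\<And>y. 0 \<le> g y" and w: "\<And>y. 0 \<le> w y"
    and iw: "integrable M w" and igw: "integrable M (\<lambda>y. g y * w y)"
    and igp: "integrable M (\<lambda>y. g y powr p * w y)"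
  shows "(LINT y|M. g y * w y) powr p \<le> (LINT y|M. w y) powr (p - 1) * (LINT y|M. g y powr p * w y)"
proof -
  define W G where "W = (LINT y|M. w y)" and "G = (LINT y|M. g y * w y)"
  have "W \<ge> 0" "G \<ge> 0" "(LINT y|M. g y powr p * w y) \<ge> 0"
    unfolding W_def G_def by (auto intro!: integral_nonneg_AE AE_I2 mult_nonneg_nonneg g w)
  show ?thesis
  proof (cases "G = 0")
    case True
    with \<open>(LINT y|M. g y powr p * w y) \<ge> 0\<close> show ?thesis unfolding G_def[symmetric] by simp
  next
    case False
    then have "G > 0" using \<open>G \<ge> 0\<close> by simp
    have "W \<noteq> 0"
    proof
      assume "W = 0"
      then have "AE y in M. w y = 0"
        using integral_nonneg_eq_0_iff_AE[OF iw] w unfolding W_def by simp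
      then have "G = (LINT y|M. 0)" unfolding G_def
        using igw by (intro integral_cong_AE) (auto dest: borel_measurable_integrable)
      then show False using False by simp
    qed
    then have "W > 0" using \<open>W \<ge> 0\<close> by simp
    define m where "m = G / W"
    have "m > 0" using \<open>G > 0\<close> \<open>W > 0\<close> by (simp add: m_def)
    have "(LINT y|M. (m powr p - p * m powr (p - 1) * m) * w y + p * m powr (p - 1) * (g y * w y))
        \<le> (LINT y|M. g y powr p * w y)"
    proof (rule integral_mono)
      show "integrable M (\<lambda>y. (m powr p - p * m powr (p - 1) * m) * w y + p * m powr (p - 1) * (g y * w y))"
        using iw igw by (intro Bochner_Integration.integrable_add integrable_mult_right) auto
      have "(m powr p + p * m powr (p - 1) * (g y - m)) * w y \<le> g y powr p * w y" for y
        using assms \<open>m > 0\<close> by (intro mult_right_mono powr_ge_tangent) auto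
      then show "(m powr p - p * m powr (p - 1) * m) * w y + p * m powr (p - 1) * (g y * w y) \<le> g y powr p * w y" for y
        by (simp add: algebra_simps)
    qed (rule igp)
    also have "(LINT y|M. (m powr p - p * m powr (p - 1) * m) * w y + p * m powr (p - 1) * (g y * w y))
        = (m powr p - p * m powr (p - 1) * m) * W + p * m powr (p - 1) * G"
      using iw igw by (simp add: W_def G_def)
    also have "\<dots> = m powr p * W" using \<open>W > 0\<close> by (simp add: m_def algebra_simps)
    finally have "m powr p * W \<le> (LINT y|M. g y powr p * w y)" .
    then have "W powr (p - 1) * (m powr p * W) \<le> W powr (p - 1) * (LINT y|M. g y powr p * w y)"
      by (intro mult_left_mono) auto
    moreover have "W powr (p - 1) * (m powr p * W) = G powr p"
    proof -
      have "W powr (p - 1) * W = W powr p" using \<open>W > 0\<close> by (simp add: powr_mult_base mult.commute)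
      then have "W powr (p - 1) * (m powr p * W) = (m * W) powr p"
        using \<open>W > 0\<close> \<open>m > 0\<close> by (simp add: powr_mult mult.commute mult.left_commute)
      then show ?thesis using \<open>W > 0\<close> by (simp add: m_def)
    qed
    ultimately show ?thesis by (simp add: G_def W_def)
  qed
qed

text \<open>Gives integrability of a translation difference against the weight from that of its
  \<open>p\<close>-th power, the weight having finite mass.\<close>

lemma le_one_plus_powr:
  fixes t p :: real
  assumes "0 \<le> t" "1 \<le> p"
  shows "t \<le> 1 + t powr p"
proof (cases "t \<le> 1")
  case True
  then show ?thesis by (simp add: add_increasing2)
next
  case False
  then have "t powr 1 \<le> t powr p" using assms by (intro powr_mono) auto
  then show ?thesis using False by simp
qed

lemma borel_measurable_Lp_modulus[measurable]:
  assumes [measurable]: "f \<in> borel_measurable borel"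
  shows "Lp_modulus p f \<in> borel_measurable borel"
  unfolding Lp_modulus_def[abs_def] by measurable

context
  fixes p :: real and f \<psi> :: "real \<Rightarrow> complex"
  assumes p: "1 \<le> p" and f[measurable]: "f \<in> borel_measurable borel"
    and int: "integrable lborel (\<lambda>x. norm (f x) powr p)"
    and \<psi>: "integrable lborel \<psi>" and one: "(LINT y|lborel. \<psi> y) = 1"
begin

lemma approximate_identity_kernel_measurable[measurable]: "\<psi> \<in> borel_measurable borel"
  using borel_measurable_integrable[OF \<psi>] by simp

lemma Lp_modulus_weight_integrable: "integrable lborel (\<lambda>y. Lp_modulus p f (a * y) * norm (\<psi> y))"
proof (rule Bochner_Integration.integrable_bound)
  show "integrable lborel (\<lambda>y. 2 powr p * (2 * (LINT x|lborel. norm (f x) powr p)) * norm (\<psi> y))"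
    using \<psi> by (intro integrable_mult_right) auto
  show "AE y in lborel. norm (Lp_modulus p f (a * y) * norm (\<psi> y))
      \<le> norm (2 powr p * (2 * (LINT x|lborel. norm (f x) powr p)) * norm (\<psi> y))"
  proof (rule AE_I2)
    fix y
    have "Lp_modulus p f (a * y) * norm (\<psi> y) \<le> 2 powr p * (2 * (LINT x|lborel. norm (f x) powr p)) * norm (\<psi> y)"
      using p int by (intro mult_right_mono Lp_modulus_le) auto
    then show "norm (Lp_modulus p f (a * y) * norm (\<psi> y))
      \<le> norm (2 powr p * (2 * (LINT x|lborel. norm (f x) powr p)) * norm (\<psi> y))"
      using Lp_modulus_nonneg[of p f "a * y"] by (simp add: abs_mult)
  qed
qed simp

lemma approximate_identity_pair_integrable:
  "integrable (lborel \<Otimes>\<^sub>M lborel) (\<lambda>(y, x). norm (f (x - a * y) - f x) powr p * norm (\<psi> y))"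
proof (rule lborel_pair.Fubini_integrable)
  show "integrable lborel (\<lambda>y. LINT x|lborel. norm (case (y, x) of (y, x) \<Rightarrow> norm (f (x - a * y) - f x) powr p * norm (\<psi> y)))"
    using Lp_modulus_weight_integrable[of a] by (simp add: Lp_modulus_def)
  show "AE y in lborel. integrable lborel (\<lambda>x. case (y, x) of (y, x) \<Rightarrow> norm (f (x - a * y) - f x) powr p * norm (\<psi> y))"
    using p int by (intro AE_I2) (simp add: integrable_translate_diff)
qed measurable

text \<open>Since \<psi> has integral 1, \<open>f x\<close> can be moved under the integral as
  \<open>f x * \<psi> y\<close>. Jensen is then applied with weight \<open>norm (\<psi> y)\<close>,
  whose mass may exceed 1 because \<psi> is complex-valued.\<close>

lemma approximate_identity_pointwise_bound:
  assumes H: "integrable lborel (\<lambda>y. norm (f (x - a * y) - f x) powr p * norm (\<psi> y))"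
  shows "norm (f x - (LINT y|lborel. f (x - a * y) * \<psi> y)) powr p
    \<le> (LINT y|lborel. norm (\<psi> y)) powr (p - 1) * (LINT y|lborel. norm (f (x - a * y) - f x) powr p * norm (\<psi> y))"
proof -
  have g: "integrable lborel (\<lambda>y. norm (f (x - a * y) - f x) * norm (\<psi> y))"
  proof (rule Bochner_Integration.integrable_bound)
    show "integrable lborel (\<lambda>y. norm (\<psi> y) + norm (f (x - a * y) - f x) powr p * norm (\<psi> y))"
      using H \<psi> by auto
    show "AE y in lborel. norm (norm (f (x - a * y) - f x) * norm (\<psi> y))
        \<le> norm (norm (\<psi> y) + norm (f (x - a * y) - f x) powr p * norm (\<psi> y))"
    proof (rule AE_I2)
      fix y
      have "norm (f (x - a * y) - f x) * norm (\<psi> y) \<le> (1 + norm (f (x - a * y) - f x) powr p) * norm (\<psi> y)"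
        using p by (intro mult_right_mono le_one_plus_powr) auto
      then show "norm (norm (f (x - a * y) - f x) * norm (\<psi> y))
        \<le> norm (norm (\<psi> y) + norm (f (x - a * y) - f x) powr p * norm (\<psi> y))"
        by (simp add: algebra_simps)
    qed
  qed simp
  have d: "integrable lborel (\<lambda>y. (f (x - a * y) - f x) * \<psi> y)"
    by (rule Bochner_Integration.integrable_bound[OF g]) (auto simp: norm_mult)
  have "(LINT y|lborel. f (x - a * y) * \<psi> y) = (LINT y|lborel. (f (x - a * y) - f x) * \<psi> y + f x * \<psi> y)"
    by (intro Bochner_Integration.integral_cong) (auto simp: algebra_simps)
  also have "\<dots> = (LINT y|lborel. (f (x - a * y) - f x) * \<psi> y) + f x"
    using d \<psi> one by simp
  finally have "norm (f x - (LINT y|lborel. f (x - a * y) * \<psi> y)) = norm (LINT y|lborel. (f (x - a * y) - f x) * \<psi> y)"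
    by simp
  also have "\<dots> \<le> (LINT y|lborel. norm ((f (x - a * y) - f x) * \<psi> y))" by (rule integral_norm_bound)
  also have "\<dots> = (LINT y|lborel. norm (f (x - a * y) - f x) * norm (\<psi> y))" by (simp add: norm_mult)
  finally have "norm (f x - (LINT y|lborel. f (x - a * y) * \<psi> y)) powr p
      \<le> (LINT y|lborel. norm (f (x - a * y) - f x) * norm (\<psi> y)) powr p"
    using p by (intro powr_mono2) auto
  also have "\<dots> \<le> (LINT y|lborel. norm (\<psi> y)) powr (p - 1) * (LINT y|lborel. norm (f (x - a * y) - f x) powr p * norm (\<psi> y))"
    using p \<psi> g H by (intro Jensen_powr_weighted) auto
  finally show ?thesis .
qed

lemma
  shows approximate_identity_integrable:
      "integrable lborel (\<lambda>x. norm (f x - (LINT y|lborel. f (x - a * y) * \<psi> y)) powr p)"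
    and approximate_identity_bound:
      "(LINT x|lborel. norm (f x - (LINT y|lborel. f (x - a * y) * \<psi> y)) powr p)
        \<le> (LINT y|lborel. norm (\<psi> y)) powr (p - 1) * (LINT y|lborel. Lp_modulus p f (a * y) * norm (\<psi> y))"
proof -
  let ?W = "(LINT y|lborel. norm (\<psi> y)) powr (p - 1)"
  let ?H = "\<lambda>y x. norm (f (x - a * y) - f x) powr p * norm (\<psi> y)"
  have ae: "AE x in lborel. norm (f x - (LINT y|lborel. f (x - a * y) * \<psi> y)) powr p \<le> ?W * (LINT y|lborel. ?H y x)"
    using lborel_pair.AE_integrable_snd[OF approximate_identity_pair_integrable[of a]]
    by eventually_elim (rule approximate_identity_pointwise_bound)
  have i: "integrable lborel (\<lambda>x. ?W * (LINT y|lborel. ?H y x))"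
    using lborel_pair.integrable_snd[OF approximate_identity_pair_integrable[of a]] by simp
  show 1: "integrable lborel (\<lambda>x. norm (f x - (LINT y|lborel. f (x - a * y) * \<psi> y)) powr p)"
  proof (rule Bochner_Integration.integrable_bound[OF i])
    show "AE x in lborel. norm (norm (f x - (LINT y|lborel. f (x - a * y) * \<psi> y)) powr p)
        \<le> norm (?W * (LINT y|lborel. ?H y x))"
      using ae by eventually_elim simp
  qed measurable
  have "(LINT x|lborel. norm (f x - (LINT y|lborel. f (x - a * y) * \<psi> y)) powr p) \<le> (LINT x|lborel. ?W * (LINT y|lborel. ?H y x))"
    by (rule integral_mono_AE[OF 1 i ae])
  also have "\<dots> = ?W * (LINT x|lborel. LINT y|lborel. ?H y x)" by simp
  also have "(LINT x|lborel. LINT y|lborel. ?H y x) = (LINT y|lborel. LINT x|lborel. ?H y x)"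
    using lborel_pair.Fubini_integral[OF approximate_identity_pair_integrable[of a]] by simp
  also have "\<dots> = (LINT y|lborel. Lp_modulus p f (a * y) * norm (\<psi> y))"
    by (simp add: Lp_modulus_def)
  finally show "(LINT x|lborel. norm (f x - (LINT y|lborel. f (x - a * y) * \<psi> y)) powr p)
        \<le> ?W * (LINT y|lborel. Lp_modulus p f (a * y) * norm (\<psi> y))" .
qed

lemma approximate_identity:
  "((\<lambda>a. LINT x|lborel. norm (f x - (LINT y|lborel. f (x - a * y) * \<psi> y)) powr p) \<longlongrightarrow> 0) (at_right 0)"
proof -
  \<comment> \<open>With \<open>a = inverse t\<close> the limit at 0 from the right becomes one at
    infinity, where dominated convergence is applied. The modulus is bounded uniformly in its
    argument, so a multiple of \<open>norm (\<psi> y)\<close> dominates.\<close>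
  have "((\<lambda>t. LINT y|lborel. Lp_modulus p f (inverse t * y) * norm (\<psi> y)) \<longlongrightarrow> (LINT y::real|lborel. 0)) at_top"
  proof (rule integral_dominated_convergence_at_top[where w = "\<lambda>y. 2 powr p * (2 * (LINT x|lborel. norm (f x) powr p)) * norm (\<psi> y)"])
    show "AE y in lborel. ((\<lambda>t. Lp_modulus p f (inverse t * y) * norm (\<psi> y)) \<longlongrightarrow> 0) at_top"
    proof (rule AE_I2)
      fix y
      have "((\<lambda>t::real. inverse t * y) \<longlongrightarrow> 0 * y) at_top"
        by (intro tendsto_mult tendsto_const tendsto_inverse_0_at_top filterlim_ident)
      moreover have "Lp_modulus p f 0 = 0" by (simp add: Lp_modulus_def)
      then have "isCont (Lp_modulus p f) 0"
        using Lp_modulus_tendsto[OF p f int] by (simp add: isCont_def)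
      ultimately have "((\<lambda>t. Lp_modulus p f (inverse t * y)) \<longlongrightarrow> Lp_modulus p f 0) at_top"
        by (intro isCont_tendsto_compose[of 0 "Lp_modulus p f"]) simp_all
      then have "((\<lambda>t. Lp_modulus p f (inverse t * y) * norm (\<psi> y)) \<longlongrightarrow> 0 * norm (\<psi> y)) at_top"
        using \<open>Lp_modulus p f 0 = 0\<close> by (intro tendsto_intros) simp
      then show "((\<lambda>t. Lp_modulus p f (inverse t * y) * norm (\<psi> y)) \<longlongrightarrow> 0) at_top" by simp
    qed
    show "\<forall>\<^sub>F t in at_top. AE y in lborel. norm (Lp_modulus p f (inverse t * y) * norm (\<psi> y))
        \<le> 2 powr p * (2 * (LINT x|lborel. norm (f x) powr p)) * norm (\<psi> y)"
    proof (intro always_eventually allI AE_I2)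
      fix t y
      have "Lp_modulus p f (inverse t * y) * norm (\<psi> y) \<le> 2 powr p * (2 * (LINT x|lborel. norm (f x) powr p)) * norm (\<psi> y)"
        using p int by (intro mult_right_mono Lp_modulus_le) auto
      then show "norm (Lp_modulus p f (inverse t * y) * norm (\<psi> y))
        \<le> 2 powr p * (2 * (LINT x|lborel. norm (f x) powr p)) * norm (\<psi> y)"
        using Lp_modulus_nonneg[of p f "inverse t * y"] by (simp add: abs_mult)
    qed
    show "integrable lborel (\<lambda>y. 2 powr p * (2 * (LINT x|lborel. norm (f x) powr p)) * norm (\<psi> y))"
      using \<psi> by (intro integrable_mult_right) auto
  qed measurable
  then have "((\<lambda>a. LINT y|lborel. Lp_modulus p f (a * y) * norm (\<psi> y)) \<longlongrightarrow> 0) (at_right 0)"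
    by (simp add: filterlim_at_right_to_top)
  then have "((\<lambda>a. (LINT y|lborel. norm (\<psi> y)) powr (p - 1) * (LINT y|lborel. Lp_modulus p f (a * y) * norm (\<psi> y)))
      \<longlongrightarrow> (LINT y|lborel. norm (\<psi> y)) powr (p - 1) * 0) (at_right 0)"
    by (intro tendsto_intros)
  then have lim: "((\<lambda>a. (LINT y|lborel. norm (\<psi> y)) powr (p - 1) * (LINT y|lborel. Lp_modulus p f (a * y) * norm (\<psi> y)))
      \<longlongrightarrow> 0) (at_right 0)"
    by simp
  show ?thesis
    by (rule real_tendsto_sandwich[OF _ _ tendsto_const lim])
       (intro always_eventually allI integral_nonneg_AE AE_I2 powr_ge_zero approximate_identity_bound)+
qed

end

section \<open>Fourier inversion\<close>

text \<open>The substitution \<open>v = a * s\<close> reduces this to the characteristic function of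
  the standard normal distribution.\<close>

lemma Gaussian_fourier:
  assumes "a > 0"
  shows "(LINT s|lborel. exp (\<i> * of_real (s * u)) * of_real (exp (- (a * s)\<^sup>2 / 2)))
    = of_real (2 * pi / a * std_normal_density (u / a))"
proof -
  have c: "(LINT v|lborel. std_normal_density v *\<^sub>R iexp (t * v)) = of_real (exp (- (t\<^sup>2) / 2))" for t
    using char_std_normal_distribution[THEN fun_cong, of t] unfolding char_def
    by (subst (asm) integral_density) auto
  have "(LINT s|lborel. exp (\<i> * of_real (s * u)) * of_real (exp (- (a * s)\<^sup>2 / 2)))
    = \<bar>1 / a\<bar> *\<^sub>R (LINT v|lborel. exp (\<i> * of_real ((0 + 1 / a * v) * u)) * of_real (exp (- (a * (0 + 1 / a * v))\<^sup>2 / 2)))"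
    using assms by (intro lborel_integral_real_affine) simp
  also have "(LINT v|lborel. exp (\<i> * of_real ((0 + 1 / a * v) * u)) * of_real (exp (- (a * (0 + 1 / a * v))\<^sup>2 / 2)))
      = (LINT v|lborel. of_real (sqrt (2 * pi)) * (std_normal_density v *\<^sub>R iexp (u / a * v)))"
    using assms by (intro Bochner_Integration.integral_cong) (auto simp: std_normal_density_def scaleR_conv_of_real field_simps)
  also have "\<dots> = of_real (sqrt (2 * pi)) * of_real (exp (- ((u / a)\<^sup>2) / 2))"
    by (simp only: integral_mult_right_zero c)
  also have "\<bar>1 / a\<bar> *\<^sub>R \<dots> = of_real (1 / a * (sqrt (2 * pi) * exp (- ((u / a)\<^sup>2) / 2)))"
    using assms by (simp add: scaleR_conv_of_real)
  also have "sqrt (2 * pi) * exp (- ((u / a)\<^sup>2) / 2) = 2 * pi * std_normal_density (u / a)"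
    by (simp add: std_normal_density_def field_simps)
  finally show ?thesis by simp
qed

lemma fourier_L1_lborel:
  assumes [measurable]: "\<psi> \<in> borel_measurable borel"
  shows "fourier_L1 \<psi> s = (LINT t|lborel. exp (- (\<i> * of_real (s * t))) * \<psi> t)"
  unfolding fourier_L1_def by (rule integral_completion) measurable

lemma measurable_fourier_L1[measurable]:
  assumes [measurable]: "\<psi> \<in> borel_measurable borel"
  shows "fourier_L1 \<psi> \<in> borel_measurable borel"
  unfolding fourier_L1_lborel[OF assms, abs_def] by measurable

text \<open>The Gaussian factor makes the double integral absolutely convergent although the
  transform of \<psi> need not be integrable. After the exchange, the inversion integral so damped
  is a convolution of \<psi> with a dilated normal density.\<close>

lemma Gauss_Weierstrass_fourier:
  assumes \<psi>: "integrable lborel \<psi>" and "a > 0"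
  shows "(LINT s|lborel. fourier_L1 \<psi> s * exp (\<i> * of_real (s * x)) * of_real (exp (- (a * s)\<^sup>2 / 2)))
    = 2 * of_real pi * (LINT y|lborel. \<psi> (x - a * y) * of_real (std_normal_density y))"
proof -
  have [measurable]: "\<psi> \<in> borel_measurable borel" using borel_measurable_integrable[OF \<psi>] by simp
  let ?g = "\<lambda>s t. (exp (\<i> * of_real (s * (x - t))) * of_real (exp (- (a * s)\<^sup>2 / 2))) * \<psi> t"
  have gauss: "integrable lborel (\<lambda>s::real. exp (- (a * s)\<^sup>2 / 2))"
  proof -
    have "integrable lborel (\<lambda>s. sqrt (2 * pi) * std_normal_density (0 + a * s))"
      using \<open>a > 0\<close> by (intro integrable_mult_right lborel_integrable_real_affine integrable_normal_density) auto
    then show ?thesis by (simp add: std_normal_density_def)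
  qed
  have pair: "integrable (lborel \<Otimes>\<^sub>M lborel) (\<lambda>(s, t). ?g s t)"
  proof (rule lborel_pair.Fubini_integrable)
    have "(LINT t|lborel. norm (?g s t)) = exp (- (a * s)\<^sup>2 / 2) * (LINT t|lborel. norm (\<psi> t))" for s
      by (simp add: norm_mult)
    then show "integrable lborel (\<lambda>s. LINT t|lborel. norm (case (s, t) of (s, t) \<Rightarrow> ?g s t))"
      using gauss by simp
    have "integrable lborel (\<lambda>t. ?g s t)" for s
      by (rule Bochner_Integration.integrable_bound[OF \<psi>]) (auto simp: norm_mult intro!: mult_left_le_one_le)
    then show "AE s in lborel. integrable lborel (\<lambda>t. case (s, t) of (s, t) \<Rightarrow> ?g s t)" by simp
  qed measurable
  have "(LINT s|lborel. fourier_L1 \<psi> s * exp (\<i> * of_real (s * x)) * of_real (exp (- (a * s)\<^sup>2 / 2)))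
      = (LINT s|lborel. LINT t|lborel. ?g s t)"
  proof (rule Bochner_Integration.integral_cong[OF refl])
    fix s
    have "fourier_L1 \<psi> s * exp (\<i> * of_real (s * x)) * of_real (exp (- (a * s)\<^sup>2 / 2))
      = (LINT t|lborel. exp (\<i> * of_real (s * x)) * of_real (exp (- (a * s)\<^sup>2 / 2)) * (exp (- (\<i> * of_real (s * t))) * \<psi> t))"
      by (subst integral_mult_right_zero) (simp add: fourier_L1_lborel mult_ac)
    also have "\<dots> = (LINT t|lborel. ?g s t)"
      by (intro Bochner_Integration.integral_cong refl)
         (simp add: algebra_simps exp_diff exp_add exp_minus divide_simps)
    finally show "fourier_L1 \<psi> s * exp (\<i> * of_real (s * x)) * of_real (exp (- (a * s)\<^sup>2 / 2)) = (LINT t|lborel. ?g s t)" .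
  qed
  also have "\<dots> = (LINT t|lborel. LINT s|lborel. ?g s t)"
    using lborel_pair.Fubini_integral[OF pair] by simp
  also have "\<dots> = (LINT t|lborel. of_real (2 * pi / a * std_normal_density ((x - t) / a)) * \<psi> t)"
    by (simp only: integral_mult_left_zero Gaussian_fourier[OF \<open>a > 0\<close>])
  also have "\<dots> = \<bar>- a\<bar> *\<^sub>R (LINT y|lborel. of_real (2 * pi / a * std_normal_density ((x - (x + (- a) * y)) / a)) * \<psi> (x + (- a) * y))"
    using \<open>a > 0\<close> by (intro lborel_integral_real_affine) simp
  also have "(LINT y|lborel. of_real (2 * pi / a * std_normal_density ((x - (x + (- a) * y)) / a)) * \<psi> (x + (- a) * y))
      = (LINT y|lborel. of_real (2 * pi / a) * (\<psi> (x - a * y) * of_real (std_normal_density y)))"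
    using \<open>a > 0\<close> by (intro Bochner_Integration.integral_cong refl) simp
  also have "\<bar>- a\<bar> *\<^sub>R \<dots> = 2 * of_real pi * (LINT y|lborel. \<psi> (x - a * y) * of_real (std_normal_density y))"
    using \<open>a > 0\<close> by (simp add: scaleR_conv_of_real)
  finally show ?thesis .
qed

text \<open>As the damping is removed, the frequency side converges at every \<open>x\<close> by
  dominated convergence, while the convolution side converges to \<psi> in L^1, by the approximate
  identity theorem with exponent 1. Equating the limits requires almost everywhere convergence,
  hence a subsequence.\<close>

lemma fourier_inversion_AE:
  assumes \<psi>: "integrable lborel \<psi>" and K: "integrable lborel (fourier_L1 \<psi>)"
  shows "AE x in lborel. \<psi> x = 1 / (2 * of_real pi) * (LINT s|lborel. fourier_L1 \<psi> s * exp (\<i> * of_real (s * x)))"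
proof -
  have [measurable]: "\<psi> \<in> borel_measurable borel" using borel_measurable_integrable[OF \<psi>] by simp
  let ?G = "\<lambda>y::real. complex_of_real (std_normal_density y)"
  have G: "integrable lborel ?G" "(LINT y|lborel. ?G y) = 1"
    by simp_all
  have n1: "integrable lborel (\<lambda>x. norm (\<psi> x) powr 1)" using \<psi> by simp
  define u where "u n x = \<psi> x - (LINT y|lborel. \<psi> (x - 1 / real (Suc n) * y) * ?G y)" for n x
  have [measurable]: "u n \<in> borel_measurable borel" for n unfolding u_def by measurable
  have ui: "integrable lborel (u n)" for n
    using approximate_identity_integrable[of 1 \<psi> ?G "1 / real (Suc n)", OF _ _ n1 G]
    unfolding u_def[symmetric] by (simp add: integrable_norm_iff)
  have "((\<lambda>a. LINT x|lborel. norm (\<psi> x - (LINT y|lborel. \<psi> (x - a * y) * ?G y)) powr 1) \<longlongrightarrow> 0) (at_right 0)"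
    using approximate_identity[of 1 \<psi> ?G, OF _ _ n1 G] by simp
  moreover have "filterlim (\<lambda>n. 1 / real (Suc n)) (at_right 0) sequentially"
    unfolding filterlim_at using LIMSEQ_inverse_real_of_nat by (auto simp: inverse_eq_divide)
  ultimately have "(\<lambda>n. LINT x|lborel. norm (\<psi> x - (LINT y|lborel. \<psi> (x - 1 / real (Suc n) * y) * ?G y)) powr 1) \<longlonglongrightarrow> 0"
    by (rule filterlim_compose)
  then have "(\<lambda>n. LINT x|lborel. norm (u n x)) \<longlonglongrightarrow> 0" by (simp add: u_def)
  from tendsto_L1_AE_subseq[OF ui this] obtain r where r: "strict_mono r" "AE x in lborel. (\<lambda>n. u (r n) x) \<longlonglongrightarrow> 0"
    by auto
  from r(2) show ?thesis
  proof eventually_elim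
    case (elim x)
    have "(\<lambda>n. LINT s|lborel. fourier_L1 \<psi> s * exp (\<i> * of_real (s * x)) * of_real (exp (- (1 / real (Suc n) * s)\<^sup>2 / 2)))
        \<longlonglongrightarrow> (LINT s|lborel. fourier_L1 \<psi> s * exp (\<i> * of_real (s * x)))"
    proof (rule integral_dominated_convergence[where w = "\<lambda>s. norm (fourier_L1 \<psi> s)"])
      show "AE s in lborel. (\<lambda>n. fourier_L1 \<psi> s * exp (\<i> * of_real (s * x)) * of_real (exp (- (1 / real (Suc n) * s)\<^sup>2 / 2)))
          \<longlonglongrightarrow> fourier_L1 \<psi> s * exp (\<i> * of_real (s * x))"
      proof (rule AE_I2)
        fix s
        have "(\<lambda>n. 1 / real (Suc n)) \<longlonglongrightarrow> 0" using LIMSEQ_inverse_real_of_nat by (simp add: inverse_eq_divide)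
        then have "(\<lambda>n. fourier_L1 \<psi> s * exp (\<i> * of_real (s * x)) * of_real (exp (- (1 / real (Suc n) * s)\<^sup>2 / 2)))
          \<longlonglongrightarrow> fourier_L1 \<psi> s * exp (\<i> * of_real (s * x)) * of_real (exp (- (0 * s)\<^sup>2 / 2))"
          by (intro tendsto_intros) auto
        then show "(\<lambda>n. fourier_L1 \<psi> s * exp (\<i> * of_real (s * x)) * of_real (exp (- (1 / real (Suc n) * s)\<^sup>2 / 2)))
          \<longlonglongrightarrow> fourier_L1 \<psi> s * exp (\<i> * of_real (s * x))" by simp
      qed
      show "AE s in lborel. norm (fourier_L1 \<psi> s * exp (\<i> * of_real (s * x)) * of_real (exp (- (1 / real (Suc n) * s)\<^sup>2 / 2)))
          \<le> norm (fourier_L1 \<psi> s)" for n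
        by (intro AE_I2) (simp add: norm_mult mult_left_le)
    qed (use K in auto)
    then have "(\<lambda>n. 2 * of_real pi * (LINT y|lborel. \<psi> (x - 1 / real (Suc n) * y) * ?G y))
        \<longlonglongrightarrow> (LINT s|lborel. fourier_L1 \<psi> s * exp (\<i> * of_real (s * x)))"
      by (subst (asm) Gauss_Weierstrass_fourier[OF \<psi>]) auto
    then have "(\<lambda>n. 2 * of_real pi * (\<psi> x - u n x)) \<longlonglongrightarrow> (LINT s|lborel. fourier_L1 \<psi> s * exp (\<i> * of_real (s * x)))"
      by (simp add: u_def)
    from LIMSEQ_subseq_LIMSEQ[OF this r(1)]
    have 1: "(\<lambda>n. 2 * of_real pi * (\<psi> x - u (r n) x)) \<longlonglongrightarrow> (LINT s|lborel. fourier_L1 \<psi> s * exp (\<i> * of_real (s * x)))"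
      by (simp add: o_def)
    have 2: "(\<lambda>n. 2 * of_real pi * (\<psi> x - u (r n) x)) \<longlonglongrightarrow> 2 * of_real pi * (\<psi> x - 0)"
      by (intro tendsto_intros elim)
    have "(LINT s|lborel. fourier_L1 \<psi> s * exp (\<i> * of_real (s * x))) = 2 * of_real pi * \<psi> x"
      using LIMSEQ_unique[OF 1 2] by simp
    then show ?case by simp
  qed
qed

section \<open>The pairing with the Fourier transform\<close>

lemma norm_iexp_diff_le: "norm (iexp u - iexp v) \<le> \<bar>u - v\<bar>"
proof -
  have "iexp u - iexp v = iexp v * (iexp (u - v) - 1)"
    by (simp add: algebra_simps exp_add[symmetric])
  then have "norm (iexp u - iexp v) = norm (iexp (u - v) - 1)" by (simp add: norm_mult)
  also have "\<dots> \<le> \<bar>u - v\<bar>" using iexp_approx1[of "u - v" 0] by simp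
  finally show ?thesis .
qed

lemma Psi_kernel_iexp: "t \<noteq> 0 \<Longrightarrow> Psi_kernel s t = (1 - iexp (- s * t)) / (\<i> * of_real t)"
  by (simp add: Psi_kernel_def)

lemma Psi_kernel_0[simp]: "Psi_kernel 0 t = 0"
  by (simp add: Psi_kernel_def)

lemma norm_Psi_kernel_diff_le: "norm (Psi_kernel u t - Psi_kernel v t) \<le> \<bar>u - v\<bar>"
proof (cases "t = 0")
  case True
  then show ?thesis by (simp add: Psi_kernel_def of_real_diff[symmetric] del: of_real_diff)
next
  case False
  then have "Psi_kernel u t - Psi_kernel v t = (iexp (- v * t) - iexp (- u * t)) / (\<i> * of_real t)"
    by (simp add: Psi_kernel_iexp diff_divide_distrib)
  then have "norm (Psi_kernel u t - Psi_kernel v t) = norm (iexp (- v * t) - iexp (- u * t)) / \<bar>t\<bar>"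
    by (simp add: norm_divide norm_mult)
  also have "\<dots> \<le> \<bar>- v * t - - u * t\<bar> / \<bar>t\<bar>" by (intro divide_right_mono norm_iexp_diff_le) auto
  also have "- v * t - - u * t = (u - v) * t" by (simp add: algebra_simps)
  finally show ?thesis using False by (simp add: abs_mult)
qed

lemma norm_Psi_kernel_le_abs: "norm (Psi_kernel s t) \<le> \<bar>s\<bar>"
  using norm_Psi_kernel_diff_le[of s t 0] by simp

lemma norm_Psi_kernel_le_inverse: "t \<noteq> 0 \<Longrightarrow> norm (Psi_kernel s t) \<le> 2 / \<bar>t\<bar>"
  using norm_triangle_ineq4[of 1 "iexp (- s * t)"]
  by (simp add: Psi_kernel_iexp norm_divide norm_mult divide_right_mono)

text \<open>A single expression covering the bounds \<open>\<bar>s\<bar>\<close> and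
  \<open>2 / \<bar>t\<bar>\<close>. They coincide when \<open>\<bar>s * t\<bar> = 2\<close>, and
  there the right-hand side equals both; this is the origin of the constant 3.\<close>

lemma norm_Psi_kernel_le: "norm (Psi_kernel s t) \<le> 3 * \<bar>s\<bar> / (1 + \<bar>s * t\<bar>)"
proof (cases "\<bar>s * t\<bar> \<le> 2")
  case True
  then have "\<bar>s\<bar> * (1 + \<bar>s * t\<bar>) \<le> \<bar>s\<bar> * 3" by (intro mult_left_mono) auto
  then have "\<bar>s\<bar> \<le> 3 * \<bar>s\<bar> / (1 + \<bar>s * t\<bar>)" by (subst pos_le_divide_eq) (auto simp: mult.commute)
  then show ?thesis using norm_Psi_kernel_le_abs order_trans by blast
next
  case False
  then have "t \<noteq> 0" by auto
  then have "2 / \<bar>t\<bar> * (1 + \<bar>s * t\<bar>) = 2 / \<bar>t\<bar> + 2 * \<bar>s\<bar>" by (simp add: abs_mult distrib_left)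
  also have "2 / \<bar>t\<bar> \<le> \<bar>s\<bar>" using False \<open>t \<noteq> 0\<close> by (simp add: divide_le_eq abs_mult)
  finally have "2 / \<bar>t\<bar> * (1 + \<bar>s * t\<bar>) \<le> 3 * \<bar>s\<bar>" by simp
  then have "2 / \<bar>t\<bar> \<le> 3 * \<bar>s\<bar> / (1 + \<bar>s * t\<bar>)" by (subst pos_le_divide_eq) auto
  then show ?thesis using norm_Psi_kernel_le_inverse[OF \<open>t \<noteq> 0\<close>] order_trans by blast
qed

lemma measurable_Psi_kernel[measurable]:
  assumes [measurable]: "f \<in> borel_measurable M" "g \<in> borel_measurable M"
  shows "(\<lambda>x. Psi_kernel (f x) (g x)) \<in> borel_measurable M"
  unfolding Psi_kernel_def by measurable

text \<open>Used with \<open>r = 1 + 1 / p\<close>, the exponent at which the kernel bound decays in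
  \<open>s * t\<close>.\<close>

lemma integrable_one_plus_abs_powr:
  assumes "1 < r"
  shows "integrable lborel (\<lambda>u::real. (1 + \<bar>u\<bar>) powr (- r))"
proof -
  have "(\<integral>\<^sup>+u. ennreal ((1 + \<bar>u::real\<bar>) powr (- r)) * indicator {0..} u \<partial>lborel) = 0 - (- ((1 + 0) powr (1 - r) / (r - 1)))"
  proof (rule nn_integral_FTC_atLeast)
    fix u :: real assume "0 \<le> u"
    have "((\<lambda>u. (1 + u) powr (1 - r)) has_real_derivative (1 - r) * (1 + u) powr (- r)) (at u)"
      using \<open>0 \<le> u\<close> by (auto intro!: derivative_eq_intros)
    from DERIV_minus[OF DERIV_cdivide[OF this, of "r - 1"]]
    have "((\<lambda>u. - ((1 + u) powr (1 - r) / (r - 1))) has_real_derivative - ((1 - r) * (1 + u) powr (- r) / (r - 1))) (at u)" .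
    moreover have "- ((1 - r) * z / (r - 1)) = z" for z
      using assms by (simp add: divide_simps algebra_simps)
    ultimately have "((\<lambda>u. - ((1 + u) powr (1 - r) / (r - 1))) has_real_derivative (1 + u) powr (- r)) (at u)"
      by simp
    then show "((\<lambda>u. - ((1 + u) powr (1 - r) / (r - 1))) has_real_derivative (1 + \<bar>u\<bar>) powr (- r)) (at u)"
      using \<open>0 \<le> u\<close> by simp
  next
    have "((\<lambda>u::real. (1 + u) powr (1 - r)) \<longlongrightarrow> 0) at_top"
      using assms by (intro tendsto_neg_powr filterlim_tendsto_add_at_top[OF tendsto_const] filterlim_ident) auto
    then have "((\<lambda>u. - ((1 + u) powr (1 - r) / (r - 1))) \<longlongrightarrow> - (0 / (r - 1))) at_top"
      using assms by (intro tendsto_intros) auto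
    then show "((\<lambda>u. - ((1 + u) powr (1 - r) / (r - 1))) \<longlongrightarrow> 0) at_top" by simp
  qed auto
  then have "integrable lborel (\<lambda>u::real. (1 + \<bar>u\<bar>) powr (- r) * indicator {0..} u)"
    by (intro integrableI_bounded) (auto simp: ennreal_mult' ennreal_indicator)
  note g = this lborel_integrable_real_affine[OF this, of "- 1" 0]
  have "integrable lborel (\<lambda>u::real. (1 + \<bar>u\<bar>) powr (- r) * indicator {0..} u + (1 + \<bar>u\<bar>) powr (- r) * indicator {0..} (- u))"
    using g by simp
  then show ?thesis
    by (rule Bochner_Integration.integrable_bound) (auto intro!: AE_I2 simp: indicator_def)
qed

text \<open>Either \<open>b \<le> l\<close>, or \<open>b = b powr p * b powr (1 - p)\<close> with a
  nonpositive exponent \<open>1 - p\<close>, so that replacing \<open>b\<close> by the smaller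
  \<open>l\<close> in the last factor only increases it.\<close>

lemma le_add_powr_mult:
  fixes b l p :: real
  assumes "0 \<le> b" "0 < l" "1 \<le> p"
  shows "b \<le> l + b powr p * l powr (1 - p)"
proof (cases "b \<le> l")
  case True
  then show ?thesis by (simp add: add_increasing2)
next
  case False
  then have "b powr (1 - p) \<le> l powr (1 - p)" using assms by (intro powr_mono2') auto
  then have "b powr p * b powr (1 - p) \<le> b powr p * l powr (1 - p)" by (intro mult_left_mono) auto
  moreover have "b powr p * b powr (1 - p) = b" using False assms by (simp add: powr_add[symmetric])
  ultimately show ?thesis using assms by simp
qed

text \<open>Hoelder's inequality is replaced by the pointwise bound above, applied to \<open>b = \<bar>f t\<bar>\<close> and
  \<open>l = (\<bar>s\<bar> / (1 + \<bar>s t\<bar>))\<^bsup>1/p\<^esup>\<close>.\<close>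

lemma Psi_kernel_mult_bound:
  assumes "1 \<le> p" "s \<noteq> 0"
  shows "norm (Psi_kernel s t) * norm z
    \<le> 3 * \<bar>s\<bar> powr (1 / p) * (\<bar>s\<bar> * (1 + \<bar>s * t\<bar>) powr (- (1 + 1 / p)) + norm z powr p)"
proof -
  define w where "w = 1 + \<bar>s * t\<bar>"
  \<comment> \<open>This choice balances the two terms: multiplied by
    \<open>\<bar>s\<bar> / w\<close>, each carries the factor
    \<open>\<bar>s\<bar> powr (1 / p)\<close>, and what remains of the first is a function of
    \<open>s * t\<close> scaled by \<open>\<bar>s\<bar>\<close>.\<close>
  define l where "l = (\<bar>s\<bar> / w) powr (1 / p)"
  have w: "w \<ge> 1" by (simp add: w_def)
  have l: "l > 0" using w assms by (simp add: l_def)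
  have lw: "l = \<bar>s\<bar> powr (1 / p) * w powr (- (1 / p))"
    using w unfolding l_def by (subst powr_divide) (simp_all add: powr_minus_divide)
  have 1: "3 * \<bar>s\<bar> / w * l = 3 * \<bar>s\<bar> powr (1 / p) * (\<bar>s\<bar> * w powr (- (1 + 1 / p)))"
  proof -
    have "w powr (- (1 + 1 / p)) = w powr (- 1) * w powr (- (1 / p))"
      by (simp only: powr_add[symmetric] minus_add_distrib)
    also have "w powr (- 1) = 1 / w" using w by (simp add: powr_minus_divide)
    finally show ?thesis by (simp add: lw)
  qed
  have 2: "\<bar>s\<bar> / w * l powr (1 - p) \<le> \<bar>s\<bar> powr (1 / p)"
  proof -
    have "l powr (1 - p) = (\<bar>s\<bar> / w) powr (1 / p * (1 - p))" by (simp add: l_def powr_powr)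
    also have "1 / p * (1 - p) = 1 / p - 1" using assms by (simp add: field_simps)
    finally have "\<bar>s\<bar> / w * l powr (1 - p) = (\<bar>s\<bar> / w) powr 1 * (\<bar>s\<bar> / w) powr (1 / p - 1)"
      using w by simp
    also have "\<dots> = (\<bar>s\<bar> / w) powr (1 / p)" by (simp only: powr_add[symmetric]) simp
    also have "\<dots> \<le> \<bar>s\<bar> powr (1 / p)"
      using w assms by (intro powr_mono2) (auto simp: divide_le_eq mult_left_le intro: mult_right_mono[of 1 w "\<bar>s\<bar>", simplified])
    finally show ?thesis .
  qed
  have "norm (Psi_kernel s t) * norm z \<le> 3 * \<bar>s\<bar> / w * (l + norm z powr p * l powr (1 - p))"
    using w l assms norm_Psi_kernel_le[of s t]
    by (intro mult_mono le_add_powr_mult) (auto simp: w_def)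
  also have "\<dots> = 3 * \<bar>s\<bar> / w * l + 3 * norm z powr p * (\<bar>s\<bar> / w * l powr (1 - p))"
    by (simp add: distrib_left)
  also have "\<dots> \<le> 3 * \<bar>s\<bar> / w * l + 3 * norm z powr p * \<bar>s\<bar> powr (1 / p)"
    using 2 by (intro add_left_mono mult_left_mono) auto
  also have "\<dots> = 3 * \<bar>s\<bar> powr (1 / p) * (\<bar>s\<bar> * w powr (- (1 + 1 / p)) + norm z powr p)"
    unfolding 1 by (simp add: algebra_simps)
  finally show ?thesis by (simp add: w_def)
qed

text \<open>The substitution \<open>u = s * t\<close> makes the integral of the scaled decay term
  independent of \<open>s\<close>, so only the common factor
  \<open>\<bar>s\<bar> powr (1 / p)\<close> depends on it. The resulting constant
  \<open>3 * (Q + N)\<close> is not homogeneous in \<open>f\<close>, which is harmless for a fixed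
  \<open>f\<close>.\<close>

lemma Psi_kernel_integral_bound:
  fixes f :: "real \<Rightarrow> complex"
  assumes p: "1 \<le> p" and [measurable]: "f \<in> borel_measurable borel"
    and int: "integrable lborel (\<lambda>x. norm (f x) powr p)"
  obtains C where "C \<ge> 0"
    "\<And>s. integrable lborel (\<lambda>t. Psi_kernel s t * f t)"
    "\<And>s. (LINT t|lborel. norm (Psi_kernel s t * f t)) \<le> C * \<bar>s\<bar> powr (1 / p)"
proof -
  let ?q = "\<lambda>u::real. (1 + \<bar>u\<bar>) powr (- (1 + 1 / p))"
  define Q where "Q = (LINT u|lborel. ?q u)"
  define N where "N = (LINT x|lborel. norm (f x) powr p)"
  have q: "integrable lborel ?q" using p by (intro integrable_one_plus_abs_powr) auto
  have QN: "Q \<ge> 0" "N \<ge> 0" unfolding Q_def N_def by (auto intro!: integral_nonneg_AE)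
  have main: "integrable lborel (\<lambda>t. Psi_kernel s t * f t) \<and>
      (LINT t|lborel. norm (Psi_kernel s t * f t)) \<le> 3 * (Q + N) * \<bar>s\<bar> powr (1 / p)" for s
  proof (cases "s = 0")
    case True
    then show ?thesis using QN by simp
  next
    case False
    let ?b = "\<lambda>t. 3 * \<bar>s\<bar> powr (1 / p) * (\<bar>s\<bar> * ?q (s * t) + norm (f t) powr p)"
    have qs: "integrable lborel (\<lambda>t. ?q (s * t))"
      using lborel_integrable_real_affine[OF q False, of 0] by simp
    have b: "integrable lborel ?b" using qs int by auto
    have le: "norm (Psi_kernel s t * f t) \<le> ?b t" for t
      using Psi_kernel_mult_bound[OF p False] by (simp add: norm_mult)
    have "(LINT t|lborel. \<bar>s\<bar> * ?q (s * t)) = Q"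
      using lborel_integral_real_affine[OF False, of ?q 0] by (simp add: Q_def)
    then have B: "(LINT t|lborel. ?b t) = 3 * \<bar>s\<bar> powr (1 / p) * (Q + N)"
      using qs int by (simp add: N_def)
    have i: "integrable lborel (\<lambda>t. Psi_kernel s t * f t)"
    proof (rule Bochner_Integration.integrable_bound[OF b])
      show "AE t in lborel. norm (Psi_kernel s t * f t) \<le> norm (?b t)"
      proof (rule AE_I2)
        show "norm (Psi_kernel s t * f t) \<le> norm (?b t)" for t
          using le[of t] by (simp only: real_norm_def)
      qed
    qed measurable
    have "(LINT t|lborel. norm (Psi_kernel s t * f t)) \<le> (LINT t|lborel. ?b t)"
      using i b by (intro integral_mono le) auto
    also note B
    also have "3 * \<bar>s\<bar> powr (1 / p) * (Q + N) = 3 * (Q + N) * \<bar>s\<bar> powr (1 / p)" by simp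
    finally show ?thesis using i by blast
  qed
  show thesis by (rule that[of "3 * (Q + N)"]) (use main QN in auto)
qed

text \<open>Disposes of boundary terms: an integrable bound need not tend to 0 at infinity, but it
  cannot stay above a positive constant on a half-line.\<close>

lemma limit_eq_0_if_integrable_bound:
  fixes h :: "real \<Rightarrow> 'a::real_normed_vector" and b :: "real \<Rightarrow> real"
  assumes lim: "(h \<longlongrightarrow> L) at_top" and b: "integrable lborel b" and le: "\<And>x. norm (h x) \<le> b x"
  shows "L = 0"
proof (rule ccontr)
  assume "L \<noteq> 0"
  define c where "c = norm L / 2"
  have "c > 0" using \<open>L \<noteq> 0\<close> by (simp add: c_def)
  have "c < norm L" using \<open>L \<noteq> 0\<close> by (simp add: c_def)
  then have "\<forall>\<^sub>F x in at_top. c < norm (h x)" by (rule order_tendstoD(1)[OF tendsto_norm[OF lim]])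
  then obtain x0 where x0: "\<And>x. x \<ge> x0 \<Longrightarrow> c < norm (h x)" by (auto simp: eventually_at_top_linorder)
  have b0: "b x \<ge> 0" for x using le[of x] norm_ge_zero[of "h x"] by linarith
  have "c * real n \<le> (LINT x|lborel. b x)" for n
  proof -
    have "(LINT x|lborel. c * indicator {x0..x0 + real n} x) \<le> (LINT x|lborel. b x)"
    proof (rule integral_mono)
      show "c * indicator {x0..x0 + real n} x \<le> b x" for x
        using x0[of x] le[of x] b0[of x] by (auto simp: indicator_def)
    qed (use b in auto)
    then show ?thesis by simp
  qed
  moreover obtain n where "(LINT x|lborel. b x) < real n * c" using ex_less_of_nat_mult[OF \<open>c > 0\<close>] by blast
  ultimately show False by (metis mult.commute not_less)
qed

section \<open>Borel derivatives, integration by parts and Fubini\<close>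

lemma AE_lborel_if_negligible:
  assumes "negligible N" "\<And>x. x \<notin> N \<Longrightarrow> P x"
  shows "AE x in lborel. P x"
proof -
  have "AE x in lebesgue. x \<notin> N" using assms(1) by (auto simp: negligible_iff_null_sets intro: AE_not_in)
  then have "AE x in lebesgue. P x" by eventually_elim (rule assms(2))
  then show ?thesis by (simp add: AE_completion_iff)
qed

text \<open>\<open>vector_derivative\<close> takes arbitrary values on the exceptional null set, so
  a Borel version of the derivative is built for use under Fubini's theorem.\<close>

lemma abs_continuous_borel_derivative:
  assumes "abs_continuous g"
  obtains D where "D \<in> borel_measurable borel" "AE s in lborel. (g has_vector_derivative D s) (at s)"
proof -
  obtain N where N: "negligible N" "\<And>x. x \<notin> N \<Longrightarrow> (g has_vector_derivative vector_derivative g (at x)) (at x)"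
    using abs_continuous_differentiable[OF assms] by metis
  have "continuous_on UNIV g" using abs_continuous_isCont[OF assms] by (auto intro: continuous_at_imp_continuous_on)
  then have [measurable]: "g \<in> borel_measurable borel" by (rule borel_measurable_continuous_onI)
  \<comment> \<open>A limit along the fixed sequence \<open>1 / Suc n\<close> of Borel difference
    quotients is Borel everywhere, and equals the derivative wherever that exists.\<close>
  define D where "D s = lim (\<lambda>n. (g (s + 1 / real (Suc n)) - g s) /\<^sub>R (1 / real (Suc n)))" for s
  show thesis
  proof (rule that[of D])
    show "D \<in> borel_measurable borel" unfolding D_def by measurable
    show "AE s in lborel. (g has_vector_derivative D s) (at s)"
    proof (rule AE_lborel_if_negligible[OF N(1)])
      fix s assume "s \<notin> N"
      then have d: "(g has_vector_derivative vector_derivative g (at s)) (at s)" by (rule N(2))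
      then have "((\<lambda>h. norm (g (s + h) - g s - h *\<^sub>R vector_derivative g (at s)) / norm h) \<longlongrightarrow> 0) (at 0)"
        by (simp add: has_vector_derivative_def has_derivative_at)
      moreover have "\<forall>\<^sub>F h in at 0. norm (g (s + h) - g s - h *\<^sub>R vector_derivative g (at s)) / norm h
          = norm ((g (s + h) - g s) /\<^sub>R h - vector_derivative g (at s))"
      proof (rule eventually_mono[OF eventually_neq_at_within[of 0]])
        fix h :: real assume "h \<noteq> 0"
        then have "(g (s + h) - g s) /\<^sub>R h - vector_derivative g (at s)
            = (g (s + h) - g s - h *\<^sub>R vector_derivative g (at s)) /\<^sub>R h"
          by (simp add: scaleR_diff_right)
        then show "norm (g (s + h) - g s - h *\<^sub>R vector_derivative g (at s)) / norm h
          = norm ((g (s + h) - g s) /\<^sub>R h - vector_derivative g (at s))"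
          by (simp add: divide_inverse mult.commute)
      qed
      ultimately have "((\<lambda>h. norm ((g (s + h) - g s) /\<^sub>R h - vector_derivative g (at s))) \<longlongrightarrow> 0) (at 0)"
        by (rule Lim_transform_eventually)
      then have "((\<lambda>h. (g (s + h) - g s) /\<^sub>R h) \<longlongrightarrow> vector_derivative g (at s)) (at 0)"
        by (simp add: tendsto_norm_zero_iff LIM_zero_iff)
      moreover have "filterlim (\<lambda>n. 1 / real (Suc n)) (at 0) sequentially"
        unfolding filterlim_at using LIMSEQ_inverse_real_of_nat by (auto simp: inverse_eq_divide)
      ultimately have "(\<lambda>n. (g (s + 1 / real (Suc n)) - g s) /\<^sub>R (1 / real (Suc n))) \<longlonglongrightarrow> vector_derivative g (at s)"
        by (rule filterlim_compose)
      then have "D s = vector_derivative g (at s)" unfolding D_def by (rule limI)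
      then show "(g has_vector_derivative D s) (at s)" using d by simp
    qed
  qed
qed

lemma negligible_if_AE_lborel:
  assumes "AE x in lborel. P x"
  shows "negligible {x. \<not> P x}"
proof -
  have "AE x in lebesgue. P x" using assms by (simp only: AE_completion_iff)
  then have "{x \<in> space lebesgue. \<not> P x} \<in> null_sets lebesgue"
    by (simp only: completion.AE_iff_null_sets)
  then show ?thesis by (simp add: negligible_iff_null_sets)
qed

lemma measurable_lebesgue_AE_eq:
  assumes f: "f \<in> measurable lebesgue borel" and eq: "AE x in lebesgue. g x = f x"
  shows "g \<in> measurable lebesgue borel"
proof (rule measurableI)
  fix S :: "'b set" assume S: "S \<in> sets borel"
  show "g -` S \<inter> space lebesgue \<in> sets lebesgue"
  proof (rule completion.in_sets_AE)
    show "AE x in lebesgue. x \<in> f -` S \<inter> space lebesgue \<longleftrightarrow> x \<in> g -` S \<inter> space lebesgue"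
      using eq by eventually_elim simp
    show "f -` S \<inter> space lebesgue \<in> sets lebesgue" using f S by (rule measurable_sets)
  qed auto
qed simp

lemma Psi_kernel_has_vector_derivative:
  assumes "t \<noteq> 0"
  shows "((\<lambda>s. Psi_kernel s t) has_vector_derivative exp (- (\<i> * of_real (s * t)))) (at s)"
proof -
  have "((\<lambda>z. (1 - exp (- (\<i> * (z * of_real t)))) / (\<i> * of_real t)) has_field_derivative
      exp (- (\<i> * (of_real s * of_real t)))) (at (of_real s))"
    using assms by (auto intro!: derivative_eq_intros simp: mult_ac)
  from has_vector_derivative_real_field[OF this] show ?thesis
    using assms by (simp add: Psi_kernel_def[abs_def])
qed

text \<open>The product \<open>H\<close> of kernel and \<open>g\<close> has the integrable
  derivative \<open>h\<close>, so the integral of \<open>h\<close> is the limit of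
  \<open>H R - H (- R)\<close>. These differences are bounded by an integrable function of
  \<open>R\<close>, because the kernel is bounded in \<open>s\<close> for
  \<open>t \<noteq> 0\<close>; the limit is therefore 0.\<close>

lemma Psi_kernel_integration_by_parts:
  assumes p: "1 \<le> p" and AC: "abs_continuous g" and g: "integrable lborel g"
    and D[measurable]: "D \<in> borel_measurable borel"
    and der: "AE s in lborel. (g has_vector_derivative D s) (at s)"
    and iD: "integrable lborel (\<lambda>s. \<bar>s\<bar> powr (1 / p) * norm (D s))"
    and "t \<noteq> 0"
  shows "(LINT s|lborel. Psi_kernel s t * D s) = - fourier_L1 g t"
proof -
  have [measurable]: "g \<in> borel_measurable borel" using borel_measurable_integrable[OF g] by simp
  define e where "e s = exp (- (\<i> * of_real (s * t)))" for s
  have [measurable]: "e \<in> borel_measurable borel" unfolding e_def by measurable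
  have ne: "norm (e s) = 1" for s by (simp add: e_def)
  define H where "H s = Psi_kernel s t * g s" for s
  define h where "h s = Psi_kernel s t * D s + e s * g s" for s
  have eg: "integrable lborel (\<lambda>s. e s * g s)"
    by (rule Bochner_Integration.integrable_bound[OF g]) (auto simp: norm_mult ne)
  \<comment> \<open>For \<open>\<bar>s\<bar> \<le> 1\<close> the bound \<open>\<bar>s\<bar>\<close>
    is at most \<open>\<bar>s\<bar> powr (1 / p)\<close>, as \<open>1 / p \<le> 1\<close>; for
    larger \<open>s\<close> the bound \<open>2 / \<bar>t\<bar>\<close> suffices, the weight being at
    least 1.\<close>
  define c where "c = max 1 (2 / \<bar>t\<bar>)"
  have kle: "norm (Psi_kernel s t) \<le> c * \<bar>s\<bar> powr (1 / p)" for s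
  proof (cases "\<bar>s\<bar> \<le> 1")
    case True
    have "\<bar>s\<bar> powr 1 \<le> \<bar>s\<bar> powr (1 / p)"
      using True p by (intro powr_mono') auto
    then have "norm (Psi_kernel s t) \<le> 1 * \<bar>s\<bar> powr (1 / p)"
      using norm_Psi_kernel_le_abs[of s t] by simp
    also have "\<dots> \<le> c * \<bar>s\<bar> powr (1 / p)" by (intro mult_right_mono) (auto simp: c_def)
    finally show ?thesis .
  next
    case False
    then have "1 \<le> \<bar>s\<bar> powr (1 / p)" using p by (intro ge_one_powr_ge_zero) auto
    then have "c * 1 \<le> c * \<bar>s\<bar> powr (1 / p)" by (intro mult_left_mono) (auto simp: c_def)
    then show ?thesis using norm_Psi_kernel_le_inverse[OF \<open>t \<noteq> 0\<close>, of s] by (simp add: c_def)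
  qed
  have kD: "integrable lborel (\<lambda>s. Psi_kernel s t * D s)"
  proof (rule Bochner_Integration.integrable_bound)
    show "integrable lborel (\<lambda>s. c * (\<bar>s\<bar> powr (1 / p) * norm (D s)))" using iD by simp
    show "AE s in lborel. norm (Psi_kernel s t * D s) \<le> norm (c * (\<bar>s\<bar> powr (1 / p) * norm (D s)))"
    proof (rule AE_I2)
      fix s
      have "norm (Psi_kernel s t * D s) \<le> (c * \<bar>s\<bar> powr (1 / p)) * norm (D s)"
        unfolding norm_mult by (intro mult_right_mono kle) auto
      also have "\<dots> \<le> norm (c * (\<bar>s\<bar> powr (1 / p) * norm (D s)))"
        by (simp only: real_norm_def mult.assoc abs_ge_self)
      finally show "norm (Psi_kernel s t * D s) \<le> norm (c * (\<bar>s\<bar> powr (1 / p) * norm (D s)))" .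
    qed
  qed measurable
  have ih: "integrable lborel h" unfolding h_def using kD eg by simp
  have [measurable]: "h \<in> borel_measurable borel" unfolding h_def by measurable
  have ACH: "abs_continuous H" unfolding H_def
    by (rule abs_continuous_mult_Lipschitz[OF AC])
       (intro exI[of _ 1] ballI, use norm_Psi_kernel_diff_le in auto)
  have derH: "AE s in lborel. (H has_vector_derivative h s) (at s)"
    using der
  proof eventually_elim
    case (elim s)
    from has_vector_derivative_mult[OF Psi_kernel_has_vector_derivative[OF \<open>t \<noteq> 0\<close>, of s] elim]
    show ?case unfolding H_def h_def e_def .
  qed
  have FTC: "(LINT s|lborel. indicator {- R..R} s *\<^sub>R h s) = H R - H (- R)" if "R \<ge> 0" for R
  proof -
    have "(h has_integral (H R - H (- R))) {- R..R}"
      using ACH that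
      by (intro abs_continuous_FTC[OF _ _ negligible_if_AE_lborel[OF derH]]) (auto simp: abs_continuous_def)
    moreover have "set_integrable lborel {- R..R} h"
      unfolding set_integrable_def using ih by (intro integrable_mult_indicator) auto
    ultimately show ?thesis
      using set_borel_integral_eq_integral(2)[of "{- R..R}" h] by (simp add: set_lebesgue_integral_def integral_unique)
  qed
  have "((\<lambda>R. LINT s|lborel. indicator {- R..R} s *\<^sub>R h s) \<longlongrightarrow> (LINT s|lborel. h s)) at_top"
  proof (rule integral_dominated_convergence_at_top[where w = "\<lambda>s. norm (h s)"])
    show "AE s in lborel. ((\<lambda>R. indicator {- R..R} s *\<^sub>R h s) \<longlongrightarrow> h s) at_top"
    proof (rule AE_I2)
      fix s :: real
      have "\<forall>\<^sub>F R in at_top. \<bar>s\<bar> \<le> R" by (rule eventually_ge_at_top)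
      then show "((\<lambda>R. indicator {- R..R} s *\<^sub>R h s) \<longlongrightarrow> h s) at_top"
        by (intro tendsto_eventually, eventually_elim) (auto simp: indicator_def)
    qed
    show "\<forall>\<^sub>F R in at_top. AE s in lborel. norm (indicator {- R..R} s *\<^sub>R h s) \<le> norm (h s)"
      by (intro always_eventually allI AE_I2) (auto simp: indicator_def)
  qed (use ih in auto)
  moreover have "\<forall>\<^sub>F R in at_top. (LINT s|lborel. indicator {- R..R} s *\<^sub>R h s) = H R - H (- R)"
    using eventually_ge_at_top[of 0] by eventually_elim (rule FTC)
  ultimately have lim: "((\<lambda>R. H R - H (- R)) \<longlongrightarrow> (LINT s|lborel. h s)) at_top"
    by (rule Lim_transform_eventually)
  have "(LINT s|lborel. h s) = 0"
  proof (rule limit_eq_0_if_integrable_bound[OF lim])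
    show "integrable lborel (\<lambda>R. 2 / \<bar>t\<bar> * (norm (g R) + norm (g (- R))))"
      using g lborel_integrable_real_affine[OF g, of "- 1" 0] by simp
    fix R
    have "norm (H s) \<le> 2 / \<bar>t\<bar> * norm (g s)" for s
      unfolding H_def norm_mult using \<open>t \<noteq> 0\<close> by (intro mult_right_mono norm_Psi_kernel_le_inverse) auto
    from add_mono[OF this[of R] this[of "- R"]] norm_triangle_ineq4[of "H R" "H (- R)"]
    show "norm (H R - H (- R)) \<le> 2 / \<bar>t\<bar> * (norm (g R) + norm (g (- R)))"
      by (simp add: distrib_left)
  qed
  moreover have "(LINT s|lborel. h s) = (LINT s|lborel. Psi_kernel s t * D s) + (LINT s|lborel. e s * g s)"
    unfolding h_def using kD eg by simp
  moreover have "(LINT s|lborel. e s * g s) = fourier_L1 g t"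
    by (simp add: fourier_L1_lborel e_def mult.commute)
  ultimately show ?thesis by (simp add: eq_neg_iff_add_eq_0)
qed

text \<open>The integral over \<open>t\<close> of the modulus of kernel times \<open>f\<close> is at
  most \<open>C * \<bar>s\<bar> powr (1 / p)\<close>, so the hypothesis on \<open>D\<close> provides
  the absolute convergence for exchanging integrals. The minus sign from integration by parts
  cancels the one in the definition of the pairing.\<close>

lemma fourier_pairing_eq:
  fixes f g D :: "real \<Rightarrow> complex"
  assumes p: "1 \<le> p" and f[measurable]: "f \<in> borel_measurable borel"
    and int: "integrable lborel (\<lambda>x. norm (f x) powr p)"
    and AC: "abs_continuous g" and g: "integrable lborel g"
    and D[measurable]: "D \<in> borel_measurable borel"
    and der: "AE s in lborel. (g has_vector_derivative D s) (at s)"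
    and iD: "integrable lborel (\<lambda>s. \<bar>s\<bar> powr (1 / p) * norm (D s))"
  shows "fourier_pairing g f = (LINT t|lborel. f t * fourier_L1 g t)"
proof -
  have [measurable]: "g \<in> borel_measurable borel" using borel_measurable_integrable[OF g] by simp
  have Psi: "Psi f s = (LINT t|lborel. Psi_kernel s t * f t)" for s
    unfolding Psi_def by (rule integral_completion) measurable
  have [measurable]: "Psi f \<in> borel_measurable borel" unfolding Psi[abs_def] by measurable
  obtain C where C: "C \<ge> 0" "\<And>s. integrable lborel (\<lambda>t. Psi_kernel s t * f t)"
    "\<And>s. (LINT t|lborel. norm (Psi_kernel s t * f t)) \<le> C * \<bar>s\<bar> powr (1 / p)"
    using Psi_kernel_integral_bound[OF p f int] by metis
  have vd: "AE s in lebesgue. vector_derivative g (at s) = D s"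
    unfolding AE_completion_iff using der by eventually_elim (rule vector_derivative_at)
  have "(LINT s|lebesgue. Psi f s * vector_derivative g (at s)) = (LINT s|lebesgue. Psi f s * D s)"
  proof (rule integral_cong_AE)
    show "AE s in lebesgue. Psi f s * vector_derivative g (at s) = Psi f s * D s"
      using vd by eventually_elim simp
    show "(\<lambda>s. Psi f s * D s) \<in> borel_measurable lebesgue" by (intro measurable_completion) measurable
    then show "(\<lambda>s. Psi f s * vector_derivative g (at s)) \<in> borel_measurable lebesgue"
      by (rule measurable_lebesgue_AE_eq) (use vd in \<open>eventually_elim, simp\<close>)
  qed
  also have "\<dots> = (LINT s|lborel. Psi f s * D s)" by (rule integral_completion) measurable
  also have "\<dots> = (LINT s|lborel. LINT t|lborel. Psi_kernel s t * f t * D s)"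
    by (simp add: Psi)
  also have "\<dots> = (LINT t|lborel. LINT s|lborel. Psi_kernel s t * f t * D s)"
  proof (rule lborel_pair.Fubini_integral[symmetric], rule lborel_pair.Fubini_integrable)
    show "integrable lborel (\<lambda>s. LINT t|lborel. norm (case (s, t) of (s, t) \<Rightarrow> Psi_kernel s t * f t * D s))"
    proof (rule Bochner_Integration.integrable_bound)
      show "integrable lborel (\<lambda>s. C * (\<bar>s\<bar> powr (1 / p) * norm (D s)))" using iD by simp
      show "AE s in lborel. norm (LINT t|lborel. norm (case (s, t) of (s, t) \<Rightarrow> Psi_kernel s t * f t * D s))
          \<le> norm (C * (\<bar>s\<bar> powr (1 / p) * norm (D s)))"
      proof (rule AE_I2)
        fix s
        have "norm (LINT t|lborel. norm (case (s, t) of (s, t) \<Rightarrow> Psi_kernel s t * f t * D s))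
            = (LINT t|lborel. norm (Psi_kernel s t * f t)) * norm (D s)"
          by (simp add: norm_mult integral_nonneg_AE)
        also have "\<dots> \<le> (C * \<bar>s\<bar> powr (1 / p)) * norm (D s)" by (intro mult_right_mono C) auto
        also have "\<dots> \<le> norm (C * (\<bar>s\<bar> powr (1 / p) * norm (D s)))"
          by (simp only: real_norm_def mult.assoc abs_ge_self)
        finally show "norm (LINT t|lborel. norm (case (s, t) of (s, t) \<Rightarrow> Psi_kernel s t * f t * D s))
          \<le> norm (C * (\<bar>s\<bar> powr (1 / p) * norm (D s)))" .
      qed
    qed measurable
    show "AE s in lborel. integrable lborel (\<lambda>t. case (s, t) of (s, t) \<Rightarrow> Psi_kernel s t * f t * D s)"
      using C(2) by simp
  qed measurable
  also have "\<dots> = (LINT t|lborel. - (f t * fourier_L1 g t))"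
  proof (rule integral_cong_AE)
    \<comment> \<open>The point \<open>t = 0\<close>, where the kernel is the unbounded function
      \<open>s\<close>, is discarded as a null set.\<close>
    show "AE t in lborel. (LINT s|lborel. Psi_kernel s t * f t * D s) = - (f t * fourier_L1 g t)"
      using AE_lborel_singleton[of 0]
    proof eventually_elim
      case (elim t)
      have "(LINT s|lborel. Psi_kernel s t * f t * D s) = (LINT s|lborel. f t * (Psi_kernel s t * D s))"
        by (simp add: mult_ac)
      also have "\<dots> = f t * (LINT s|lborel. Psi_kernel s t * D s)" by (rule integral_mult_right_zero)
      also have "\<dots> = - (f t * fourier_L1 g t)"
        using Psi_kernel_integration_by_parts[OF p AC g D der iD] elim by simp
      finally show ?case .
    qed
  qed measurable
  finally show ?thesis by (simp add: fourier_pairing_def)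
qed

section \<open>Norm convergence of the summability means\<close>

text \<open>Fubini is used on products of \<open>lborel\<close>, so \<open>f\<close> and \<psi> are
  replaced by Borel functions equal to them almost everywhere; the transforms, being integrals, do
  not change.\<close>

lemma borel_representative:
  fixes f :: "real \<Rightarrow> complex"
  assumes f: "f \<in> borel_measurable lebesgue"
  obtains f' where "f' \<in> borel_measurable borel" "AE x in lborel. f x = f' x"
proof -
  obtain u where u: "u \<in> borel_measurable lborel" "AE x in lborel. Re (f x) = u x"
    using completion_ex_borel_measurable_real[of "\<lambda>x. Re (f x)" lborel] f by auto
  obtain v where v: "v \<in> borel_measurable lborel" "AE x in lborel. Im (f x) = v x"
    using completion_ex_borel_measurable_real[of "\<lambda>x. Im (f x)" lborel] f by auto
  have uv[measurable]: "u \<in> borel_measurable borel" "v \<in> borel_measurable borel" using u(1) v(1) by simp_all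
  show thesis
  proof (rule that[of "\<lambda>x. of_real (u x) + \<i> * of_real (v x)"])
    show "AE x in lborel. f x = of_real (u x) + \<i> * of_real (v x)"
      using u(2) v(2) by eventually_elim (metis complex_eq)
  qed measurable
qed

lemma AE_lborel_scale:
  fixes c :: real
  assumes "AE x in lborel. P x" "c \<noteq> 0"
  shows "AE x in lborel. P (c * x)"
proof -
  obtain N where N: "N \<in> null_sets lborel" "{x \<in> space lborel. \<not> P x} \<subseteq> N"
    using assms(1) unfolding eventually_ae_filter by blast
  then have [measurable]: "N \<in> sets borel" by auto
  have "AE x in lborel. x \<notin> N" using N(1) by (rule AE_not_in)
  then have "AE x in lborel. 0 + c * x \<notin> N"
    using \<open>c \<noteq> 0\<close> by (intro AE_borel_affine) auto
  then show ?thesis by eventually_elim (use N(2) in auto)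
qed

lemma fourier_L1_cong_AE:
  assumes [measurable]: "\<psi>' \<in> borel_measurable borel" and eq: "AE x in lborel. \<psi> x = \<psi>' x"
  shows "fourier_L1 \<psi> = fourier_L1 \<psi>'"
proof
  fix s
  have eq': "AE x in lebesgue. exp (- (\<i> * of_real (s * x))) * \<psi> x = exp (- (\<i> * of_real (s * x))) * \<psi>' x"
    unfolding AE_completion_iff using eq by eventually_elim simp
  have m: "(\<lambda>x. exp (- (\<i> * of_real (s * x))) * \<psi>' x) \<in> borel_measurable lebesgue"
    by (intro measurable_completion) measurable
  show "fourier_L1 \<psi> s = fourier_L1 \<psi>' s" unfolding fourier_L1_def
    by (rule integral_cong_AE[OF measurable_lebesgue_AE_eq[OF m eq'] m eq'])
qed

lemma Psi_cong_AE:
  assumes [measurable]: "f' \<in> borel_measurable borel" and eq: "AE x in lborel. f x = f' x"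
  shows "Psi f = Psi f'"
proof
  fix s
  have eq': "AE x in lebesgue. Psi_kernel s x * f x = Psi_kernel s x * f' x"
    unfolding AE_completion_iff using eq by eventually_elim simp
  have m: "(\<lambda>x. Psi_kernel s x * f' x) \<in> borel_measurable lebesgue"
    by (intro measurable_completion) measurable
  show "Psi f s = Psi f' s" unfolding Psi_def
    by (rule integral_cong_AE[OF measurable_lebesgue_AE_eq[OF m eq'] m eq'])
qed

section \<open>The means as convolutions\<close>

lemma summability_kernel_eq:
  assumes [measurable]: "\<psi>' \<in> borel_measurable borel" and eq: "AE x in lborel. \<psi> x = \<psi>' x" and "a > 0"
  shows "summability_kernel \<psi> a s = fourier_L1 \<psi>' (a * s)"
proof -
  have [measurable]: "dilate \<psi>' a \<in> borel_measurable borel" unfolding dilate_def by measurable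
  have "AE x in lborel. \<psi> (1 / a * x) = \<psi>' (1 / a * x)" using eq \<open>a > 0\<close> by (intro AE_lborel_scale) auto
  then have "AE x in lborel. dilate \<psi> a x = dilate \<psi>' a x"
    by eventually_elim (simp add: dilate_def)
  then have "summability_kernel \<psi> a s = fourier_L1 (dilate \<psi>' a) s"
    unfolding summability_kernel_def by (subst fourier_L1_cong_AE[of "dilate \<psi>' a"]) auto
  also have "\<dots> = (LINT t|lborel. exp (- (\<i> * of_real (s * t))) * (\<psi>' (t / a) / of_real a))"
    by (simp add: fourier_L1_lborel dilate_def)
  also have "\<dots> = \<bar>a\<bar> *\<^sub>R (LINT t|lborel. exp (- (\<i> * of_real (s * (0 + a * t)))) * (\<psi>' ((0 + a * t) / a) / of_real a))"
    using \<open>a > 0\<close> by (intro lborel_integral_real_affine) simp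
  also have "(LINT t|lborel. exp (- (\<i> * of_real (s * (0 + a * t)))) * (\<psi>' ((0 + a * t) / a) / of_real a))
      = (LINT t|lborel. exp (- (\<i> * of_real (a * s * t))) * \<psi>' t / of_real a)"
    using \<open>a > 0\<close> by (intro Bochner_Integration.integral_cong refl) (simp add: mult_ac)
  also have "\<dots> = (LINT t|lborel. exp (- (\<i> * of_real (a * s * t))) * \<psi>' t) / of_real a"
    by (rule integral_divide_zero)
  also have "\<bar>a\<bar> *\<^sub>R \<dots> = fourier_L1 \<psi>' (a * s)"
    using \<open>a > 0\<close> by (simp add: fourier_L1_lborel scaleR_conv_of_real)
  finally show ?thesis .
qed

lemma char_fun_has_vector_derivative:
  "(char_fun x has_vector_derivative (\<i> * of_real x * char_fun x s)) (at s)"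
proof -
  have "((\<lambda>z. exp (\<i> * (of_real x * z))) has_field_derivative
      (\<i> * of_real x * exp (\<i> * (of_real x * of_real s)))) (at (of_real s))"
    by (auto intro!: derivative_eq_intros simp: mult_ac)
  from has_vector_derivative_real_field[OF this] show ?thesis
    by (simp add: char_fun_def[abs_def])
qed

text \<open>Up to the factor \<open>2 * pi / a\<close>, the right-hand side is the inverse transform
  of \<open>K\<close> at \<open>(x - t) / a\<close>: modulation by \<open>x\<close> becomes a
  translation and dilation of the argument becomes a dilation of the result.\<close>

lemma fourier_L1_char_fun_scale:
  assumes [measurable]: "K \<in> borel_measurable borel" and "a > 0"
  shows "fourier_L1 (\<lambda>s. char_fun x s * K (a * s)) t
    = 1 / of_real a * (LINT s|lborel. K s * exp (\<i> * of_real (s * ((x - t) / a))))"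
proof -
  let ?F = "\<lambda>s. exp (- (\<i> * of_real (t * s))) * (exp (\<i> * of_real (x * s)) * K (a * s))"
  have "fourier_L1 (\<lambda>s. char_fun x s * K (a * s)) t = (LINT s|lborel. ?F s)"
    unfolding char_fun_def by (rule fourier_L1_lborel) measurable
  also have "\<dots> = \<bar>1 / a\<bar> *\<^sub>R (LINT s|lborel. ?F (0 + 1 / a * s))"
    using \<open>a > 0\<close> by (intro lborel_integral_real_affine) simp
  also have "(LINT s|lborel. ?F (0 + 1 / a * s)) = (LINT s|lborel. K s * exp (\<i> * of_real (s * ((x - t) / a))))"
  proof (intro Bochner_Integration.integral_cong refl)
    fix s
    have eq: "exp (- (\<i> * of_real (t * (s / a)))) * exp (\<i> * of_real (x * (s / a))) = exp (\<i> * of_real (s * ((x - t) / a)))"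
      unfolding exp_add[symmetric] using \<open>a > 0\<close> by (simp add: field_simps)
    have "?F (0 + 1 / a * s) = (exp (- (\<i> * of_real (t * (s / a)))) * exp (\<i> * of_real (x * (s / a)))) * K s"
      using \<open>a > 0\<close> by (simp add: mult.assoc)
    then show "?F (0 + 1 / a * s) = K s * exp (\<i> * of_real (s * ((x - t) / a)))"
      unfolding eq by (rule trans) (rule mult.commute)
  qed
  finally show ?thesis using \<open>a > 0\<close> by (simp add: scaleR_conv_of_real)
qed

text \<open>Stated with \<phi>, the inverse transform of \<open>K\<close>, in place of the original
  kernel, which inversion recovers only almost everywhere. In this form the identity holds at every
  \<open>x\<close>.\<close>

lemma summability_mean_eq_convolution:
  fixes f \<psi> f' \<psi>' D :: "real \<Rightarrow> complex"
  defines "K \<equiv> fourier_L1 \<psi>'"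
  defines "\<phi> \<equiv> \<lambda>y. 1 / (2 * of_real pi) * (LINT s|lborel. K s * exp (\<i> * of_real (s * y)))"
  assumes p: "1 \<le> p" and f'[measurable]: "f' \<in> borel_measurable borel"
    and feq: "AE x in lborel. f x = f' x"
    and int: "integrable lborel (\<lambda>x. norm (f' x) powr p)"
    and \<psi>'[measurable]: "\<psi>' \<in> borel_measurable borel" and \<psi>eq: "AE x in lborel. \<psi> x = \<psi>' x"
    and AC: "abs_continuous K" and K: "integrable lborel K"
    and D[measurable]: "D \<in> borel_measurable borel"
    and der: "AE s in lborel. (K has_vector_derivative D s) (at s)"
    and iK: "integrable lborel (\<lambda>s. \<bar>s\<bar> powr (1 / p) * norm (K s))"
    and iD: "integrable lborel (\<lambda>s. \<bar>s\<bar> powr (1 / p) * norm (D s))"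
    and a: "a > 0"
  shows "summability_mean \<psi> a f x = (LINT y|lborel. f' (x - a * y) * \<phi> y)"
proof -
  have [measurable]: "K \<in> borel_measurable borel" unfolding K_def by measurable
  have [measurable]: "\<phi> \<in> borel_measurable borel" unfolding \<phi>_def by measurable
  define g where "g s = char_fun x s * K (a * s)" for s
  define Dg where "Dg s = char_fun x s * (of_real a * D (a * s)) + \<i> * of_real x * char_fun x s * K (a * s)" for s
  have nc: "norm (char_fun x s) = 1" for s by (simp add: char_fun_def)
  have [measurable]: "char_fun x \<in> borel_measurable borel" unfolding char_fun_def by measurable
  have [measurable]: "g \<in> borel_measurable borel" unfolding g_def by measurable
  have [measurable]: "Dg \<in> borel_measurable borel" unfolding Dg_def by measurable
  have Ka: "integrable lborel (\<lambda>s. K (a * s))"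
    using lborel_integrable_real_affine[OF K, of a 0] a by simp
  have g: "integrable lborel g"
    by (rule Bochner_Integration.integrable_bound[OF Ka]) (auto simp: g_def norm_mult nc)
  have ACg: "abs_continuous g" unfolding g_def
  proof (rule abs_continuous_mult_Lipschitz[OF abs_continuous_scale[OF AC a]])
    have "norm (char_fun x v - char_fun x u) \<le> \<bar>x\<bar> * \<bar>v - u\<bar>" for u v
      using norm_iexp_diff_le[of "x * v" "x * u"]
      by (simp add: char_fun_def abs_mult[symmetric] right_diff_distrib)
    then show "\<exists>L. \<forall>u\<in>{c..d}. \<forall>v\<in>{c..d}. norm (char_fun x v - char_fun x u) \<le> L * \<bar>v - u\<bar>" for c d
      by blast
  qed
  have derg: "AE s in lborel. (g has_vector_derivative Dg s) (at s)"
    using AE_lborel_scale[OF der a[THEN less_imp_neq, symmetric]]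
  proof eventually_elim
    case (elim s)
    have "((\<lambda>s. a * s) has_vector_derivative a) (at s)"
      by (auto intro!: derivative_eq_intros simp: has_real_derivative_iff_has_vector_derivative[symmetric])
    from vector_diff_chain_at[OF this elim]
    have "((\<lambda>s. K (a * s)) has_vector_derivative (of_real a * D (a * s))) (at s)"
      by (simp add: o_def scaleR_conv_of_real)
    from has_vector_derivative_mult[OF char_fun_has_vector_derivative this]
    show ?case by (simp add: g_def[abs_def] Dg_def)
  qed
  \<comment> \<open>The product rule for \<open>g\<close> leaves a term in \<open>K\<close> with
    factor \<open>x\<close> beside the one in \<open>D\<close>, so both weighted integrability
    conditions enter. The constant \<open>?c\<close> compensates for moving the weight from
    \<open>s\<close> to \<open>a * s\<close>.\<close>
  have iDg: "integrable lborel (\<lambda>s. \<bar>s\<bar> powr (1 / p) * norm (Dg s))"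
  proof (rule Bochner_Integration.integrable_bound)
    let ?c = "(1 / a) powr (1 / p)"
    let ?b = "\<lambda>s. ?c * a * (\<bar>a * s\<bar> powr (1 / p) * norm (D (a * s))) + ?c * \<bar>x\<bar> * (\<bar>a * s\<bar> powr (1 / p) * norm (K (a * s)))"
    show "integrable lborel ?b"
      using lborel_integrable_real_affine[OF iD, of a 0] lborel_integrable_real_affine[OF iK, of a 0] a
      by (intro Bochner_Integration.integrable_add integrable_mult_right) simp_all
    show "AE s in lborel. norm (\<bar>s\<bar> powr (1 / p) * norm (Dg s)) \<le> norm (?b s)"
    proof (rule AE_I2)
      fix s
      have sc: "\<bar>s\<bar> powr (1 / p) = ?c * \<bar>a * s\<bar> powr (1 / p)"
        using a by (subst powr_mult[symmetric]) (auto simp: abs_mult)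
      have "norm (Dg s) \<le> a * norm (D (a * s)) + \<bar>x\<bar> * norm (K (a * s))"
        unfolding Dg_def by (rule order_trans[OF norm_triangle_ineq]) (use a in \<open>simp add: norm_mult nc\<close>)
      then have "\<bar>s\<bar> powr (1 / p) * norm (Dg s) \<le> \<bar>s\<bar> powr (1 / p) * (a * norm (D (a * s)) + \<bar>x\<bar> * norm (K (a * s)))"
        by (intro mult_left_mono) auto
      also have "\<dots> = ?b s" unfolding sc by (simp add: algebra_simps)
      also have "\<dots> \<le> norm (?b s)" by (simp only: real_norm_def abs_ge_self)
      finally show "norm (\<bar>s\<bar> powr (1 / p) * norm (Dg s)) \<le> norm (?b s)" by simp
    qed
  qed measurable
  have "fourier_pairing (\<lambda>s. char_fun x s * summability_kernel \<psi> a s) f = fourier_pairing g f'"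
    unfolding fourier_pairing_def g_def K_def
    by (simp only: summability_kernel_eq[OF \<psi>' \<psi>eq a] Psi_cong_AE[OF f' feq])
  also have "\<dots> = (LINT t|lborel. f' t * fourier_L1 g t)"
    by (rule fourier_pairing_eq[OF p f' int ACg g _ derg iDg]) measurable
  also have "\<dots> = (LINT t|lborel. f' t * (2 * of_real pi / of_real a * \<phi> ((x - t) / a)))"
    unfolding g_def by (subst fourier_L1_char_fun_scale) (use a in \<open>simp_all add: \<phi>_def\<close>)
  also have "\<dots> = \<bar>- a\<bar> *\<^sub>R (LINT y|lborel. f' (x + - a * y) * (2 * of_real pi / of_real a * \<phi> ((x - (x + - a * y)) / a)))"
    using a by (intro lborel_integral_real_affine) simp
  also have "(LINT y|lborel. f' (x + - a * y) * (2 * of_real pi / of_real a * \<phi> ((x - (x + - a * y)) / a)))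
      = (LINT y|lborel. 2 * of_real pi / of_real a * (f' (x - a * y) * \<phi> y))"
    using a by (intro Bochner_Integration.integral_cong refl) simp
  also have "\<dots> = 2 * of_real pi / of_real a * (LINT y|lborel. f' (x - a * y) * \<phi> y)"
    by (rule integral_mult_right_zero)
  finally show ?thesis using a by (simp add: summability_mean_def scaleR_conv_of_real)
qed

text \<open>On \<open>{-1..1}\<close> the transform is bounded by the L^1 norm of \<psi>; outside,
  the weight is at least 1.\<close>

lemma fourier_L1_integrable:
  assumes p: "1 \<le> p" and [measurable]: "\<psi> \<in> borel_measurable borel" and \<psi>: "integrable lborel \<psi>"
    and iK: "integrable lborel (\<lambda>s. \<bar>s\<bar> powr (1 / p) * norm (fourier_L1 \<psi> s))"
  shows "integrable lborel (fourier_L1 \<psi>)"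
proof (rule Bochner_Integration.integrable_bound)
  define M where "M = (LINT t|lborel. norm (\<psi> t))"
  have "M \<ge> 0" by (simp add: M_def)
  show "integrable lborel (\<lambda>s. M * indicator {-1..1} s + \<bar>s\<bar> powr (1 / p) * norm (fourier_L1 \<psi> s))"
    using iK by simp
  have M: "norm (fourier_L1 \<psi> s) \<le> M" for s
    using integral_norm_bound[of lborel "\<lambda>t. exp (- (\<i> * of_real (s * t))) * \<psi> t"]
    by (simp add: fourier_L1_lborel norm_mult M_def)
  show "AE s in lborel. norm (fourier_L1 \<psi> s) \<le> norm (M * indicator {-1..1} s + \<bar>s\<bar> powr (1 / p) * norm (fourier_L1 \<psi> s))"
  proof (rule AE_I2)
    fix s
    have "norm (fourier_L1 \<psi> s) \<le> M * indicator {-1..1} s + \<bar>s\<bar> powr (1 / p) * norm (fourier_L1 \<psi> s)"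
    proof (cases "s \<in> {-1..1}")
      case True
      then show ?thesis using M[of s] by (simp add: add_increasing2)
    next
      case False
      then have "1 \<le> \<bar>s\<bar> powr (1 / p)" using p by (intro ge_one_powr_ge_zero) auto
      then have "1 * norm (fourier_L1 \<psi> s) \<le> \<bar>s\<bar> powr (1 / p) * norm (fourier_L1 \<psi> s)" by (intro mult_right_mono) auto
      then show ?thesis using False by simp
    qed
    then show "norm (fourier_L1 \<psi> s) \<le> norm (M * indicator {-1..1} s + \<bar>s\<bar> powr (1 / p) * norm (fourier_L1 \<psi> s))"
      by (simp only: real_norm_def)
  qed
qed measurable

text \<open>Membership in \<open>Lp_space p\<close> is part of the conclusion because
  \<open>Lp_norm\<close> would be 0 on a function whose \<open>p\<close>-th power is not integrable,
  which would make the limit meaningless.\<close>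

theorem theorem6p4:
  fixes p :: real and f \<psi> :: "real \<Rightarrow> complex"
  assumes "1 \<le> p"
    and "f \<in> Lp_space p"
    and "integrable lebesgue \<psi>"
    and "(LINT t|lebesgue. \<psi> t) = 1"
    and "abs_continuous (fourier_L1 \<psi>)"
    and "integrable lebesgue (\<lambda>s. \<bar>s\<bar> powr (1 / p) * norm (fourier_L1 \<psi> s))"
    and "integrable lebesgue
           (\<lambda>s. \<bar>s\<bar> powr (1 / p) * norm (vector_derivative (fourier_L1 \<psi>) (at s)))"
  shows "(\<forall>a>0. (\<lambda>x. f x - summability_mean \<psi> a f x) \<in> Lp_space p) \<and>
         ((\<lambda>a. Lp_norm p (\<lambda>x. f x - summability_mean \<psi> a f x)) \<longlongrightarrow> 0) (at_right 0)"
proof -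
  have fm: "f \<in> borel_measurable lebesgue" and fi: "integrable lebesgue (\<lambda>x. norm (f x) powr p)"
    using assms(2) by (auto simp: Lp_space_def)
  obtain f' where f'[measurable]: "f' \<in> borel_measurable borel" and feq: "AE x in lborel. f x = f' x"
    using borel_representative[OF fm] by metis
  obtain \<psi>' where \<psi>'[measurable]: "\<psi>' \<in> borel_measurable borel" and \<psi>eq: "AE x in lborel. \<psi> x = \<psi>' x"
    using borel_representative[OF borel_measurable_integrable[OF assms(3)]] by metis
  define K where "K = fourier_L1 \<psi>'"
  have KE: "fourier_L1 \<psi> = K" unfolding K_def by (rule fourier_L1_cong_AE[OF \<psi>' \<psi>eq])
  have [measurable]: "K \<in> borel_measurable borel" unfolding K_def by measurable
  have int: "integrable lborel (\<lambda>x. norm (f' x) powr p)"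
  proof -
    have "integrable lebesgue (\<lambda>x. norm (f' x) powr p)"
    proof (rule integrable_cong_AE_imp[OF fi])
      show "(\<lambda>x. norm (f' x) powr p) \<in> borel_measurable lebesgue" by (intro measurable_completion) measurable
      show "AE x in lebesgue. norm (f x) powr p = norm (f' x) powr p"
        unfolding AE_completion_iff using feq by eventually_elim simp
    qed
    then show ?thesis by (simp add: integrable_completion)
  qed
  have \<psi>eq': "AE x in lebesgue. \<psi>' x = \<psi> x" unfolding AE_completion_iff using \<psi>eq by eventually_elim simp
  have \<psi>'l: "\<psi>' \<in> borel_measurable lebesgue" using \<psi>' by (intro measurable_completion) simp
  have \<psi>'i: "integrable lborel \<psi>'"
    using integrable_cong_AE_imp[OF assms(3) \<psi>'l] \<psi>eq by (simp add: AE_completion_iff integrable_completion)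
  have \<psi>'1: "(LINT t|lborel. \<psi>' t) = 1"
    using integral_cong_AE[OF \<psi>'l borel_measurable_integrable[OF assms(3)] \<psi>eq'] assms(4)
    by (simp add: integral_completion)
  have iK: "integrable lborel (\<lambda>s. \<bar>s\<bar> powr (1 / p) * norm (K s))"
    using assms(6) unfolding KE by (simp add: integrable_completion)
  have AC: "abs_continuous K" using assms(5) by (simp add: KE)
  have K: "integrable lborel K"
    using fourier_L1_integrable[OF assms(1) \<psi>' \<psi>'i] iK by (simp add: K_def)
  obtain D where D[measurable]: "D \<in> borel_measurable borel" and der: "AE s in lborel. (K has_vector_derivative D s) (at s)"
    using abs_continuous_borel_derivative[OF AC] by metis
  have iD: "integrable lborel (\<lambda>s. \<bar>s\<bar> powr (1 / p) * norm (D s))"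
  proof -
    have "integrable lebesgue (\<lambda>s. \<bar>s\<bar> powr (1 / p) * norm (D s))"
    proof (rule integrable_cong_AE_imp[OF assms(7)])
      show "(\<lambda>s. \<bar>s\<bar> powr (1 / p) * norm (D s)) \<in> borel_measurable lebesgue" by (intro measurable_completion) measurable
      show "AE s in lebesgue. \<bar>s\<bar> powr (1 / p) * norm (vector_derivative (fourier_L1 \<psi>) (at s)) = \<bar>s\<bar> powr (1 / p) * norm (D s)"
        unfolding AE_completion_iff KE using der by eventually_elim (simp add: vector_derivative_at)
    qed
    then show ?thesis by (simp add: integrable_completion)
  qed
  define \<phi> where "\<phi> = (\<lambda>y. 1 / (2 * of_real pi) * (LINT s|lborel. K s * exp (\<i> * of_real (s * y))))"
  have [measurable]: "\<phi> \<in> borel_measurable borel" unfolding \<phi>_def by measurable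
  have \<phi>eq: "AE y in lborel. \<psi>' y = \<phi> y"
    using fourier_inversion_AE[OF \<psi>'i] K by (simp add: K_def \<phi>_def)
  have \<phi>i: "integrable lborel \<phi>"
    using integrable_cong_AE_imp[OF \<psi>'i, of \<phi>] \<phi>eq by simp
  \<comment> \<open>By inversion \<phi> inherits integrability and total integral 1 from the kernel,
    as the approximate identity theorem demands.\<close>
  have \<phi>1: "(LINT y|lborel. \<phi> y) = 1"
    using integral_cong_AE[of \<psi>' lborel \<phi>] \<phi>eq \<psi>'1 by simp
  define C where "C a x = (LINT y|lborel. f' (x - a * y) * \<phi> y)" for a x
  have [measurable]: "C a \<in> borel_measurable borel" for a unfolding C_def by measurable
  have mean: "summability_mean \<psi> a f x = C a x" if "a > 0" for a x
    unfolding C_def \<phi>_def K_def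
    by (rule summability_mean_eq_convolution[OF assms(1) f' feq int \<psi>' \<psi>eq AC[unfolded K_def] K[unfolded K_def] D
          der[unfolded K_def] iK[unfolded K_def] iD that])
  have diff: "AE x in lebesgue. f x - summability_mean \<psi> a f x = f' x - C a x" if "a > 0" for a
    unfolding AE_completion_iff mean[OF that] using feq by eventually_elim simp
  have dm: "(\<lambda>x. f' x - C a x) \<in> borel_measurable lebesgue" for a by (intro measurable_completion) measurable
  have dm': "(\<lambda>x. f x - summability_mean \<psi> a f x) \<in> borel_measurable lebesgue" if "a > 0" for a
    by (rule measurable_lebesgue_AE_eq[OF dm diff[OF that]])
  have pm: "(\<lambda>x. norm (f' x - C a x) powr p) \<in> borel_measurable lborel" for a by measurable
  have ci: "integrable lebesgue (\<lambda>x. norm (f' x - C a x) powr p)" for a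
    using approximate_identity_integrable[OF assms(1) f' int \<phi>i \<phi>1, of a]
    unfolding C_def[symmetric] by (subst integrable_completion) measurable
  have pdiff: "AE x in lebesgue. norm (f x - summability_mean \<psi> a f x) powr p = norm (f' x - C a x) powr p" if "a > 0" for a
    using diff[OF that] by eventually_elim simp
  have pdiff': "AE x in lebesgue. norm (f' x - C a x) powr p = norm (f x - summability_mean \<psi> a f x) powr p" if "a > 0" for a
    using pdiff[OF that] by eventually_elim simp
  have pm': "(\<lambda>x. norm (f x - summability_mean \<psi> a f x) powr p) \<in> borel_measurable lebesgue" if "a > 0" for a
    using dm'[OF that] by measurable
  have mem: "(\<lambda>x. f x - summability_mean \<psi> a f x) \<in> Lp_space p" if "a > 0" for a
    unfolding Lp_space_def using dm'[OF that] integrable_cong_AE_imp[OF ci pm'[OF that] pdiff'[OF that]] by simp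
  have norm: "Lp_norm p (\<lambda>x. f x - summability_mean \<psi> a f x) = (LINT x|lborel. norm (f' x - C a x) powr p) powr (1 / p)"
    if "a > 0" for a
    unfolding Lp_norm_def
    using integral_cong_AE[OF pm'[OF that] measurable_completion[OF pm] pdiff[OF that]]
    by (simp add: integral_completion[OF pm])
  have "((\<lambda>a. LINT x|lborel. norm (f' x - C a x) powr p) \<longlongrightarrow> 0) (at_right 0)"
    using approximate_identity[OF assms(1) f' int \<phi>i \<phi>1] by (simp add: C_def)
  \<comment> \<open>Up to here only \<open>p\<close>-th powers occur; the root is taken at the end,
    and \<open>1 / p > 0\<close> lets it pass to the limit 0.\<close>
  then have "((\<lambda>a. (LINT x|lborel. norm (f' x - C a x) powr p) powr (1 / p)) \<longlongrightarrow> 0 powr (1 / p)) (at_right 0)"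
    using assms(1) by (intro tendsto_powr') (auto intro!: always_eventually integral_nonneg_AE)
  moreover have "\<forall>\<^sub>F a in at_right 0. (LINT x|lborel. norm (f' x - C a x) powr p) powr (1 / p)
      = Lp_norm p (\<lambda>x. f x - summability_mean \<psi> a f x)"
    using norm by (auto simp: eventually_at_right_field intro: exI[of _ 1])
  ultimately have "((\<lambda>a. Lp_norm p (\<lambda>x. f x - summability_mean \<psi> a f x)) \<longlongrightarrow> 0 powr (1 / p)) (at_right 0)"
    by (rule Lim_transform_eventually)
  then show ?thesis using mem by simp
qed

end
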